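(* Let $p\ge 1$ and let $D\in\mathcal{P}_p(\beta)$ where $0<\beta<\frac12$. Then $E_D$ is a closed set of Lebesgue measure zero, and its convergence exponent satisfies $$\dim E_D\le \tau(E_D)\le \frac{1-2\beta}{1-\beta},$$ where $\dim E_D$ is the Hausdorff dimension of $E_D$. Moreover, if $D\in\mathcal{P}_p(\frac12)$, then $E_D=\emptyset$, i.e., the discrete spectrum $\sigma_{\rm d}(D)$ is finite.
   Context: A complex matrix $D=\|d_{ij}\|_{i,j=1}^\infty$ is called banded of order $p$ ($p$-banded) if $d_{ij}=0$ for $|i-j|>p$ and $d_{ij}\ne0$ for $|i-j|=p$. By convention, for indices with $\min(i,j)\le 0$ one sets $d_{ij}=1$ if $|i-j|=p$ and $d_{ij}=0$ if $|i-j|\neq p$. For $0<\beta<1$, a $p$-banded matrix $D$ belongs to the class $\mathcal{P}_p(\beta)$ if there are constants $C_1,C_2>0$ (depending on $D$) such that for all $n\in\mathbb{N}=\{1,2,\dots\}$ $$q_n:=|d_{n,n-p}-1|+\sum_{r=-p+1}^{p-1}|d_{n,n+r}|+|d_{n,n+p}-1|\le C_1\exp(-C_2 n^\beta).$$ Such a $D$ defines a bounded operator on $\ell^2(\mathbb{N})$ which is a compact perturbation of $D_0=S^p+(S^* )^p$, $S$ the one-sided shift, and $\sigma(D_0)=[-2,2]$. Hence $\sigma(D)=[-2,2]\cup\sigma_{\rm d}(D)$, where the discrete spectrum $\sigma_{\rm d}(D)$ is the at most countable set of eigenvalues (of finite algebraic multiplicity) of $D$ in $\mathbb{C}\setminus[-2,2]$,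 whose accumulation points all lie in $[-2,2]$. $E_D\subset[-2,2]$ denotes the set of all accumulation points of $\sigma_{\rm d}(D)$. The convergence exponent (Taylor–Besicovitch index) of a closed set $F\subset[-2,2]$ is $\tau(F):=\inf\{\varepsilon>0:\ \sum_j|l_j|^\varepsilon<\infty\}$, where $\{l_j\}$ are the adjacent intervals of $F$ (the connected components of $[-2,2]\setminus F$) and $|l_j|$ is the length of $l_j$. *)

theory Defs
  imports "HOL-Analysis.Analysis"
begin

text \<open>
  An infinite matrix indexed by \<open>{1, 2, \<dots>}\<close> is a function \<open>nat \<Rightarrow> nat \<Rightarrow> complex\<close>
  whose values at index \<open>0\<close> are never used.
\<close>

definition banded :: "nat \<Rightarrow> (nat \<Rightarrow> nat \<Rightarrow> complex) \<Rightarrow> bool" where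
  "banded p D \<longleftrightarrow>
     (\<forall>i\<ge>1. \<forall>j\<ge>1. (\<bar>int i - int j\<bar> > int p \<longrightarrow> D i j = 0) \<and>
                  (\<bar>int i - int j\<bar> = int p \<longrightarrow> D i j \<noteq> 0))"

definition ext_entry :: "nat \<Rightarrow> (nat \<Rightarrow> nat \<Rightarrow> complex) \<Rightarrow> int \<Rightarrow> int \<Rightarrow> complex" where
  "ext_entry p D i j =
     (if min i j \<le> 0 then (if \<bar>i - j\<bar> = int p then 1 else 0) else D (nat i) (nat j))"

definition band_dev :: "nat \<Rightarrow> (nat \<Rightarrow> nat \<Rightarrow> complex) \<Rightarrow> nat \<Rightarrow> real" where
  "band_dev p D n =
     cmod (ext_entry p D (int n) (int n - int p) - 1)
     + (\<Sum>r\<in>{- int p + 1..int p - 1}. cmod (ext_entry p D (int n) (int n + r)))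
     + cmod (ext_entry p D (int n) (int n + int p) - 1)"

definition P_class :: "nat \<Rightarrow> real \<Rightarrow> (nat \<Rightarrow> nat \<Rightarrow> complex) set" where
  "P_class p \<beta> = {D. banded p D \<and>
     (\<exists>C1>0. \<exists>C2>0. \<forall>n\<ge>1. band_dev p D n \<le> C1 * exp (- C2 * real n powr \<beta>))}"

text \<open>
  The space \<open>\<ell>\<^sup>2\<close> over \<open>{1, 2, \<dots>}\<close>: the unused coordinate \<open>0\<close> is pinned to \<open>0\<close>, so that
  sequences are determined by their coordinates of index at least \<open>1\<close>.
\<close>

definition l2 :: "(nat \<Rightarrow> complex) set" where
  "l2 = {x. x 0 = 0 \<and> summable (\<lambda>n. (cmod (x n))\<^sup>2)}"

definition mat_op :: "(nat \<Rightarrow> nat \<Rightarrow> complex) \<Rightarrow> (nat \<Rightarrow> complex) \<Rightarrow> nat \<Rightarrow> complex" where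
  "mat_op D x = (\<lambda>i. if i = 0 then 0 else (\<Sum>\<^sub>\<infinity>j\<in>{1..}. D i j * x j))"

definition shift_op :: "(nat \<Rightarrow> nat \<Rightarrow> complex) \<Rightarrow> complex \<Rightarrow> (nat \<Rightarrow> complex) \<Rightarrow> nat \<Rightarrow> complex" where
  "shift_op D z x = (\<lambda>i. mat_op D x i - z * x i)"

definition is_eigenvalue :: "(nat \<Rightarrow> nat \<Rightarrow> complex) \<Rightarrow> complex \<Rightarrow> bool" where
  "is_eigenvalue D z \<longleftrightarrow> (\<exists>x\<in>l2. x \<noteq> (\<lambda>_. 0) \<and> mat_op D x = (\<lambda>i. z * x i))"

definition root_space :: "(nat \<Rightarrow> nat \<Rightarrow> complex) \<Rightarrow> complex \<Rightarrow> (nat \<Rightarrow> complex) set" where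
  "root_space D z = {x \<in> l2. \<exists>k. (shift_op D z ^^ k) x = (\<lambda>_. 0)}"

text \<open>
  The algebraic multiplicity of \<open>z\<close> is the complex dimension of \<open>root_space D z\<close>; it is finite
  iff the root space is spanned by finitely many of its elements.
\<close>

definition finite_alg_mult :: "(nat \<Rightarrow> nat \<Rightarrow> complex) \<Rightarrow> complex \<Rightarrow> bool" where
  "finite_alg_mult D z \<longleftrightarrow>
     (\<exists>B. finite B \<and> B \<subseteq> root_space D z \<and>
          (\<forall>x\<in>root_space D z. \<exists>c :: (nat \<Rightarrow> complex) \<Rightarrow> complex. x = (\<lambda>i. \<Sum>b\<in>B. c b * b i)))"

definition discrete_spectrum :: "(nat \<Rightarrow> nat \<Rightarrow> complex) \<Rightarrow> complex set" where
  "discrete_spectrum D =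
     {z. z \<notin> complex_of_real ` {-2..2} \<and> is_eigenvalue D z \<and> finite_alg_mult D z}"

definition E_set :: "(nat \<Rightarrow> nat \<Rightarrow> complex) \<Rightarrow> complex set" where
  "E_set D = {z. z islimpt discrete_spectrum D}"

text \<open>
  For a closed set \<open>F \<subseteq> [-2, 2]\<close>; the components of \<open>[-2, 2] - F\<close> are intervals, whose
  Lebesgue measure is their length.
\<close>

definition convergence_exponent :: "real set \<Rightarrow> ereal" where
  "convergence_exponent F =
     (INF \<epsilon>\<in>{\<epsilon>::real. \<epsilon> > 0 \<and>
        (\<lambda>l. (measure lborel l) powr \<epsilon>) summable_on components ({-2..2} - F)}. ereal \<epsilon>)"

text \<open>
  Hausdorff measure with countable covers indexed by \<open>nat\<close>. Only exponents \<open>s > 0\<close> are used: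
  then empty sets contribute \<open>0\<close>, so finite covers are included. Boundedness is required
  because \<open>diameter\<close> is meaningful only for bounded sets.
\<close>

definition hausdorff_premeasure :: "real \<Rightarrow> real \<Rightarrow> 'a::metric_space set \<Rightarrow> ennreal" where
  "hausdorff_premeasure s \<delta> A =
     (INF U\<in>{U :: nat \<Rightarrow> 'a set. A \<subseteq> (\<Union>i. U i) \<and> (\<forall>i. bounded (U i) \<and> diameter (U i) \<le> \<delta>)}.
        \<Sum>i. ennreal (diameter (U i) powr s))"

definition hausdorff_measure :: "real \<Rightarrow> 'a::metric_space set \<Rightarrow> ennreal" where
  "hausdorff_measure s A = (SUP \<delta>\<in>{0<..}. hausdorff_premeasure s \<delta> A)"

definition hausdorff_dim :: "'a::metric_space set \<Rightarrow> ereal" where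
  "hausdorff_dim A = (INF s\<in>{s::real. s > 0 \<and> hausdorff_measure s A = 0}. ereal s)"

end

theory Submission
  imports Defs "HOL-Complex_Analysis.Complex_Analysis" "HOL-Real_Asymp.Real_Asymp"
begin

text \<open>
  Write an eigenvalue off \<open>[-2, 2]\<close> as \<open>z + 1 / z\<close> with \<open>0 < |z| < 1\<close>. Inverting the free operator
  turns the eigenvalue equation into \<open>y = K(z) y\<close>, where the entries of the infinite matrix \<open>K\<close> are
  polynomials in \<open>z\<close> without constant term and are summable in a coefficient norm with the
  submultiplicative weights \<open>exp (\<kappa> k\<^sup>\<beta>)\<close>. Its Fredholm determinant is therefore a power series \<open>F\<close> with
  \<open>F(0) = 1\<close> and coefficients \<open>O(exp (-\<kappa> k\<^sup>\<beta>))\<close>, and \<open>F(z) = 0\<close> at every eigenvalue.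

  At an accumulation point \<open>\<zeta>\<close> of zeros, necessarily on the unit circle, all Taylor coefficients of
  \<open>F\<close> vanish, and optimizing the order of the Taylor remainder gives
  \<open>|F(z)| \<le> C exp (-c |z - \<zeta>| powr (-\<alpha>))\<close> with \<open>\<alpha> = \<beta> / (1 - \<beta>)\<close>. Since \<open>F(0) = 1\<close>, the average of
  \<open>ln |F|\<close> over the circle is not \<open>-\<infinity>\<close>. This bounds \<open>\<Sum> |l| powr (1 - \<alpha>)\<close> over disjoint intervals \<open>l\<close>
  that touch the accumulation set: taking the gaps bounds the convergence exponent, taking
  the cells of a grid shows that the set is null, and for \<open>\<alpha> = 1\<close> dyadic intervals shrinking to a
  single point already give a contradiction. The Hausdorff dimension is compared with the
  convergence exponent by counting grid cells.
\<close>

section \<open>Determinants of arbitrary size\<close>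

text \<open>The obstacle is that \<open>F\<close> need not continue analytically across the unit
  circle, so zeros accumulating at a boundary point do not make \<open>F\<close> vanish; uniqueness
  has to be replaced by a quantitative statement. For this all bounds must hold up to and including
  the circle. That is why \<open>K\<close> stays a matrix of polynomials measured by their
  coefficients: convergence in the weighted norm hands the boundary regularity on to
  \<open>F\<close>, which estimates at single points of the open disc would lose. One scalar
  determinant of the whole matrix also treats all band widths \<open>p\<close> alike.

  Origin of the exponents: decay \<open>exp (-\<kappa> k powr \<beta>)\<close> bounds the Taylor
  coefficients of order k by \<open>C * (Q * k powr (1/\<alpha>)) ^ k\<close> with
  \<open>1/\<alpha> = 1/\<beta> - 1\<close>, and making
  \<open>(Q * \<delta> * k powr (1/\<alpha>)) ^ k\<close> small over k yields
  \<open>exp (-c * \<delta> powr (-\<alpha>))\<close>. An interval of length l near a flat point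
  thus lowers the integral of \<open>ln |F|\<close> by about \<open>l * l powr (-\<alpha>)\<close>,
  which is the source of \<open>1 - \<alpha> = (1 - 2\<beta>)/(1 - \<beta>)\<close>. The singularity
  \<open>\<delta> powr (-\<alpha>)\<close> is integrable exactly for \<open>\<alpha> < 1\<close>,
  that is for \<open>\<beta> < 1/2\<close>.\<close>

text \<open>The determinant of HOL-Analysis fixes the size by a type; here the size has to tend to infinity.\<close>

definition ldet :: "nat \<Rightarrow> (nat \<Rightarrow> nat \<Rightarrow> 'a::comm_ring_1) \<Rightarrow> 'a" where
  "ldet N M = (\<Sum>\<pi> | \<pi> permutes {..<N}. of_int (sign \<pi>) * (\<Prod>i<N. M i (\<pi> i)))"

lemma ldet_0 [simp]: "ldet 0 M = 1"
  by (simp add: ldet_def)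

lemma permutes_Suc_fixing:
  "{\<pi>. \<pi> permutes {..<Suc N} \<and> \<pi> N = N} = {\<pi>. \<pi> permutes {..<N}}"
proof safe
  fix \<pi> assume h: "\<pi> permutes {..<Suc N}" "\<pi> N = N"
  show "\<pi> permutes {..<N}"
  proof (rule permutes_superset[OF h(1)])
    fix x assume "x \<in> {..<Suc N} - {..<N}"
    then show "\<pi> x = x" using h(2) by (auto simp: less_Suc_eq)
  qed
next
  fix \<pi> assume h: "\<pi> permutes {..<N}"
  show "\<pi> permutes {..<Suc N}" using permutes_subset[OF h] by auto
  show "\<pi> N = N" using permutes_not_in[OF h] by auto
qed

text \<open>Replacing the last row of \<open>M\<close> by the unit vector leaves only the
  permutations fixing \<open>N\<close>, so \<open>ldet N M\<close> is itself a determinant of size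
  \<open>Suc N\<close>. Linearity in the last row does the rest.\<close>

lemma ldet_Suc_diff:
  "ldet (Suc N) M - ldet N M =
   ldet (Suc N) (\<lambda>i j. if i = N then M N j - (if j = N then 1 else 0) else M i j)"
proof -
  let ?P = "{\<pi>. \<pi> permutes {..<Suc N}}"
  have fin: "finite ?P" by (rule finite_permutations) simp
  have 1: "ldet N M = (\<Sum>\<pi>\<in>?P. if \<pi> N = N then of_int (sign \<pi>) * (\<Prod>i<N. M i (\<pi> i)) else 0)"
    unfolding ldet_def
    by (subst sum.inter_filter[OF fin, symmetric], rule sum.cong)
       (use permutes_Suc_fixing[of N] in auto)
  show ?thesis
    unfolding 1 unfolding ldet_def sum_subtractf[symmetric]
  proof (rule sum.cong[OF refl])
    fix \<pi>
    have "(\<Prod>i<N. (if i = N then M N (\<pi> i) - (if \<pi> i = N then 1 else 0) else M i (\<pi> i)))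
        = (\<Prod>i<N. M i (\<pi> i))" by (rule prod.cong) auto
    then show "of_int (sign \<pi>) * (\<Prod>i<Suc N. M i (\<pi> i)) -
         (if \<pi> N = N then of_int (sign \<pi>) * (\<Prod>i<N. M i (\<pi> i)) else 0) =
         of_int (sign \<pi>) * (\<Prod>i<Suc N. (if i = N then M N (\<pi> i) - (if \<pi> i = N then 1 else 0) else M i (\<pi> i)))"
      by (simp add: algebra_simps)
  qed
qed

text \<open>Swapping the values \<open>j\<close> and \<open>k\<close> pairs permutations of opposite
  sign with equal products.\<close>

lemma ldet_identical_columns:
  fixes M :: "nat \<Rightarrow> nat \<Rightarrow> complex"
  assumes "j < N" "k < N" "j \<noteq> k" "\<And>i. M i j = M i k"
  shows "ldet N M = 0"
proof -
  let ?P = "{\<pi>. \<pi> permutes {..<N}}"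
  let ?t = "Transposition.transpose j k"
  have t: "?t permutes {..<N}" using assms by (intro permutes_swap_id) auto
  have M: "M i (?t m) = M i m" for i m
    using assms(4) by (auto simp: Transposition.transpose_def)
  have "ldet N M = (\<Sum>\<pi>\<in>?P. of_int (sign (?t \<circ> \<pi>)) * (\<Prod>i<N. M i ((?t \<circ> \<pi>) i)))"
    unfolding ldet_def
  proof (rule sum.reindex_bij_witness[where i="(\<circ>) ?t" and j="(\<circ>) ?t"])
    fix \<pi> assume "\<pi> \<in> ?P"
    then show "?t \<circ> \<pi> \<in> ?P" using permutes_compose[OF _ t] by auto
    show "?t \<circ> (?t \<circ> \<pi>) = \<pi>" by (auto simp: fun_eq_iff)
  qed (auto simp: fun_eq_iff comp_def intro: permutes_compose[OF _ t, unfolded comp_def])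
  also have "\<dots> = (\<Sum>\<pi>\<in>?P. - (of_int (sign \<pi>) * (\<Prod>i<N. M i (\<pi> i))))"
  proof (rule sum.cong[OF refl])
    fix \<pi> assume "\<pi> \<in> ?P"
    then have "permutation \<pi>" using permutation_permutes[of \<pi>] by blast
    then have "sign (?t \<circ> \<pi>) = - sign \<pi>"
      using assms(3) by (simp add: sign_compose permutation_swap_id sign_swap_id)
    then show "of_int (sign (?t \<circ> \<pi>)) * (\<Prod>i<N. M i ((?t \<circ> \<pi>) i))
       = - (of_int (sign \<pi>) * (\<Prod>i<N. M i (\<pi> i)))" by (simp add: M)
  qed
  also have "\<dots> = - ldet N M" unfolding ldet_def by (simp add: sum_negf)
  finally have neg: "ldet N M = - ldet N M" .
  have "2 * ldet N M = 0"
    unfolding mult_2 by (rule iffD1[OF eq_neg_iff_add_eq_0 neg])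
  then show ?thesis by simp
qed

text \<open>Column \<open>k\<close> is a combination of all columns, and every term except
  \<open>l = k\<close> repeats a column. No inverse of \<open>M\<close> enters; this matters because
  the determinant will be shown to tend to 0.\<close>

lemma ldet_cramer:
  fixes M :: "nat \<Rightarrow> nat \<Rightarrow> complex"
  assumes k: "k < N"
  shows "ldet N (\<lambda>i j. if j = k then (\<Sum>l<N. M i l * u l) else M i j) = ldet N M * u k"
proof -
  let ?C = "\<lambda>l i j. if j = k then M i l else M i j"
  have "ldet N (\<lambda>i j. if j = k then (\<Sum>l<N. M i l * u l) else M i j)
     = (\<Sum>\<pi> | \<pi> permutes {..<N}. \<Sum>l<N. u l * (of_int (sign \<pi>) * (\<Prod>i<N. ?C l i (\<pi> i))))"
    unfolding ldet_def
  proof (rule sum.cong[OF refl])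
    fix \<pi> assume "\<pi> \<in> {\<pi>. \<pi> permutes {..<N}}"
    then have p: "\<pi> permutes {..<N}" by simp
    \<comment> \<open>The only row whose factor meets the modified column.\<close>
    define m where "m = inv \<pi> k"
    have m: "m < N" "\<pi> m = k"
      using permutes_in_image[OF permutes_inv[OF p], of k] k permutes_inverses(1)[OF p]
      by (auto simp: m_def)
    have ne: "\<pi> i \<noteq> k" if "i \<noteq> m" for i
      using permutes_inverses(2)[OF p, of i] that m_def by metis
    have rest: "(\<Prod>i\<in>{..<N}-{m}. if \<pi> i = k then g i else M i (\<pi> i)) = (\<Prod>i\<in>{..<N}-{m}. M i (\<pi> i))" for g
      by (rule prod.cong) (use ne in auto)
    have e: "(\<Prod>i<N. if \<pi> i = k then g i else M i (\<pi> i)) = g m * (\<Prod>i\<in>{..<N}-{m}. M i (\<pi> i))" for g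
      using m by (subst prod.remove[of _ m]) (auto simp: rest)
    show "of_int (sign \<pi>) * (\<Prod>i<N. if \<pi> i = k then \<Sum>l<N. M i l * u l else M i (\<pi> i)) =
         (\<Sum>l<N. u l * (of_int (sign \<pi>) * (\<Prod>i<N. if \<pi> i = k then M i l else M i (\<pi> i))))"
      unfolding e by (simp add: sum_distrib_left sum_distrib_right mult_ac)
  qed
  also have "\<dots> = (\<Sum>l<N. u l * ldet N (?C l))"
    unfolding ldet_def by (subst sum.swap) (simp add: sum_distrib_left)
  also have "\<dots> = (\<Sum>l<N. if l = k then u k * ldet N M else 0)"
  proof (rule sum.cong[OF refl])
    fix l assume l: "l \<in> {..<N}"
    show "u l * ldet N (?C l) = (if l = k then u k * ldet N M else 0)"
    proof (cases "l = k")
      case True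
      then have "?C l = M" by (auto simp: fun_eq_iff)
      then show ?thesis using True by simp
    next
      case False
      then have "ldet N (?C l) = 0" using l k by (intro ldet_identical_columns[of l N k]) auto
      then show ?thesis using False by simp
    qed
  qed
  also have "\<dots> = ldet N M * u k" using k by (simp add: sum.delta)
  finally show ?thesis .
qed

text \<open>The product of the row sums expands over all maps of \<open>{..<N}\<close> to itself,
  among them the permutations. The abstract \<open>\<nu>\<close> lets the bound serve both
  \<open>wnorm w\<close> on polynomials and \<open>cmod\<close> on numbers.\<close>

lemma ldet_bound:
  fixes \<nu> :: "'a::comm_ring_1 \<Rightarrow> real"
  assumes "\<nu> 0 = 0" "\<nu> 1 \<le> 1" "\<And>x. 0 \<le> \<nu> x" "\<And>x. \<nu> (- x) = \<nu> x"
    "\<And>x y. \<nu> (x + y) \<le> \<nu> x + \<nu> y" "\<And>x y. \<nu> (x * y) \<le> \<nu> x * \<nu> y"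
  shows "\<nu> (ldet N M) \<le> (\<Prod>i<N. \<Sum>j<N. \<nu> (M i j))"
proof -
  let ?P = "{\<pi>. \<pi> permutes {..<N}}"
  have s: "\<nu> (sum f A) \<le> (\<Sum>x\<in>A. \<nu> (f x))" for f :: "'b \<Rightarrow> 'a" and A
  proof (induction A rule: infinite_finite_induct)
    case (insert x F)
    then show ?case using assms(5)[of "f x" "sum f F"] by simp
  qed (auto simp: assms)
  have p: "\<nu> (prod f A) \<le> (\<Prod>x\<in>A. \<nu> (f x))" for f :: "'b \<Rightarrow> 'a" and A
  proof (induction A rule: infinite_finite_induct)
    case (insert x F)
    have "\<nu> (prod f (insert x F)) \<le> \<nu> (f x) * \<nu> (prod f F)" using insert assms(6) by simp
    also have "\<dots> \<le> \<nu> (f x) * (\<Prod>x\<in>F. \<nu> (f x))" by (intro mult_left_mono insert assms)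
    finally show ?case using insert by simp
  qed (auto simp: assms)
  have "\<nu> (ldet N M) \<le> (\<Sum>\<pi>\<in>?P. \<nu> (of_int (sign \<pi>) * (\<Prod>i<N. M i (\<pi> i))))"
    unfolding ldet_def by (rule s)
  also have "\<dots> \<le> (\<Sum>\<pi>\<in>?P. \<Prod>i<N. \<nu> (M i (\<pi> i)))"
  proof (rule sum_mono)
    fix \<pi> :: "nat \<Rightarrow> nat"
    have "\<nu> (of_int (sign \<pi>) * (\<Prod>i<N. M i (\<pi> i))) = \<nu> (\<Prod>i<N. M i (\<pi> i))"
      by (cases "sign \<pi> = 1") (use assms(4) in \<open>auto simp: sign_def\<close>)
    then show "\<nu> (of_int (sign \<pi>) * (\<Prod>i<N. M i (\<pi> i))) \<le> (\<Prod>i<N. \<nu> (M i (\<pi> i)))"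
      using p by simp
  qed
  \<comment> \<open>A permutation is the identity outside \<open>{..<N}\<close>, a member of
    \<open>PiE\<close> is \<open>undefined\<close> there; \<open>restrict\<close> mediates and is
    injective on permutations.\<close>
  also have "\<dots> = (\<Sum>f\<in>(\<lambda>\<pi>. restrict \<pi> {..<N}) ` ?P. \<Prod>i<N. \<nu> (M i (f i)))"
  proof (subst sum.reindex)
    show "inj_on (\<lambda>\<pi>. restrict \<pi> {..<N}) ?P"
    proof (rule inj_onI)
      fix \<pi> \<sigma> assume h: "\<pi> \<in> ?P" "\<sigma> \<in> ?P" "restrict \<pi> {..<N} = restrict \<sigma> {..<N}"
      show "\<pi> = \<sigma>"
      proof
        fix x
        show "\<pi> x = \<sigma> x"
        proof (cases "x \<in> {..<N}")
          case True then show ?thesis using fun_cong[OF h(3), of x] by simp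
        next
          case False
          then show ?thesis using h permutes_not_in[of \<pi> "{..<N}" x] permutes_not_in[of \<sigma> "{..<N}" x] by auto
        qed
      qed
    qed
  qed (auto intro!: sum.cong prod.cong)
  also have "\<dots> \<le> (\<Sum>f\<in>PiE {..<N} (\<lambda>_. {..<N}). \<Prod>i<N. \<nu> (M i (f i)))"
  proof (rule sum_mono2)
    show "finite (PiE {..<N} (\<lambda>_. {..<N}))" by (intro finite_PiE) auto
    show "(\<lambda>\<pi>. restrict \<pi> {..<N}) ` ?P \<subseteq> PiE {..<N} (\<lambda>_. {..<N})"
      using permutes_in_image by fastforce
  qed (auto intro!: prod_nonneg assms)
  also have "\<dots> = (\<Prod>i<N. \<Sum>j<N. \<nu> (M i j))"
    by (rule prod_sum_PiE[symmetric]) auto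
  finally show ?thesis .
qed

section \<open>Fredholm determinants over weighted polynomials\<close>

text \<open>The norm of the Beurling algebra with weight \<open>w\<close>, restricted to
  polynomials.\<close>

definition wnorm :: "(nat \<Rightarrow> real) \<Rightarrow> complex poly \<Rightarrow> real" where
  "wnorm w q = (\<Sum>k\<le>degree q. cmod (coeff q k) * w k)"

lemma wnorm_eq:
  assumes "degree q \<le> n"
  shows "wnorm w q = (\<Sum>k\<le>n. cmod (coeff q k) * w k)"
  unfolding wnorm_def
  by (rule sum.mono_neutral_left) (use assms in \<open>auto simp: coeff_eq_0\<close>)

lemma wnorm_0 [simp]: "wnorm w 0 = 0"
  by (simp add: wnorm_def)

lemma wnorm_1 [simp]: "wnorm w 1 = w 0"
  by (simp add: wnorm_def)

lemma wnorm_minus [simp]: "wnorm w (- q) = wnorm w q"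
  by (simp add: wnorm_def)

lemma wnorm_smult [simp]: "wnorm w (smult c q) = cmod c * wnorm w q"
  by (cases "c = 0") (simp_all add: wnorm_def norm_mult sum_distrib_left mult_ac)

lemma wnorm_monom [simp]: "wnorm w (monom c n) = cmod c * w n"
proof -
  have "wnorm w (monom c n) = (\<Sum>k\<le>n. cmod (coeff (monom c n) k) * w k)"
    by (rule wnorm_eq) (rule degree_monom_le)
  also have "\<dots> = (\<Sum>k\<le>n. if k = n then cmod c * w n else 0)"
    by (rule sum.cong) (auto simp: coeff_monom)
  finally show ?thesis by (simp add: sum.delta)
qed

text \<open>\<open>wmult\<close> makes \<open>wnorm w\<close> submultiplicative, \<open>w1\<close>
  makes it dominate the supremum over the closed unit disc, and \<open>w0\<close> gives the
  polynomial 1 the norm 1, as the determinant bound requires.\<close>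

locale submult_weight =
  fixes w :: "nat \<Rightarrow> real"
  assumes w0: "w 0 = 1" and w1: "\<And>k. 1 \<le> w k" and wmult: "\<And>i j. w (i + j) \<le> w i * w j"
begin

lemma w_nonneg [simp]: "0 \<le> w k" and w_pos [simp]: "0 < w k"
  using w1[of k] by linarith+

lemma wnorm_nonneg [simp]: "0 \<le> wnorm w q"
  by (auto simp: wnorm_def intro!: sum_nonneg)

lemma wnorm_add: "wnorm w (q + r) \<le> wnorm w q + wnorm w r"
proof -
  let ?n = "max (degree q) (degree r)"
  have "wnorm w (q + r) = (\<Sum>k\<le>?n. cmod (coeff q k + coeff r k) * w k)"
    by (subst wnorm_eq[of _ ?n]) (auto simp: degree_add_le_max)
  also have "\<dots> \<le> (\<Sum>k\<le>?n. cmod (coeff q k) * w k + cmod (coeff r k) * w k)"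
    by (rule sum_mono) (metis distrib_right mult_right_mono norm_triangle_ineq w_nonneg)
  also have "\<dots> = wnorm w q + wnorm w r"
    by (simp add: wnorm_eq[of q ?n] wnorm_eq[of r ?n] sum.distrib)
  finally show ?thesis .
qed

lemma wnorm_sum: "wnorm w (sum f A) \<le> (\<Sum>x\<in>A. wnorm w (f x))"
proof (induction A rule: infinite_finite_induct)
  case (insert x F)
  then show ?case using wnorm_add[of "f x" "sum f F"] by simp
qed auto

lemma wnorm_mult: "wnorm w (q * r) \<le> wnorm w q * wnorm w r"
proof -
  let ?a = "\<lambda>i. cmod (coeff q i) * w i" and ?b = "\<lambda>j. cmod (coeff r j) * w j"
  let ?n = "degree q + degree r"
  have "wnorm w (q * r) = (\<Sum>k\<le>?n. cmod (\<Sum>i\<le>k. coeff q i * coeff r (k - i)) * w k)"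
    by (subst wnorm_eq[of _ ?n]) (auto simp: degree_mult_le coeff_mult)
  also have "\<dots> \<le> (\<Sum>k\<le>?n. \<Sum>i\<le>k. ?a i * ?b (k - i))"
  proof (rule sum_mono)
    fix k
    have "cmod (\<Sum>i\<le>k. coeff q i * coeff r (k - i)) * w k
      \<le> (\<Sum>i\<le>k. cmod (coeff q i * coeff r (k - i))) * w k"
      by (intro mult_right_mono norm_sum) auto
    also have "\<dots> = (\<Sum>i\<le>k. cmod (coeff q i) * cmod (coeff r (k - i)) * w k)"
      by (simp add: sum_distrib_right norm_mult)
    also have "\<dots> \<le> (\<Sum>i\<le>k. cmod (coeff q i) * cmod (coeff r (k - i)) * (w i * w (k - i)))"
    proof (rule sum_mono)
      fix i assume "i \<in> {..k}"
      then show "cmod (coeff q i) * cmod (coeff r (k - i)) * w k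
          \<le> cmod (coeff q i) * cmod (coeff r (k - i)) * (w i * w (k - i))"
        using wmult[of i "k - i"] by (intro mult_left_mono) auto
    qed
    finally show "cmod (\<Sum>i\<le>k. coeff q i * coeff r (k - i)) * w k \<le> (\<Sum>i\<le>k. ?a i * ?b (k - i))"
      by (simp add: mult_ac)
  qed
  also have "\<dots> = (\<Sum>(i,j)\<in>{(i,j). i + j \<le> ?n}. ?a i * ?b j)"
    by (rule sum.triangle_reindex_eq[symmetric])
  also have "\<dots> \<le> (\<Sum>(i,j)\<in>{..?n} \<times> {..?n}. ?a i * ?b j)"
    by (rule sum_mono2) auto
  also have "\<dots> = wnorm w q * wnorm w r"
    by (simp add: wnorm_eq[of q ?n] wnorm_eq[of r ?n] sum_product sum.cartesian_product)
  finally show ?thesis .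
qed

lemma wnorm_coeff: "cmod (coeff q k) * w k \<le> wnorm w q"
proof -
  have "cmod (coeff q k) * w k = (\<Sum>j\<in>{k}. cmod (coeff q j) * w j)" by simp
  also have "\<dots> \<le> (\<Sum>j\<le>max k (degree q). cmod (coeff q j) * w j)"
    by (rule sum_mono2) auto
  finally show ?thesis by (simp add: wnorm_eq[of q "max k (degree q)"])
qed

lemma wnorm_poly: "cmod z \<le> 1 \<Longrightarrow> cmod (poly q z) \<le> wnorm w q"
proof -
  assume z: "cmod z \<le> 1"
  have "cmod (poly q z) \<le> (\<Sum>k\<le>degree q. cmod (coeff q k * z ^ k))"
    unfolding poly_altdef by (rule norm_sum)
  also have "\<dots> \<le> wnorm w q"
    unfolding wnorm_def
  proof (rule sum_mono)
    fix k
    have "cmod z ^ k \<le> 1" using z by (simp add: power_le_one)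
    then have "cmod z ^ k \<le> w k" using w1[of k] by linarith
    then show "cmod (coeff q k * z ^ k) \<le> cmod (coeff q k) * w k"
      by (simp add: norm_mult norm_power mult_left_mono)
  qed
  finally show ?thesis .
qed

lemma wnorm_ldet: "wnorm w (ldet N M) \<le> (\<Prod>i<N. \<Sum>j<N. wnorm w (M i j))"
  by (rule ldet_bound) (auto simp: w0 wnorm_add wnorm_mult)

end

lemma poly_ldet:
  fixes M :: "nat \<Rightarrow> nat \<Rightarrow> complex poly"
  shows "poly (ldet N M) z = ldet N (\<lambda>i j. poly (M i j) z)"
proof -
  have "poly (of_int (sign (\<pi>::nat\<Rightarrow>nat)) :: complex poly) z = of_int (sign \<pi>)" for \<pi>
    by (simp add: sign_def)
  then show ?thesis by (simp add: ldet_def poly_sum poly_prod)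
qed

lemma prod_one_plus_le_exp:
  fixes f :: "'a \<Rightarrow> real"
  assumes "\<And>x. x \<in> A \<Longrightarrow> 0 \<le> f x"
  shows "(\<Prod>x\<in>A. 1 + f x) \<le> exp (\<Sum>x\<in>A. f x)"
proof (cases "finite A")
  case True
  then have "(\<Prod>x\<in>A. 1 + f x) \<le> (\<Prod>x\<in>A. exp (f x))"
    by (intro prod_mono) (use assms in \<open>auto intro: add_nonneg_nonneg exp_ge_add_one_self\<close>)
  then show ?thesis using True by (simp add: exp_sum)
qed auto

text \<open>The majorant \<open>A n * B l\<close> separates the indices, so the row sums of
  \<open>K\<close> are at most \<open>A n * S\<close> and summable in \<open>n\<close>; this one
  estimate controls both the size of the finite sections and their increments. \<open>K0\<close>
  makes every section equal to 1 at the origin, so the limit is not the zero series. Summability of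
  \<open>1 / w k\<close> turns convergence of coefficients into convergence of values on the closed
  disc.\<close>

lemma (in submult_weight) fredholm_determinant:
  fixes K :: "nat \<Rightarrow> nat \<Rightarrow> complex poly" and A B :: "nat \<Rightarrow> real"
  assumes A: "summable A" "\<And>n. 0 \<le> A n" and B: "summable B" "\<And>n. 0 \<le> B n"
    and K: "\<And>n l. wnorm w (K n l) \<le> A n * B l"
    and K0: "\<And>n l. coeff (K n l) 0 = 0"
    and w: "summable (\<lambda>k. 1 / w k)"
  obtains a :: "nat \<Rightarrow> complex" and M :: real where
    "\<And>k. cmod (a k) * w k \<le> M" and "a 0 = 1"
    and "\<And>z u U. \<lbrakk>cmod z \<le> 1; \<And>n. cmod (u n) \<le> U; u \<noteq> (\<lambda>_. 0);
            \<And>n. u n = (\<Sum>l. poly (K n l) z * u l)\<rbrakk> \<Longrightarrow> (\<Sum>k. a k * z ^ k) = 0"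
proof -
  define \<delta> :: "nat \<Rightarrow> nat \<Rightarrow> complex poly" where "\<delta> i j = (if i = j then 1 else 0)" for i j
  \<comment> \<open>\<open>D (Suc N) - D N\<close> is the determinant with the row \<open>N\<close> of the identity removed, so it is
    bounded by the row sum \<open>A N\<close>: the finite sections converge coefficientwise.\<close>
  define D where "D N = ldet N (\<lambda>i j. \<delta> i j - K i j)" for N
  define S where "S = suminf B"
  define R where "R = exp (suminf A * S)"
  have S0: "0 \<le> S" unfolding S_def by (rule suminf_nonneg[OF B])
  have sumB: "(\<Sum>j<N. B j) \<le> S" for N
    unfolding S_def by (rule sum_le_suminf) (use B in auto)
  have sumA: "(\<Sum>j<N. A j) \<le> suminf A" for N
    by (rule sum_le_suminf) (use A in auto)
  have R1: "1 \<le> R" unfolding R_def using S0 suminf_nonneg[OF A] by simp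
  have Krow: "(\<Sum>j<N. wnorm w (K i j)) \<le> A i * S" for N i
  proof -
    have "(\<Sum>j<N. wnorm w (K i j)) \<le> (\<Sum>j<N. A i * B j)" by (rule sum_mono) (rule K)
    also have "\<dots> \<le> A i * S" unfolding sum_distrib_left[symmetric] by (intro mult_left_mono sumB A)
    finally show ?thesis .
  qed
  have row: "(\<Sum>j<N. wnorm w (\<delta> i j - K i j)) \<le> 1 + A i * S" for N i
  proof -
    have "(\<Sum>j<N. wnorm w (\<delta> i j - K i j)) \<le> (\<Sum>j<N. wnorm w (\<delta> i j) + wnorm w (K i j))"
      by (rule sum_mono) (use wnorm_add[of _ "- _"] in force)
    also have "\<dots> = (\<Sum>j<N. if j = i then 1 else 0) + (\<Sum>j<N. wnorm w (K i j))"
      unfolding sum.distrib by (intro arg_cong2[where f="(+)"] sum.cong) (auto simp: \<delta>_def w0)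
    also have "(\<Sum>j<N. if j = i then 1 else (0::real)) \<le> 1" by (subst sum.delta) auto
    finally show ?thesis using Krow[of i N] by linarith
  qed
  have prodb: "(\<Prod>i<N. 1 + A i * S) \<le> R" for N
  proof -
    have "(\<Prod>i<N. 1 + A i * S) \<le> exp (\<Sum>i<N. A i * S)"
      by (rule prod_one_plus_le_exp) (use A S0 in auto)
    also have "\<dots> \<le> R"
      unfolding R_def by (simp add: sum_distrib_right[symmetric] mult_right_mono sumA S0)
    finally show ?thesis .
  qed
  have diff: "wnorm w (D (Suc N) - D N) \<le> R * (A N * S)" for N
  proof -
    let ?M = "\<lambda>i j. if i = N then (\<delta> N j - K N j) - (if j = N then 1 else 0) else \<delta> i j - K i j"
    have "wnorm w (D (Suc N) - D N) = wnorm w (ldet (Suc N) ?M)"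
      unfolding D_def by (subst ldet_Suc_diff) simp
    also have "\<dots> \<le> (\<Prod>i<Suc N. \<Sum>j<Suc N. wnorm w (?M i j))" by (rule wnorm_ldet)
    also have "\<dots> = (\<Prod>i<N. \<Sum>j<Suc N. wnorm w (\<delta> i j - K i j)) * (\<Sum>j<Suc N. wnorm w (K N j))"
    proof -
      have "?M N j = - K N j" for j by (simp add: \<delta>_def)
      then have "(\<Sum>j<Suc N. wnorm w (?M N j)) = (\<Sum>j<Suc N. wnorm w (K N j))"
        by (simp only: wnorm_minus)
      moreover have "(\<Prod>i<N. \<Sum>j<Suc N. wnorm w (?M i j)) = (\<Prod>i<N. \<Sum>j<Suc N. wnorm w (\<delta> i j - K i j))"
        by (rule prod.cong) auto
      ultimately show ?thesis by (simp only: prod.lessThan_Suc)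
    qed
    also have "\<dots> \<le> (\<Prod>i<N. 1 + A i * S) * (A N * S)"
      by (intro mult_mono prod_mono prod_nonneg conjI sum_nonneg row Krow) (use A S0 in \<open>auto intro: add_nonneg_nonneg\<close>)
    also have "\<dots> \<le> R * (A N * S)"
      by (intro mult_right_mono prodb) (use A S0 in auto)
    finally show ?thesis .
  qed
  \<comment> \<open>Bounds \<open>D (N + m) - D N\<close> for all \<open>m\<close> at once, hence
    coefficientwise the distance from \<open>D N\<close> to the limit.\<close>
  define T where "T N = R * S * (\<Sum>n. A (n + N))" for N
  have Tlim: "T \<longlonglongrightarrow> 0"
  proof -
    have "(\<lambda>N. \<Sum>n. A (n + N)) \<longlonglongrightarrow> 0" by (rule suminf_exist_split2[OF A(1)])
    then show ?thesis unfolding T_def using tendsto_mult_right_zero by blast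
  qed
  have Dm: "wnorm w (D (N + m) - D N) \<le> (\<Sum>n<m. R * S * A (n + N))" for N m
  proof (induction m)
    case (Suc m)
    have "wnorm w (D (N + Suc m) - D N) = wnorm w ((D (Suc (N + m)) - D (N + m)) + (D (N + m) - D N))"
      by simp
    also have "\<dots> \<le> R * (A (N + m) * S) + (\<Sum>n<m. R * S * A (n + N))"
      using wnorm_add diff[of "N + m"] Suc by (meson add_mono order_trans)
    finally show ?case by (simp add: mult_ac add_ac)
  qed simp
  have DT: "wnorm w (D (N + m) - D N) \<le> T N" for N m
  proof -
    have "(\<Sum>n<m. A (n + N)) \<le> (\<Sum>n. A (n + N))"
      by (rule sum_le_suminf) (use A in \<open>auto simp: summable_iff_shift\<close>)
    then have "R * S * (\<Sum>n<m. A (n + N)) \<le> T N"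
      unfolding T_def using R1 S0 by (intro mult_left_mono) auto
    then show ?thesis using Dm[of N m] by (simp add: sum_distrib_left)
  qed
  have cT: "cmod (coeff (D (N + m)) k - coeff (D N) k) \<le> T N / w k" for N m k
    using wnorm_coeff[of "D (N + m) - D N" k] DT[of N m] by (simp add: field_simps)
  have "\<exists>l. (\<lambda>N. coeff (D N) k) \<longlonglongrightarrow> l" for k
  proof -
    have "Cauchy (\<lambda>N. coeff (D N) k)"
    proof (rule metric_CauchyI)
      fix e :: real assume "e > 0"
      then have "eventually (\<lambda>N. T N < e / 2 ) sequentially"
        using order_tendstoD(2)[OF Tlim, of "e/2"] by simp
      then obtain N where N: "T N < e / 2" by (auto simp: eventually_sequentially)
      have *: "dist (coeff (D m) k) (coeff (D N) k) < e / 2" if "m \<ge> N" for m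
      proof -
        have "T N / w k \<le> T N" using w1[of k] DT[of N 0] wnorm_nonneg[of "D N - D N"]
          by (simp add: divide_le_eq) (use mult_left_mono[of 1 "w k" "T N"] in auto)
        then show ?thesis using cT[of N "m - N" k] that N by (simp add: dist_norm)
      qed
      show "\<exists>M. \<forall>m\<ge>M. \<forall>n\<ge>M. dist (coeff (D m) k) (coeff (D n) k) < e"
        using * dist_triangle_half_l by blast
    qed
    then show ?thesis by (simp add: Cauchy_convergent_iff convergent_def)
  qed
  then obtain a where a: "\<And>k. (\<lambda>N. coeff (D N) k) \<longlonglongrightarrow> a k" by metis
  have aT: "cmod (a k - coeff (D N) k) \<le> T N / w k" for N k
  proof -
    have "(\<lambda>m. coeff (D (m + N)) k) \<longlonglongrightarrow> a k" using a LIMSEQ_ignore_initial_segment by blast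
    then have "(\<lambda>m. cmod (coeff (D (m + N)) k - coeff (D N) k)) \<longlonglongrightarrow> cmod (a k - coeff (D N) k)"
      by (intro tendsto_intros)
    then show ?thesis by (rule LIMSEQ_le_const2) (use cT[of N _ k] in \<open>simp add: add.commute\<close>)
  qed
  have bound: "cmod (a k) * w k \<le> T 0 + 1" for k
  proof -
    have "cmod (a k) \<le> T 0 / w k + cmod (coeff (D 0) k)"
      using aT[of k 0] norm_triangle_sub[of "a k" "coeff (D 0) k"] by linarith
    \<comment> \<open>\<open>D 0\<close> is the empty determinant 1; it accounts for the
      \<open>+ 1\<close> in the bound.\<close>
    also have "cmod (coeff (D 0) k) \<le> 1 / w k" by (simp add: D_def w0 del: w_pos)
    finally have "cmod (a k) \<le> (T 0 + 1) / w k" by (simp add: add_divide_distrib)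
    then show ?thesis using w_pos[of k] by (simp only: pos_le_divide_eq)
  qed
  have D0: "coeff (D N) 0 = 1" for N
  proof -
    have "coeff (D N) 0 = poly (D N) 0" by (simp add: poly_0_coeff_0)
    also have "\<dots> = ldet N (\<lambda>i j. if i = j then 1 else 0 :: complex)"
      unfolding D_def poly_ldet by (intro arg_cong[where f="ldet N"] ext)
        (simp add: \<delta>_def poly_0_coeff_0 K0)
    also have "\<dots> = 1"
    proof (induction N)
      case (Suc N)
      have "ldet (Suc N) (\<lambda>i j. if i = j then 1 else 0 :: complex) - ldet N (\<lambda>i j. if i = j then 1 else 0) = 0"
        unfolding ldet_Suc_diff unfolding ldet_def by (intro sum.neutral) auto
      then show ?case using Suc by simp
    qed simp
    finally show ?thesis .
  qed
  have a0: "a 0 = 1" using LIMSEQ_unique[OF a[of 0]] by (simp add: D0)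
  have sum_a: "summable (\<lambda>k. a k * z ^ k)" if "cmod z \<le> 1" for z
  proof (rule summable_comparison_test'[OF summable_mult[OF w, of "T 0 + 1"]])
    fix k :: nat
    have "cmod (a k * z ^ k) \<le> cmod (a k)" using that by (simp add: norm_mult norm_power mult_left_le power_le_one)
    also have "\<dots> \<le> (T 0 + 1) * (1 / w k)" using bound[of k] by (simp add: field_simps)
    finally show "norm (a k * z ^ k) \<le> (T 0 + 1) * (1 / w k)" by simp
  qed
  have Dlim: "(\<lambda>N. poly (D N) z) \<longlonglongrightarrow> (\<Sum>k. a k * z ^ k)" if z: "cmod z \<le> 1" for z
  proof -
    have "cmod (poly (D N) z - (\<Sum>k. a k * z ^ k)) \<le> T N * (\<Sum>k. 1 / w k)" for N
    proof -
      have s: "(\<lambda>k. coeff (D N) k * z ^ k) sums poly (D N) z"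
        unfolding poly_altdef by (rule sums_finite) (auto simp: coeff_eq_0)
      have "(\<lambda>k. (coeff (D N) k - a k) * z ^ k) sums (poly (D N) z - (\<Sum>k. a k * z ^ k))"
        using sums_diff[OF s summable_sums[OF sum_a[OF z]]] by (simp add: algebra_simps)
      moreover have "(\<lambda>k. T N * (1 / w k)) sums (T N * (\<Sum>k. 1 / w k))"
        by (intro sums_mult summable_sums w)
      moreover have "cmod ((coeff (D N) k - a k) * z ^ k) \<le> T N * (1 / w k)" for k
      proof -
        have "cmod ((coeff (D N) k - a k) * z ^ k) \<le> cmod (coeff (D N) k - a k)"
          using z by (simp add: norm_mult norm_power mult_left_le power_le_one)
        then show ?thesis using aT[of k N] by (simp add: norm_minus_commute)
      qed
      ultimately show ?thesis
        using norm_suminf_le[of "\<lambda>k. (coeff (D N) k - a k) * z ^ k" "\<lambda>k. T N * (1 / w k)"]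
        by (simp add: sums_iff)
    qed
    then have "\<forall>\<^sub>F N in sequentially. norm (poly (D N) z - (\<Sum>k. a k * z ^ k)) \<le> T N * (\<Sum>k. 1 / w k)"
      by simp
    moreover have "(\<lambda>N. T N * (\<Sum>k. 1 / w k)) \<longlonglongrightarrow> 0"
      by (rule tendsto_mult_left_zero[OF Tlim])
    ultimately have "(\<lambda>N. poly (D N) z - (\<Sum>k. a k * z ^ k)) \<longlonglongrightarrow> 0"
      by (rule Lim_null_comparison)
    then show ?thesis by (simp add: LIM_zero_iff)
  qed
  have ker: "(\<Sum>k. a k * z ^ k) = 0"
    if z: "cmod z \<le> 1" and U: "\<And>n. cmod (u n) \<le> U" and nz: "u \<noteq> (\<lambda>_. 0)"
      and u: "\<And>n. u n = (\<Sum>l. poly (K n l) z * u l)" for z u U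
  proof -
    obtain k where k: "u k \<noteq> 0" using nz by (auto simp: fun_eq_iff)
    have U0: "0 \<le> U" using U[of 0] norm_ge_zero order_trans by blast
    define M where "M i j = poly (\<delta> i j - K i j) z" for i j
    have Meq: "M i j = (if i = j then 1 else 0) - poly (K i j) z" for i j
      by (simp add: M_def \<delta>_def)
    have DM: "poly (D N) z = ldet N M" for N
      unfolding D_def poly_ldet by (simp add: M_def[abs_def])
    have Mrow: "(\<Sum>j<N. cmod (M i j)) \<le> 1 + A i * S" for i N
    proof -
      have "(\<Sum>j<N. cmod (M i j)) \<le> (\<Sum>j<N. wnorm w (\<delta> i j - K i j))"
        unfolding M_def by (intro sum_mono wnorm_poly z)
      then show ?thesis using row[where i=i and N=N] by linarith
    qed
    define tB where "tB N = (\<Sum>l. B (l + N))" for N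
    have tB0: "0 \<le> tB N" for N unfolding tB_def
      by (rule suminf_nonneg) (use B in \<open>auto simp: summable_iff_shift\<close>)
    have Ku: "cmod (poly (K i l) z * u l) \<le> A i * U * B l" for i l
    proof -
      have "cmod (poly (K i l) z) * cmod (u l) \<le> (A i * B l) * U"
        by (intro mult_mono U order_trans[OF wnorm_poly[OF z] K]) (use A B in auto)
      then show ?thesis by (simp add: norm_mult mult_ac)
    qed
    have sKu: "summable (\<lambda>l. poly (K i l) z * u l)" for i
      by (rule summable_comparison_test'[OF summable_mult[OF B(1), of "A i * U"]]) (use Ku in auto)
    \<comment> \<open>Truncating \<open>u\<close> leaves a residual \<open>y\<close> of size \<open>tB N\<close>; by Cramer's rule \<open>D N\<close> times a
      fixed nonzero \<open>u k\<close> is a determinant with the column \<open>k\<close> replaced by \<open>y\<close>.\<close>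
    define y where "y N i = (\<Sum>l<N. M i l * u l)" for N i
    have yb: "cmod (y N i) \<le> A i * U * tB N" if "i < N" for N i
    proof -
      have "y N i = (\<Sum>l<N. if l = i then u i else 0) - (\<Sum>l<N. poly (K i l) z * u l)"
        unfolding y_def Meq sum_subtractf[symmetric] by (intro sum.cong) (auto simp: algebra_simps)
      also have "(\<Sum>l<N. if l = i then u i else 0) = u i" using that by (subst sum.delta) auto
      also have "u i - (\<Sum>l<N. poly (K i l) z * u l) = (\<Sum>l. poly (K i (l + N)) z * u (l + N))"
        using u[of i] suminf_minus_initial_segment[OF sKu[of i], of N] by simp
      also have "cmod \<dots> \<le> (\<Sum>l. A i * U * B (l + N))"
        by (rule norm_suminf_le) (use Ku B in \<open>auto simp: summable_iff_shift intro!: summable_mult\<close>)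
      also have "\<dots> = A i * U * tB N"
        unfolding tB_def by (rule suminf_mult) (use B in \<open>auto simp: summable_iff_shift\<close>)
      finally show ?thesis .
    qed
    have main: "cmod (poly (D N) z * u k) \<le> R * exp (U * suminf A) * tB N" if kN: "k < N" for N
    proof (cases "tB N = 0")
      case True
      then have "y N i = 0" if "i < N" for i using yb[OF that] by simp
      then have y0: "(\<Sum>l<N. M i l * u l) = 0" if "i < N" for i using that y_def by simp
      have "ldet N (\<lambda>i j. if j = k then (\<Sum>l<N. M i l * u l) else M i j) = 0"
        unfolding ldet_def
      proof (intro sum.neutral ballI)
        fix \<pi> assume "\<pi> \<in> {\<pi>. \<pi> permutes {..<N}}"
        then have p: "\<pi> permutes {..<N}" by simp
        have m: "inv \<pi> k < N" "\<pi> (inv \<pi> k) = k"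
          using permutes_in_image[OF permutes_inv[OF p], of k] kN permutes_inverses(1)[OF p] by auto
        have "(\<Prod>i<N. if \<pi> i = k then (\<Sum>l<N. M i l * u l) else M i (\<pi> i)) = 0"
          by (rule prod_zero) (use m y0 in auto)
        then show "of_int (sign \<pi>) * (\<Prod>i<N. if \<pi> i = k then (\<Sum>l<N. M i l * u l) else M i (\<pi> i)) = 0"
          by simp
      qed
      then show ?thesis using ldet_cramer[OF kN, of M u] DM True by simp
    next
      case False
      then have tp: "tB N > 0" using tB0[of N] by simp
      \<comment> \<open>Scaled by \<open>tB N\<close>, the replaced column has entries at most
        \<open>U * A i\<close>, so each row sum is still 1 plus a multiple of \<open>A i\<close> up
        to products, and the determinant is bounded independently of \<open>N\<close>. Undoing the
        scaling returns the factor \<open>tB N\<close>, which tends to 0.\<close>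
      let ?u = "\<lambda>i. u i / of_real (tB N)"
      let ?C = "\<lambda>i j. if j = k then (\<Sum>l<N. M i l * ?u l) else M i j"
      have C: "(\<Sum>l<N. M i l * ?u l) = y N i / of_real (tB N)" for i
        by (simp add: y_def sum_divide_distrib)
      have "cmod (ldet N ?C) \<le> (\<Prod>i<N. \<Sum>j<N. cmod (?C i j))"
        by (rule ldet_bound) (auto simp: norm_triangle_ineq norm_mult)
      also have "\<dots> \<le> (\<Prod>i<N. (1 + A i * S) * (1 + U * A i))"
      proof (intro prod_mono conjI sum_nonneg)
        fix i assume i: "i \<in> {..<N}"
        have "(\<Sum>j<N. cmod (?C i j)) \<le> (\<Sum>j<N. cmod (M i j) + (if j = k then U * A i else 0))"
        proof (rule sum_mono)
          fix j
          have "cmod (y N i / of_real (tB N)) \<le> U * A i"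
            using yb[of i N] i tp by (simp add: norm_divide field_simps)
          then show "cmod (?C i j) \<le> cmod (M i j) + (if j = k then U * A i else 0)"
            unfolding C by (auto intro: add_increasing)
        qed
        also have "\<dots> \<le> (1 + A i * S) + U * A i"
          using Mrow[of i N] kN by (simp add: sum.distrib)
        also have "\<dots> \<le> (1 + A i * S) * (1 + U * A i)"
          using A(2)[of i] S0 U0 by (simp add: algebra_simps)
        finally show "(\<Sum>j<N. cmod (?C i j)) \<le> (1 + A i * S) * (1 + U * A i)" .
      qed auto
      also have "\<dots> = (\<Prod>i<N. 1 + A i * S) * (\<Prod>i<N. 1 + U * A i)" by (rule prod.distrib)
      also have "\<dots> \<le> R * exp (U * suminf A)"
      proof (intro mult_mono prodb)
        have "(\<Prod>i<N. 1 + U * A i) \<le> exp (\<Sum>i<N. U * A i)"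
          by (rule prod_one_plus_le_exp) (use A U0 in auto)
        also have "\<dots> \<le> exp (U * suminf A)"
          using sumA U0 by (simp add: sum_distrib_left[symmetric] mult_left_mono)
        finally show "(\<Prod>i<N. 1 + U * A i) \<le> exp (U * suminf A)" .
      qed (use A U0 R1 in \<open>auto intro!: prod_nonneg add_nonneg_nonneg\<close>)
      finally have "cmod (ldet N M * ?u k) \<le> R * exp (U * suminf A)"
        using ldet_cramer[OF kN, of M ?u] by simp
      then show ?thesis using tp by (simp add: DM norm_divide norm_mult field_simps)
    qed
    have "(\<lambda>N. R * exp (U * suminf A) * tB N) \<longlonglongrightarrow> 0"
      unfolding tB_def by (rule tendsto_mult_right_zero[OF suminf_exist_split2[OF B(1)]])
    then have "(\<lambda>N. poly (D N) z * u k) \<longlonglongrightarrow> 0"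
      by (rule Lim_null_comparison[rotated]) (use main in \<open>auto intro: eventually_sequentiallyI[of "Suc k"]\<close>)
    moreover have "(\<lambda>N. poly (D N) z * u k) \<longlonglongrightarrow> (\<Sum>k. a k * z ^ k) * u k"
      by (intro tendsto_mult Dlim z tendsto_const)
    ultimately have "(\<Sum>k. a k * z ^ k) * u k = 0" using LIMSEQ_unique by blast
    then show ?thesis using k by simp
  qed
  show ?thesis by (rule that[OF bound a0 ker])
qed

section \<open>The Jost series of a perturbed free operator\<close>

text \<open>
  \<open>- green p\<close> is the kernel of the inverse of \<open>S\<^sup>p + (S*)\<^sup>p - (z + 1 / z)\<close>, which factors: with
  \<open>g n = s n - z s (n - p)\<close> the equation becomes \<open>g (n + p) - g n / z = y n\<close>. Here \<open>green_tail\<close>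
  recovers \<open>g\<close> from \<open>y\<close>, and \<open>green\<close> recovers \<open>s\<close> from \<open>y\<close>.
\<close>

definition green_tail :: "nat \<Rightarrow> nat \<Rightarrow> nat \<Rightarrow> complex poly" where
  "green_tail p n l = (if n \<le> l \<and> p dvd (l - n) then monom 1 (Suc ((l - n) div p)) else 0)"

definition green :: "nat \<Rightarrow> nat \<Rightarrow> nat \<Rightarrow> complex poly" where
  "green p m l = (\<Sum>i\<le>m div p. monom 1 i * green_tail p (m - i * p) l)"

text \<open>Iterating the factored equation upwards leaves the term
  \<open>z ^ J * g (n + J * p)\<close>, which vanishes in the limit because \<open>s\<close> is
  bounded and \<open>cmod z < 1\<close>: boundedness excludes the growing homogeneous solution. From
  \<open>g\<close>, finitely many downward steps of length \<open>p\<close> recover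
  \<open>s\<close>.\<close>

lemma green_sums:
  fixes s y :: "nat \<Rightarrow> complex"
  assumes p: "p \<ge> 1" and z: "cmod z < 1" "z \<noteq> 0" and S: "\<And>n. cmod (s n) \<le> S"
    and y: "\<And>n. y n = s (n + p) + (if n \<ge> p then s (n - p) else 0) - (z + 1 / z) * s n"
  shows "(\<lambda>l. poly (green p m l) z * y l) sums (- s m)"
proof -
  define g where "g n = s n - z * (if n \<ge> p then s (n - p) else 0)" for n
  have S0: "0 \<le> S" using S[of 0] norm_ge_zero order_trans by blast
  have gb: "cmod (g n) \<le> 2 * S" for n
  proof -
    have "cmod z * cmod (s (n - p)) \<le> 1 * S" by (intro mult_mono S) (use z in auto)
    then show ?thesis
      unfolding g_def using S[of n] S0 norm_triangle_ineq4[of "s n" "z * (if n \<ge> p then s (n - p) else 0)"]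
      by (auto simp: norm_mult)
  qed
  have gy: "g n = z * g (n + p) - z * y n" for n
    using z(2) by (simp add: y g_def field_simps)
  have iter: "g n = z ^ J * g (n + J * p) - (\<Sum>j<J. z ^ Suc j * y (n + j * p))" for n J
  proof (induction J)
    case (Suc J)
    then show ?case using gy[of "n + J * p"] by (simp add: algebra_simps)
  qed simp
  have gs: "(\<lambda>j. z ^ Suc j * y (n + j * p)) sums (- g n)" for n
  proof -
    have "(\<lambda>J. z ^ J * g (n + J * p)) \<longlonglongrightarrow> 0"
    proof (rule Lim_null_comparison)
      show "\<forall>\<^sub>F J in sequentially. norm (z ^ J * g (n + J * p)) \<le> cmod z ^ J * (2 * S)"
        by (intro always_eventually allI) (simp add: norm_mult norm_power mult_left_mono gb)
      show "(\<lambda>J. cmod z ^ J * (2 * S)) \<longlonglongrightarrow> 0"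
        by (intro tendsto_mult_left_zero LIMSEQ_power_zero) (use z in auto)
    qed
    then have "(\<lambda>J. z ^ J * g (n + J * p) - g n) \<longlonglongrightarrow> 0 - g n" by (intro tendsto_intros)
    moreover have "z ^ J * g (n + J * p) - g n = (\<Sum>j<J. z ^ Suc j * y (n + j * p))" for J
      using iter[of n J] by simp
    ultimately show ?thesis by (simp add: sums_def)
  qed
  have gs': "(\<lambda>l. poly (green_tail p n l) z * y l) sums (- g n)" for n
  proof (subst sums_mono_reindex[symmetric, where g = "\<lambda>j. n + j * p"])
    show "strict_mono (\<lambda>j. n + j * p)" using p by (auto simp: strict_mono_def)
    show "poly (green_tail p n l) z * y l = 0" if "l \<notin> range (\<lambda>j. n + j * p)" for l
    proof -
      have "\<not> (n \<le> l \<and> p dvd (l - n))"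
      proof
        assume h: "n \<le> l \<and> p dvd (l - n)"
        then obtain j where "l - n = p * j" by (auto elim: dvdE)
        then have "l = n + j * p" using h by (simp add: mult.commute)
        then show False using that by blast
      qed
      then show ?thesis by (auto simp: green_tail_def)
    qed
    have "poly (green_tail p n (n + j * p)) z = z ^ Suc j" for j
      using p by (simp add: green_tail_def poly_monom)
    then show "(\<lambda>j. poly (green_tail p n (n + j * p)) z * y (n + j * p)) sums (- g n)"
      using gs[of n] by simp
  qed
  have "q \<le> m div p \<Longrightarrow> s m = (\<Sum>i<q. z ^ i * g (m - i * p)) + z ^ q * s (m - q * p)" for q
  proof (induction q)
    case (Suc q)
    then have "Suc q * p \<le> m" by (metis div_times_less_eq_dividend le_trans mult_le_mono1)
    then have h: "p \<le> m - q * p" "m - q * p - p = m - Suc q * p" by auto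
    have "s (m - q * p) = g (m - q * p) + z * s (m - Suc q * p)"
      unfolding g_def using h by simp
    then show ?case using Suc by (simp add: algebra_simps)
  qed simp
  from this[of "m div p"] have "s m = (\<Sum>i<m div p. z ^ i * g (m - i * p)) + z ^ (m div p) * s (m mod p)"
    by (simp add: minus_div_mult_eq_mod)
  \<comment> \<open>Below \<open>p\<close> there is no predecessor, so \<open>s\<close> and
    \<open>g\<close> agree and the descent stops.\<close>
  also have "s (m mod p) = g (m - (m div p) * p)"
    using mod_less_divisor[of p m] p by (auto simp: g_def minus_div_mult_eq_mod simp del: mod_less_divisor)
  finally have "- s m = (\<Sum>i\<le>m div p. z ^ i * - g (m - i * p))"
    by (simp add: lessThan_Suc_atMost[symmetric] sum_negf)
  moreover have "(\<lambda>l. \<Sum>i\<le>m div p. z ^ i * (poly (green_tail p (m - i * p) l) z * y l)) sums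
      (\<Sum>i\<le>m div p. z ^ i * - g (m - i * p))"
    by (intro sums_sum sums_mult gs')
  ultimately show ?thesis
    by (simp add: green_def poly_sum poly_monom poly_mult sum_distrib_right mult.assoc)
qed

section \<open>Stretched exponential weights and the perturbed equation\<close>

lemma powr_add_subadditive:
  fixes x y :: real
  assumes "0 \<le> x" "0 \<le> y" "0 < b" "b \<le> 1"
  shows "(x + y) powr b \<le> x powr b + y powr b"
proof (cases "x + y = 0")
  case False
  then have s: "x + y > 0" using assms by simp
  have *: "t * (x + y) powr (b - 1) \<le> t powr b" if "0 \<le> t" "t \<le> x + y" for t
  proof (cases "t = 0")
    case False
    then have t: "t > 0" using that by simp
    have "(x + y) powr (b - 1) \<le> t powr (b - 1)"
      by (rule powr_mono2') (use t that assms in auto)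
    then have "t * (x + y) powr (b - 1) \<le> t powr 1 * t powr (b - 1)"
      using t by (simp add: mult_left_mono)
    also have "\<dots> = t powr b" by (simp only: powr_add[symmetric]) simp
    finally show ?thesis .
  qed simp
  have "(x + y) powr b = (x + y) powr 1 * (x + y) powr (b - 1)"
    using s by (simp only: powr_add[symmetric]) simp
  also have "\<dots> = x * (x + y) powr (b - 1) + y * (x + y) powr (b - 1)"
    using s by (simp add: distrib_right)
  also have "\<dots> \<le> x powr b + y powr b"
    by (intro add_mono *) (use assms in auto)
  finally show ?thesis .
qed (use assms in auto)

lemma submult_weight_exp_powr:
  assumes "0 < b" "b \<le> 1" "0 \<le> c"
  shows "submult_weight (\<lambda>k. exp (c * real k powr b))"
proof
  fix i j :: nat
  have "c * (real i + real j) powr b \<le> c * (real i powr b + real j powr b)"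
    by (intro mult_left_mono powr_add_subadditive) (use assms in auto)
  then show "exp (c * real (i + j) powr b) \<le> exp (c * real i powr b) * exp (c * real j powr b)"
    by (simp add: exp_add[symmetric] distrib_left)
qed (use assms in auto)

lemma summable_poly_exp_powr:
  fixes b c q :: real
  assumes "0 < b" "0 < c"
  shows "summable (\<lambda>n. (real n + q) ^ d * exp (- c * real n powr b))"
proof (rule summable_comparison_test_bigo)
  show "summable (\<lambda>n. norm (1 / real n ^ 2))"
    using inverse_power_summable[of 2, where 'a = real] by (simp add: inverse_eq_divide)
  show "(\<lambda>n. (real n + q) ^ d * exp (- c * real n powr b)) \<in> O(\<lambda>n. 1 / real n ^ 2)"
    using assms by real_asymp
qed

text \<open>Put \<open>y = - V s\<close>. The Green sums send \<open>y\<close> to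
  \<open>- s\<close>, so applying \<open>V\<close> to them gives \<open>y\<close> back:
  \<open>y\<close> is fixed by the product \<open>K0\<close> of \<open>V\<close> and
  \<open>green\<close>, whose entries are polynomials in \<open>z\<close> because \<open>V\<close>
  is constant in \<open>z\<close> and \<open>green\<close> is polynomial.\<close>

lemma jost_series:
  fixes V :: "nat \<Rightarrow> nat \<Rightarrow> complex"
  assumes p: "p \<ge> 1" and b: "0 < b" "b \<le> 1" and c: "0 < c" and C: "0 \<le> C"
    and V: "\<And>n m. cmod (V n m) \<le> C * exp (- c * real n powr b)"
  obtains a :: "nat \<Rightarrow> complex" and M \<kappa> :: real where
    "\<kappa> > 0" "\<And>k. cmod (a k) \<le> M * exp (- \<kappa> * real k powr b)" "a 0 = 1"
    "\<And>z s S. \<lbrakk>cmod z < 1; z \<noteq> 0; \<And>n. cmod (s n) \<le> S; s \<noteq> (\<lambda>_. 0);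
       \<And>n. s (n + p) + (if n \<ge> p then s (n - p) else 0) + (\<Sum>m\<le>n + p. V n m * s m) = (z + 1 / z) * s n\<rbrakk>
       \<Longrightarrow> (\<Sum>k. a k * z ^ k) = 0"
proof -
  \<comment> \<open>Of the decay rate \<open>c\<close> of \<open>V\<close>, each of the two indices
    receives \<open>c / 2\<close>; the weight consumes half of that, and rate \<open>c / 4\<close>
    remains to make \<open>A\<close> and \<open>B\<close> summable.\<close>
  define \<kappa> where "\<kappa> = c / 4"
  define w where "w k = exp (\<kappa> * real k powr b)" for k :: nat
  have \<kappa>: "\<kappa> > 0" using c by (simp add: \<kappa>_def)
  interpret submult_weight w
    unfolding w_def using submult_weight_exp_powr[of b \<kappa>] b \<kappa> by simp
  have wmono: "w i \<le> w j" if "i \<le> j" for i j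
    using that \<kappa> b by (auto simp: w_def intro!: powr_mono2)
  \<comment> \<open>The kernel \<open>V * green\<close> decays along rows but grows along columns; conjugating by \<open>\<rho>\<close>
    splits the decay of \<open>V\<close> evenly between the two.\<close>
  define \<rho> where "\<rho> n = exp (- (c / 2) * real n powr b)" for n :: nat
  have \<rho>0: "\<rho> n > 0" for n by (simp add: \<rho>_def)
  have w\<rho>: "w n * \<rho> n = exp (- \<kappa> * real n powr b)" for n
    by (simp add: w_def \<rho>_def exp_add[symmetric] \<kappa>_def algebra_simps)
  have \<rho>2: "exp (- c * real n powr b) = \<rho> n * \<rho> n" for n
    by (simp add: \<rho>_def exp_add[symmetric] algebra_simps)
  define K0 where "K0 n l = (\<Sum>m\<le>n + p. smult (V n m) (green p m l))" for n l
  define K where "K n l = smult (of_real (\<rho> l / \<rho> n)) (K0 n l)" for n l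
  \<comment> \<open>One factor of the square counts the terms of the sum over \<open>m\<close>, the
    other the terms inside \<open>green p m l\<close>. The trivial power in \<open>B\<close> only
    fits it to \<open>summable_poly_exp_powr\<close>.\<close>
  define A where "A n = C * w p * ((real n + (real p + 1)) ^ 2 * exp (- \<kappa> * real n powr b))" for n :: nat
  define B where "B l = w 1 * ((real l + 0) ^ 0 * exp (- \<kappa> * real l powr b))" for l :: nat
  have tail: "wnorm w (green_tail p n l) \<le> w (l + 1)" for n l
    by (auto simp: green_tail_def intro!: wmono le_trans[OF div_le_dividend])
  have gr: "wnorm w (green p m l) \<le> (real m + 1) * w m * w (l + 1)" for m l
  proof -
    have "wnorm w (green p m l) \<le> (\<Sum>i\<le>m div p. wnorm w (monom 1 i * green_tail p (m - i * p) l))"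
      unfolding green_def by (rule wnorm_sum)
    also have "\<dots> \<le> (\<Sum>i\<le>m div p. w m * w (l + 1))"
    proof (rule sum_mono)
      fix i assume "i \<in> {..m div p}"
      then have i: "i \<le> m" using le_trans[OF _ div_le_dividend[of m p]] by simp
      have "wnorm w (monom 1 i * green_tail p (m - i * p) l) \<le> wnorm w (monom 1 i) * wnorm w (green_tail p (m - i * p) l)"
        by (rule wnorm_mult)
      also have "\<dots> \<le> w m * w (l + 1)"
        using wmono[OF i] by (intro mult_mono tail) auto
      finally show "wnorm w (monom 1 i * green_tail p (m - i * p) l) \<le> w m * w (l + 1)" .
    qed
    also have "\<dots> = (real (m div p) + 1) * (w m * w (l + 1))" by simp
    also have "\<dots> \<le> (real m + 1) * (w m * w (l + 1))"
      by (intro mult_right_mono add_right_mono) (auto simp: div_le_dividend)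
    finally show ?thesis by (simp add: mult_ac)
  qed
  have KAB: "wnorm w (K n l) \<le> A n * B l" for n l
  proof -
    have "wnorm w (K0 n l) \<le> (\<Sum>m\<le>n + p. cmod (V n m) * wnorm w (green p m l))"
      unfolding K0_def using wnorm_sum[of "\<lambda>m. smult (V n m) (green p m l)" "{..n + p}"] by simp
    also have "\<dots> \<le> (\<Sum>m\<le>n + p. (C * (\<rho> n * \<rho> n)) * ((real (n + p) + 1) * w (n + p) * w (l + 1)))"
    proof (rule sum_mono)
      fix m assume m: "m \<in> {..n + p}"
      have "wnorm w (green p m l) \<le> (real m + 1) * w m * w (l + 1)" by (rule gr)
      also have "\<dots> \<le> (real (n + p) + 1) * w (n + p) * w (l + 1)"
        by (intro mult_mono wmono) (use m in auto)
      finally show "cmod (V n m) * wnorm w (green p m l) \<le> (C * (\<rho> n * \<rho> n)) * ((real (n + p) + 1) * w (n + p) * w (l + 1))"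
        using V[of n m] C \<rho>0[of n] by (intro mult_mono) (simp_all flip: \<rho>2)
    qed
    also have "\<dots> = C * (real n + (real p + 1)) ^ 2 * w (n + p) * w (l + 1) * (\<rho> n * \<rho> n)"
      by (simp add: power2_eq_square algebra_simps)
    also have "\<dots> \<le> C * (real n + (real p + 1)) ^ 2 * (w n * w p) * (w l * w 1) * (\<rho> n * \<rho> n)"
      by (intro mult_right_mono mult_mono mult_left_mono wmult) (use C \<rho>0[of n] in auto)
    finally have "wnorm w (K n l) \<le> (\<rho> l / \<rho> n) * (C * (real n + (real p + 1)) ^ 2 * (w n * w p) * (w l * w 1) * (\<rho> n * \<rho> n))"
      using \<rho>0[of l] \<rho>0[of n] by (simp add: K_def norm_divide divide_simps mult_left_mono)
    also have "\<dots> = C * w p * ((real n + (real p + 1)) ^ 2 * (w n * \<rho> n)) * (w 1 * (w l * \<rho> l))"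
      using \<rho>0[of n] by (simp add: field_simps)
    also have "\<dots> = A n * B l" unfolding w\<rho> A_def B_def by simp
    finally show ?thesis .
  qed
  have Kc: "coeff (K n l) 0 = 0" for n l
    by (simp add: K_def K0_def green_def green_tail_def coeff_sum mult_monom coeff_monom 
      if_distrib if_distribR sum.neutral cong: if_cong)
  have sA: "summable A" unfolding A_def by (intro summable_mult summable_poly_exp_powr b \<kappa>)
  have sB: "summable B" unfolding B_def by (intro summable_mult summable_poly_exp_powr b \<kappa>)
  have sw: "summable (\<lambda>k. 1 / w k)"
    using summable_poly_exp_powr[OF b(1) \<kappa>, of 0 0] by (simp add: w_def exp_minus inverse_eq_divide)
  have A0: "0 \<le> A n" and B0: "0 \<le> B n" for n
    using C by (simp_all add: A_def B_def)
  show ?thesis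
  proof (rule fredholm_determinant[of A B K, OF sA A0 sB B0 KAB Kc sw])
    fix a :: "nat \<Rightarrow> complex" and M :: real
    assume a: "\<And>k. cmod (a k) * w k \<le> M" "a 0 = 1"
    and ker: "\<And>z u U. \<lbrakk>cmod z \<le> 1; \<And>n. cmod (u n) \<le> U; u \<noteq> (\<lambda>_. 0);
            \<And>n. u n = (\<Sum>l. poly (K n l) z * u l)\<rbrakk> \<Longrightarrow> (\<Sum>k. a k * z ^ k) = 0"
  show ?thesis
  proof (rule that[of \<kappa> a M, OF \<kappa> _ a(2)])
    fix k
    have "cmod (a k) \<le> M / w k" using a(1)[of k] by (simp add: field_simps)
    then show "cmod (a k) \<le> M * exp (- \<kappa> * real k powr b)"
      by (simp add: w_def exp_minus divide_inverse)
  next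
    fix z s S
    assume z: "cmod z < 1" "z \<noteq> 0" and S: "\<And>n. cmod (s n) \<le> S" and nz: "s \<noteq> (\<lambda>_. 0)"
      and eq: "\<And>n. s (n + p) + (if n \<ge> p then s (n - p) else 0) + (\<Sum>m\<le>n + p. V n m * s m) = (z + 1 / z) * s n"
    define y where "y n = - (\<Sum>m\<le>n + p. V n m * s m)" for n
    have S0: "0 \<le> S" using S[of 0] norm_ge_zero order_trans by blast
    have y: "y n = s (n + p) + (if n \<ge> p then s (n - p) else 0) - (z + 1 / z) * s n" for n
      using eq[of n] unfolding y_def by (simp add: algebra_simps)
    have sm: "(\<lambda>l. poly (green p m l) z * y l) sums (- s m)" for m
      by (rule green_sums[OF p z S y])
    have yK: "(\<lambda>l. poly (K0 n l) z * y l) sums y n" for n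
    proof -
      have "(\<lambda>l. \<Sum>m\<le>n + p. V n m * (poly (green p m l) z * y l)) sums (\<Sum>m\<le>n + p. V n m * - s m)"
        by (intro sums_sum sums_mult sm)
      moreover have "(\<Sum>m\<le>n + p. V n m * (poly (green p m l) z * y l)) = poly (K0 n l) z * y l" for l
        by (simp add: K0_def poly_sum sum_distrib_right mult.assoc)
      moreover have "(\<Sum>m\<le>n + p. V n m * - s m) = y n" by (simp add: y_def sum_negf)
      ultimately show ?thesis by simp
    qed
    \<comment> \<open>The conjugated fixed vector. It stays bounded because \<open>y\<close> decays
      with rate \<open>c\<close>, up to a linear factor, while \<open>\<rho>\<close> decays only
      with rate \<open>c / 2\<close>.\<close>
    define u where "u n = y n / of_real (\<rho> n)" for n
    have "(\<lambda>n. C * S * ((real n + (real p + 1)) ^ 1 * exp (- (c / 2) * real n powr b))) \<longlonglongrightarrow> 0"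
      by (intro summable_LIMSEQ_zero summable_mult summable_poly_exp_powr) (use b c in auto)
    then have "Bseq (\<lambda>n. C * S * ((real n + (real p + 1)) ^ 1 * exp (- (c / 2) * real n powr b)))"
      by (rule convergent_imp_Bseq[OF convergentI])
    then obtain U where U: "\<And>n. norm (C * S * ((real n + (real p + 1)) ^ 1 * exp (- (c / 2) * real n powr b))) \<le> U"
      by (auto simp: Bseq_def)
    have ub: "cmod (u n) \<le> U" for n
    proof -
      have "cmod (y n) \<le> (\<Sum>m\<le>n + p. cmod (V n m * s m))"
        unfolding y_def norm_minus_cancel by (rule norm_sum)
      also have "\<dots> \<le> (\<Sum>m\<le>n + p. C * (\<rho> n * \<rho> n) * S)"
        unfolding norm_mult by (intro sum_mono mult_mono S) (use V[of n] C \<rho>0[of n] in \<open>simp_all flip: \<rho>2\<close>)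
      also have "\<dots> = C * S * (real n + (real p + 1)) * (\<rho> n * \<rho> n)" by (simp add: algebra_simps)
      finally have "cmod (u n) \<le> C * S * (real n + (real p + 1)) * \<rho> n"
        using \<rho>0[of n] by (simp add: u_def norm_divide divide_simps mult_ac)
      also have "\<dots> \<le> U" using U[of n] by (simp add: \<rho>_def abs_le_iff mult_ac)
      finally show ?thesis .
    qed
    \<comment> \<open>If \<open>y\<close> were 0, then \<open>s\<close>, being recovered from
      \<open>y\<close> by the Green sums, would be 0 too.\<close>
    have unz: "u \<noteq> (\<lambda>_. 0)"
    proof
      assume "u = (\<lambda>_. 0)"
      then have "u n = 0" for n by simp
      moreover have "\<rho> n \<noteq> 0" for n using \<rho>0[of n] by simp
      ultimately have "y n = 0" for n by (simp add: u_def)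
      then have "s m = 0" for m using sums_unique2[OF sm[of m], of 0] by simp
      then show False using nz by auto
    qed
    have uK: "u n = (\<Sum>l. poly (K n l) z * u l)" for n
    proof -
      have "(\<lambda>l. poly (K0 n l) z * y l / of_real (\<rho> n)) sums u n"
        unfolding u_def by (intro sums_divide yK)
      moreover have "poly (K0 n l) z * y l / of_real (\<rho> n) = poly (K n l) z * u l" for l
        using \<rho>0[of l] by (simp add: K_def u_def)
      ultimately show ?thesis by (simp add: sums_iff)
    qed
    show "(\<Sum>k. a k * z ^ k) = 0"
      using ker[OF _ ub unz uK] z by simp
  qed
qed
qed

section \<open>Flatness at accumulation points of zeros\<close>

text \<open>Multiplying the truncated binomial expansion of \<open>z ^ n\<close> by
  \<open>z = \<zeta> + (z - \<zeta>)\<close> reproduces the one of \<open>z ^ Suc n\<close>, by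
  Pascal's rule, except for one overflowing top term. This yields a recursion in \<open>n\<close>
  for the remainder.\<close>

lemma power_taylor_step:
  fixes z \<zeta> :: complex
  shows "(\<Sum>j<Suc k. of_nat (Suc n choose j) * \<zeta> ^ (Suc n - j) * (z - \<zeta>) ^ j)
       = z * (\<Sum>j<Suc k. of_nat (n choose j) * \<zeta> ^ (n - j) * (z - \<zeta>) ^ j)
         - of_nat (n choose k) * \<zeta> ^ (n - k) * (z - \<zeta>) ^ Suc k"
proof (induction k)
  case (Suc k)
  have *: "of_nat (n choose Suc k) * \<zeta> ^ (n - k) = of_nat (n choose Suc k) * (\<zeta> ^ (n - Suc k) * \<zeta>)"
  proof (cases "k < n")
    case True
    then have "n - k = Suc (n - Suc k)" by simp
    then show ?thesis by (simp add: mult.commute)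
  qed (simp add: binomial_eq_0)
  have "of_nat (Suc n choose Suc k) * \<zeta> ^ (Suc n - Suc k) * (z - \<zeta>) ^ Suc k
     = (of_nat (n choose k) * \<zeta> ^ (n - k) + of_nat (n choose Suc k) * \<zeta> ^ (n - k)) * (z - \<zeta>) ^ Suc k"
    by (simp add: algebra_simps)
  also have "\<dots> = of_nat (n choose k) * \<zeta> ^ (n - k) * (z - \<zeta>) ^ Suc k
      + z * (of_nat (n choose Suc k) * \<zeta> ^ (n - Suc k) * (z - \<zeta>) ^ Suc k)
      - of_nat (n choose Suc k) * \<zeta> ^ (n - Suc k) * (z - \<zeta>) ^ Suc (Suc k)"
    unfolding * by (simp add: algebra_simps)
  finally show ?case
    using Suc unfolding sum.lessThan_Suc[of _ "Suc k"] by (simp only: distrib_left) simp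
qed (simp add: algebra_simps)

text \<open>Both points may lie on the circle: the recursion only multiplies by numbers of modulus
  at most 1, and the overflow terms add up to the binomial coefficient by Pascal's rule.\<close>

lemma power_taylor_remainder:
  fixes z \<zeta> :: complex
  assumes "cmod z \<le> 1" "cmod \<zeta> \<le> 1"
  shows "cmod (z ^ n - (\<Sum>j<k. of_nat (n choose j) * \<zeta> ^ (n - j) * (z - \<zeta>) ^ j))
     \<le> real (n choose k) * cmod (z - \<zeta>) ^ k"
proof (cases k)
  case 0
  then show ?thesis using assms by (simp add: norm_power power_le_one)
next
  case (Suc k')
  let ?r = "\<lambda>n. z ^ n - (\<Sum>j<Suc k'. of_nat (n choose j) * \<zeta> ^ (n - j) * (z - \<zeta>) ^ j)"
  have "cmod (?r n) \<le> real (n choose Suc k') * cmod (z - \<zeta>) ^ Suc k'"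
  proof (induction n)
    case 0
    have "(\<Sum>j<Suc k'. of_nat (0 choose j) * \<zeta> ^ (0 - j) * (z - \<zeta>) ^ j) = (\<Sum>j<Suc k'. if j = 0 then 1 else 0)"
      by (rule sum.cong) auto
    then show ?case by (simp add: sum.delta)
  next
    case (Suc n)
    have "?r (Suc n) = z * ?r n + of_nat (n choose k') * \<zeta> ^ (n - k') * (z - \<zeta>) ^ Suc k'"
      unfolding power_taylor_step by (simp only: right_diff_distrib power_Suc) simp
    also have "cmod \<dots> \<le> cmod z * cmod (?r n) + real (n choose k') * cmod \<zeta> ^ (n - k') * cmod (z - \<zeta>) ^ Suc k'"
      by (rule order_trans[OF norm_triangle_ineq]) (simp only: norm_mult norm_power norm_of_nat order_refl)
    also have "\<dots> \<le> 1 * (real (n choose Suc k') * cmod (z - \<zeta>) ^ Suc k') + real (n choose k') * 1 * cmod (z - \<zeta>) ^ Suc k'"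
      by (intro add_mono mult_mono Suc.IH) (use assms in \<open>auto simp: power_le_one\<close>)
    also have "\<dots> = real (Suc n choose Suc k') * cmod (z - \<zeta>) ^ Suc k'"
      by (simp add: distrib_right)
    finally show ?case .
  qed
  then show ?thesis using Suc by simp
qed

text \<open>The maximum is attained at \<open>t = s / \<mu>\<close>; the bound gives away the
  further factor \<open>exp (- s)\<close>.\<close>

lemma powr_exp_le:
  fixes t s \<mu> :: real
  assumes "0 < t" "0 < s" "0 < \<mu>"
  shows "t powr s * exp (- \<mu> * t) \<le> (s / \<mu>) powr s"
proof -
  have "ln (\<mu> * t / s) \<le> \<mu> * t / s - 1" using assms by (intro ln_le_minus_one) simp
  then have "s * (ln t - ln (s / \<mu>)) \<le> s * (\<mu> * t / s - 1)"
    using assms by (intro mult_left_mono) (simp_all add: ln_mult ln_div)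
  then have "s * ln t - \<mu> * t \<le> s * ln (s / \<mu>)" using assms by (simp add: algebra_simps)
  then show ?thesis using assms by (simp add: powr_def exp_add[symmetric])
qed

text \<open>\<open>k ^ k / fact k\<close> is a single term of the exponential series at
  \<open>k\<close>.\<close>

lemma power_le_fact_exp: "real k ^ k \<le> fact k * exp (real k)"
proof -
  have "(\<Sum>n\<in>{k}. real k ^ n / fact n) \<le> (\<Sum>n. real k ^ n / fact n)"
    by (rule sum_le_suminf) (auto intro: summable_exp simp: divide_inverse mult.commute[of "_ ^ _"])
  also have "\<dots> = exp (real k)" by (simp add: exp_def divide_inverse_commute)
  finally show ?thesis by (simp add: field_simps)
qed

locale stretched_series =
  fixes a :: "nat \<Rightarrow> complex" and M \<kappa> b :: real
  assumes \<kappa>: "0 < \<kappa>" and b: "0 < b" "b < 1"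
    and a: "\<And>k. cmod (a k) \<le> M * exp (- \<kappa> * real k powr b)"
begin

definition F :: "complex \<Rightarrow> complex" where "F z = (\<Sum>k. a k * z ^ k)"

text \<open>A bound for the Taylor coefficients of order \<open>k\<close>, and for the Taylor
  remainder, valid at every centre in the closed disc.\<close>

definition A :: "nat \<Rightarrow> real" where "A k = (\<Sum>n. cmod (a n) * real (n choose k))"

definition S :: real where "S = (\<Sum>n. exp (- (\<kappa> / 2) * real n powr b))"

definition \<alpha> :: real where "\<alpha> = b / (1 - b)"

lemma \<alpha>_pos: "0 < \<alpha>" using b by (simp add: \<alpha>_def)

lemma M_nonneg: "0 \<le> M"
  using order_trans[OF norm_ge_zero a[of 0]] b by simp

lemma summable_S: "summable (\<lambda>n. exp (- (\<kappa> / 2) * real n powr b))"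
  using summable_poly_exp_powr[of b "\<kappa> / 2" 0 0] b \<kappa> by simp

lemma S_nonneg: "0 \<le> S" unfolding S_def by (rule suminf_nonneg[OF summable_S]) simp

text \<open>\<open>exp 1\<close> comes from \<open>power_le_fact_exp\<close>, the power of
  \<open>2 / (b * \<kappa>)\<close> from maximizing
  \<open>n ^ k * exp (- (\<kappa> / 2) * n powr b)\<close> over \<open>n\<close>.\<close>

definition Q :: real where "Q = exp 1 * (2 / (b * \<kappa>)) powr (1 / b)"

lemma Q_pos: "0 < Q" using b \<kappa> by (simp add: Q_def)

text \<open>Half of the exponential decay of \<open>a n\<close> pays for the binomial coefficient,
  the other half is kept for summing over \<open>n\<close>. The factor \<open>fact k\<close> in the
  denominator of the binomial lowers the exponent from \<open>1 / b\<close> to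
  \<open>1 / b - 1 = 1 / \<alpha>\<close>.\<close>

lemma coeff_choose_bound:
  "cmod (a n) * real (n choose k) \<le> M * (Q * real k powr (1 / \<alpha>)) ^ k * exp (- (\<kappa> / 2) * real n powr b)"
\<comment> \<open>\<open>powr_exp_le\<close> demands a positive exponent, so order 0 is treated
  directly.\<close>
proof (cases "k = 0")
  case True
  have "\<kappa> * real n powr b \<ge> (\<kappa> / 2) * real n powr b" using \<kappa> by (intro mult_right_mono) auto
  then have "M * exp (- \<kappa> * real n powr b) \<le> M * exp (- (\<kappa> / 2) * real n powr b)"
    using M_nonneg by (intro mult_left_mono) auto
  then show ?thesis using a[of n] True by simp
next
  case k: False
  show ?thesis
  proof (cases "n = 0")
    case True
    then show ?thesis using k M_nonneg Q_pos by (simp add: binomial_eq_0)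
  next
    case False
    let ?t = "real n powr b"
    have t: "?t > 0" using False by simp
    have ee: "exp (- \<kappa> * ?t) = exp (- (\<kappa> / 2) * ?t) * exp (- (\<kappa> / 2) * ?t)"
      by (simp add: exp_add[symmetric])
    have "real n ^ k = ?t powr (real k / b)"
      using False b by (simp add: powr_powr powr_realpow)
    then have 1: "real n ^ k * exp (- (\<kappa> / 2) * ?t) \<le> ((real k / b) / (\<kappa> / 2)) powr (real k / b)"
      using powr_exp_le[of ?t "real k / b" "\<kappa> / 2"] k b \<kappa> t by simp
    have 2: "real (n choose k) \<le> real n ^ k * (exp (real k) / real k ^ k)"
    proof -
      have "real ((n choose k) * fact k) \<le> real (n ^ k)" using binomial_fact_pow of_nat_le_iff by blast
      then have "real (n choose k) * fact k \<le> real n ^ k" by simp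
      then have "real (n choose k) * fact k * exp (real k) \<le> real n ^ k * exp (real k)"
        by (rule mult_right_mono) simp
      moreover have "real (n choose k) * real k ^ k \<le> real (n choose k) * (fact k * exp (real k))"
        by (intro mult_left_mono power_le_fact_exp) simp
      ultimately have "real (n choose k) * real k ^ k \<le> real n ^ k * exp (real k)" by (simp only: mult.assoc)
      then show ?thesis using k by (simp add: field_simps)
    qed
    have 3: "((real k / b) / (\<kappa> / 2)) powr (real k / b) * (exp (real k) / real k ^ k)
        = (Q * real k powr (1 / \<alpha>)) ^ k"
    proof -
      have "(real k / b) / (\<kappa> / 2) = (2 / (b * \<kappa>)) * real k" by simp
      then have "((real k / b) / (\<kappa> / 2)) powr (real k / b) = (2 / (b * \<kappa>)) powr (real k / b) * real k powr (real k / b)"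
        by (simp only: powr_mult)
      also have "(2 / (b * \<kappa>)) powr (real k / b) = ((2 / (b * \<kappa>)) powr (1 / b)) ^ k"
        using b \<kappa> by (simp add: powr_realpow[symmetric] powr_powr)
      also have "real k powr (real k / b) = (real k powr (1 / b)) ^ k"
        using k by (simp add: powr_realpow[symmetric] powr_powr)
      also have "real k powr (1 / b) = real k powr (1 / \<alpha>) * real k"
      proof -
        have "1 / b = 1 / \<alpha> + 1" using b by (simp add: \<alpha>_def field_simps)
        then have "real k powr (1 / b) = real k powr (1 / \<alpha>) * real k powr 1" by (simp only: powr_add)
        then show ?thesis by simp
      qed
      finally show ?thesis
        using k by (simp add: Q_def power_mult_distrib exp_of_nat_mult[symmetric])
    qed
    have "cmod (a n) * real (n choose k)
      \<le> (M * exp (- \<kappa> * ?t)) * (real n ^ k * (exp (real k) / real k ^ k))"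
      by (intro mult_mono a 2) (use M_nonneg in auto)
    also have "\<dots> = M * ((real n ^ k * exp (- (\<kappa> / 2) * ?t)) * (exp (real k) / real k ^ k)) * exp (- (\<kappa> / 2) * ?t)"
      unfolding ee by (simp only: mult_ac)
    also have "\<dots> \<le> M * (((real k / b) / (\<kappa> / 2)) powr (real k / b) * (exp (real k) / real k ^ k)) * exp (- (\<kappa> / 2) * ?t)"
      by (intro mult_right_mono mult_left_mono 1) (use M_nonneg in auto)
    finally show ?thesis unfolding 3 .
  qed
qed

lemma summable_A: "summable (\<lambda>n. cmod (a n) * real (n choose k))"
  by (rule summable_comparison_test'[OF summable_mult[OF summable_S], where N = 0])
     (use coeff_choose_bound[of _ k] in auto)

lemma A_bound: "A k \<le> M * S * (Q * real k powr (1 / \<alpha>)) ^ k"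
proof -
  have "A k \<le> (\<Sum>n. M * (Q * real k powr (1 / \<alpha>)) ^ k * exp (- (\<kappa> / 2) * real n powr b))"
    unfolding A_def by (intro suminf_le coeff_choose_bound summable_A summable_mult summable_S)
  also have "\<dots> = M * (Q * real k powr (1 / \<alpha>)) ^ k * S"
    unfolding S_def by (rule suminf_mult[OF summable_S])
  finally show ?thesis by (simp add: mult_ac)
qed

lemma A_nonneg: "0 \<le> A k"
  unfolding A_def by (rule suminf_nonneg[OF summable_A]) simp

lemma summable_F: "cmod z \<le> 1 \<Longrightarrow> summable (\<lambda>k. a k * z ^ k)"
  by (rule summable_comparison_test'[OF summable_A[of 0], where N = 0])
     (simp add: norm_mult norm_power mult_left_le power_le_one)

text \<open>The Taylor coefficients are given by their series and not as derivatives, so centres on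
  the circle are allowed; the remainder is estimated power by power.\<close>

lemma F_taylor:
  assumes "cmod z \<le> 1" "cmod \<zeta> \<le> 1"
  shows "cmod (F z - (\<Sum>j<k. (\<Sum>n. a n * of_nat (n choose j) * \<zeta> ^ (n - j)) * (z - \<zeta>) ^ j))
     \<le> A k * cmod (z - \<zeta>) ^ k"
proof -
  have s: "summable (\<lambda>n. a n * of_nat (n choose j) * \<zeta> ^ (n - j))" for j
    by (rule summable_comparison_test'[OF summable_A[of j], where N = 0])
       (use assms in \<open>simp add: norm_mult norm_power mult_left_le power_le_one\<close>)
  let ?T = "\<lambda>n. \<Sum>j<k. of_nat (n choose j) * \<zeta> ^ (n - j) * (z - \<zeta>) ^ j"
  have "(\<lambda>n. \<Sum>j<k. a n * of_nat (n choose j) * \<zeta> ^ (n - j) * (z - \<zeta>) ^ j) sums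
     (\<Sum>j<k. (\<Sum>n. a n * of_nat (n choose j) * \<zeta> ^ (n - j)) * (z - \<zeta>) ^ j)"
    by (intro sums_sum sums_mult2 summable_sums s)
  from sums_diff[OF summable_sums[OF summable_F[OF assms(1)]] this]
  have "(\<lambda>n. a n * (z ^ n - ?T n)) sums (F z - (\<Sum>j<k. (\<Sum>n. a n * of_nat (n choose j) * \<zeta> ^ (n - j)) * (z - \<zeta>) ^ j))"
    by (simp add: F_def right_diff_distrib sum_distrib_left mult_ac)
  moreover have "cmod (a n * (z ^ n - ?T n)) \<le> cmod (a n) * real (n choose k) * cmod (z - \<zeta>) ^ k" for n
    using power_taylor_remainder[OF assms, of n k] by (simp add: norm_mult mult.assoc mult_left_mono)
  moreover have "(\<lambda>n. cmod (a n) * real (n choose k) * cmod (z - \<zeta>) ^ k) sums (A k * cmod (z - \<zeta>) ^ k)"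
    unfolding A_def by (intro sums_mult2 summable_sums summable_A)
  ultimately show ?thesis
    using norm_suminf_le[of "\<lambda>n. a n * (z ^ n - ?T n)" "\<lambda>n. cmod (a n) * real (n choose k) * cmod (z - \<zeta>) ^ k"]
    by (simp add: sums_iff)
qed

text \<open>If \<open>c j\<close> were the first non-zero Taylor coefficient, \<open>F\<close> would
  equal \<open>c j * (z - \<zeta>) ^ j\<close> up to an error of order \<open>Suc j\<close>, and
  could not vanish arbitrarily close to \<open>\<zeta>\<close>.\<close>

lemma F_flat_power:
  assumes \<zeta>: "cmod \<zeta> \<le> 1" "\<zeta> islimpt {z. cmod z \<le> 1 \<and> F z = 0}" and z: "cmod z \<le> 1"
  shows "cmod (F z) \<le> A k * cmod (z - \<zeta>) ^ k"
proof -
  define c where "c j = (\<Sum>n. a n * of_nat (n choose j) * \<zeta> ^ (n - j))" for j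
  have c0: "c j = 0" for j
  proof (induction j rule: less_induct)
    case (less j)
    show ?case
    proof (rule ccontr)
      assume nz: "c j \<noteq> 0"
      \<comment> \<open>Within this distance the term of order \<open>j\<close> dominates the
        remainder; the \<open>+ 1\<close> avoids division by 0.\<close>
      define e where "e = cmod (c j) / (A (Suc j) + 1)"
      have "e > 0" using nz A_nonneg[of "Suc j"] by (simp add: e_def)
      then obtain x where x: "cmod x \<le> 1" "F x = 0" "x \<noteq> \<zeta>" "dist x \<zeta> < e"
        using \<zeta>(2) unfolding islimpt_approachable by blast
      have "(\<Sum>i<Suc j. c i * (x - \<zeta>) ^ i) = c j * (x - \<zeta>) ^ j"
        using less by simp
      then have "cmod (c j) * cmod (x - \<zeta>) ^ j \<le> A (Suc j) * cmod (x - \<zeta>) ^ Suc j"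
        using F_taylor[OF x(1) \<zeta>(1), of "Suc j"] x(2) by (simp add: c_def[symmetric] norm_mult norm_power)
      then have "cmod (c j) * cmod (x - \<zeta>) ^ j \<le> (A (Suc j) * cmod (x - \<zeta>)) * cmod (x - \<zeta>) ^ j"
        by (simp add: mult_ac)
      then have "cmod (c j) \<le> A (Suc j) * cmod (x - \<zeta>)"
        using x(3) by (subst (asm) mult_le_cancel_right_pos) auto
      also have "\<dots> \<le> A (Suc j) * e"
        using x(4) A_nonneg by (intro mult_left_mono) (auto simp: dist_norm)
      also have "\<dots> < (A (Suc j) + 1) * e" using \<open>e > 0\<close> by simp
      also have "\<dots> = cmod (c j)" using A_nonneg[of "Suc j"] by (simp add: e_def)
      finally show False by simp
    qed
  qed
  show ?thesis using F_taylor[OF z \<zeta>(1), of k] by (simp add: c_def[symmetric] c0)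
qed

text \<open>\<open>exp 1\<close> pays for rounding the Taylor order down to an integer, and
  \<open>+ 1\<close> ensures \<open>C0 \<ge> 1\<close>.\<close>

definition C0 :: real where "C0 = M * S * exp 1 + 1"

text \<open>Makes \<open>c0 * \<delta> powr (- \<alpha>)\<close> the order at which the base of the
  Taylor bound at distance \<open>\<delta>\<close> equals \<open>1 / e\<close>.\<close>

definition c0 :: real where "c0 = (exp 1 * Q) powr (- \<alpha>)"

lemma c0_pos: "0 < c0" using Q_pos by (simp add: c0_def)

lemma C0_ge_1: "1 \<le> C0" using M_nonneg S_nonneg by (simp add: C0_def)

lemma F_bound: "cmod z \<le> 1 \<Longrightarrow> cmod (F z) \<le> C0"
proof -
  assume z: "cmod z \<le> 1"
  have "cmod (F z) \<le> A 0 * cmod (z - 0) ^ 0" using F_taylor[OF z, of 0 0] by simp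
  also have "\<dots> \<le> M * S * 1" using A_bound[of 0] by simp
  also have "\<dots> \<le> M * S * exp 1" using M_nonneg S_nonneg by (intro mult_left_mono) auto
  finally show ?thesis by (simp add: C0_def)
qed

lemma F_flat:
  assumes \<zeta>: "cmod \<zeta> \<le> 1" "\<zeta> islimpt {z. cmod z \<le> 1 \<and> F z = 0}" and z: "cmod z \<le> 1" "z \<noteq> \<zeta>"
  shows "cmod (F z) \<le> C0 * exp (- c0 * cmod (z - \<zeta>) powr (- \<alpha>))"
proof -
  define \<delta> where "\<delta> = cmod (z - \<zeta>)"
  have \<delta>: "\<delta> > 0" using z by (simp add: \<delta>_def)
  define X where "X = (exp 1 * Q * \<delta>) powr (- \<alpha>)"
  have X: "X = c0 * \<delta> powr (- \<alpha>)" using Q_pos \<delta> by (simp add: X_def c0_def powr_mult)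
  have X0: "X > 0" using Q_pos \<delta> by (simp add: X_def)
  \<comment> \<open>This choice makes \<open>Q * \<delta> * real k powr (1 / \<alpha>)\<close> at most \<open>1 / e\<close>.\<close>
  define k where "k = nat \<lfloor>X\<rfloor>"
  have k: "real k \<le> X" "X \<le> real k + 1" using X0 unfolding k_def by linarith+
  have "cmod (F z) \<le> A k * \<delta> ^ k" unfolding \<delta>_def by (rule F_flat_power[OF \<zeta> z(1)])
  also have "\<dots> \<le> M * S * (Q * real k powr (1 / \<alpha>)) ^ k * \<delta> ^ k"
    by (intro mult_right_mono A_bound) (use \<delta> in auto)
  also have "\<dots> = M * S * (Q * \<delta> * real k powr (1 / \<alpha>)) ^ k"
    by (simp add: power_mult_distrib mult_ac)
  also have "\<dots> \<le> M * S * exp (- real k)"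
  proof (intro mult_left_mono)
    have "real k powr (1 / \<alpha>) \<le> X powr (1 / \<alpha>)"
      using k \<alpha>_pos by (intro powr_mono2) auto
    also have "X powr (1 / \<alpha>) = (exp 1 * Q * \<delta>) powr (- \<alpha> * (1 / \<alpha>))"
      unfolding X_def by (rule powr_powr)
    also have "\<dots> = 1 / (exp 1 * Q * \<delta>)"
      using \<alpha>_pos Q_pos \<delta> by (simp add: powr_minus_divide)
    finally have "Q * \<delta> * real k powr (1 / \<alpha>) \<le> Q * \<delta> * (1 / (exp 1 * Q * \<delta>))"
      using Q_pos \<delta> by (intro mult_left_mono) auto
    also have "\<dots> = exp (- 1)" using Q_pos \<delta> by (simp add: exp_minus field_simps)
    finally have "(Q * \<delta> * real k powr (1 / \<alpha>)) ^ k \<le> exp (- 1) ^ k"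
      using Q_pos \<delta> by (intro power_mono) auto
    then show "(Q * \<delta> * real k powr (1 / \<alpha>)) ^ k \<le> exp (- real k)"
      by (simp add: exp_of_nat_mult[symmetric])
  qed (use M_nonneg S_nonneg in auto)
  also have "\<dots> \<le> M * S * (exp 1 * exp (- X))"
    using k M_nonneg S_nonneg by (intro mult_left_mono) (auto simp: exp_add[symmetric])
  also have "\<dots> \<le> C0 * exp (- X)" by (simp add: C0_def algebra_simps)
  finally show ?thesis unfolding X \<delta>_def by simp
qed

lemma F_continuous: "continuous_on (cball 0 1) F"
proof -
  have "uniform_limit (cball 0 1) (\<lambda>n z. \<Sum>k<n. a k * z ^ k) (\<lambda>z. \<Sum>k. a k * z ^ k) sequentially"
    by (rule Weierstrass_m_test[OF _ summable_A[of 0]])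
       (simp add: norm_mult norm_power mult_left_le power_le_one)
  then have "continuous_on (cball 0 1) (\<lambda>z. \<Sum>k. a k * z ^ k)"
    by (rule uniform_limit_theorem[rotated]) (auto intro!: always_eventually continuous_intros)
  then show ?thesis by (simp add: F_def[abs_def])
qed

lemma F_holomorphic: "F holomorphic_on ball 0 1"
proof -
  have "(\<lambda>n. a n * (z - 0) ^ n) sums F z" if "z \<in> ball 0 1" for z
    using summable_sums[OF summable_F[of z]] that by (simp add: F_def)
  then show ?thesis by (rule power_series_holomorphic)
qed

end

section \<open>A discrete Jensen inequality\<close>

lemma prod_int_periodic:
  fixes f :: "int \<Rightarrow> real"
  assumes "\<And>j. f (j + int n) = f j"
  shows "(\<Prod>k<n. f (int k + q)) = (\<Prod>k<n. f (int k))"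
proof -
  define P where "P q = (\<Prod>k<n. f (int k + q))" for q
  have step: "P (q + 1) = P q" for q
  proof (cases n)
    case (Suc m)
    have "P (q + 1) = (\<Prod>k<m. f (int (Suc k) + q)) * f (q + int n)"
      by (simp add: P_def Suc add_ac)
    also have "\<dots> = P q"
      unfolding P_def assms by (simp only: Suc prod.lessThan_Suc_shift) simp
    finally show ?thesis .
  qed (simp add: P_def)
  have "P q = P 0"
  proof (induction q rule: int_induct[where k = 0])
    case (step2 i)
    then show ?case using step[of "i - 1"] by simp
  qed (use step in auto)
  then show ?thesis by (simp add: P_def)
qed

text \<open>
  The maximum principle for the product of the rotated copies of \<open>G\<close> replaces the mean value
  inequality for \<open>ln |G|\<close>, so that no integral of a singular logarithm is needed.
\<close>

lemma max_modulus_rotations: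
  fixes G :: "complex \<Rightarrow> complex" and t0 :: real
  assumes hol: "G holomorphic_on ball 0 1" and cont: "continuous_on (cball 0 1) G"
    and G0: "1 \<le> cmod (G 0)" and n: "n \<ge> 1"
  obtains \<theta> where "t0 \<le> \<theta>" "\<theta> < t0 + 2 * pi / n"
    "1 \<le> (\<Prod>k<n. cmod (G (cis (\<theta> + real k * (2 * pi / n)))))"
proof -
  let ?h = "2 * pi / real n"
  have h: "?h > 0" using n by simp
  define P where "P z = (\<Prod>k<n. G (cis (real k * ?h) * z))" for z
  have Pc: "continuous_on (cball 0 1) P"
    unfolding P_def
    by (intro continuous_on_prod continuous_on_compose2[OF cont] continuous_intros)
       (auto simp: norm_mult)
  have Ph: "P holomorphic_on ball 0 1"
    unfolding P_def
  proof (intro holomorphic_on_prod)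
    fix k
    have "(G \<circ> (\<lambda>z. cis (real k * ?h) * z)) holomorphic_on ball 0 1"
      by (rule holomorphic_on_compose_gen[OF _ hol]) (auto intro!: holomorphic_intros simp: norm_mult)
    then show "(\<lambda>z. G (cis (real k * ?h) * z)) holomorphic_on ball 0 1" by (simp add: comp_def)
  qed
  have "\<exists>z\<in>sphere 0 1. \<forall>y\<in>sphere 0 1. cmod (P y) \<le> cmod (P z)"
    by (rule continuous_attains_sup)
       (auto intro!: continuous_on_norm continuous_on_subset[OF Pc])
  then obtain z where z: "z \<in> sphere 0 1" "\<And>y. y \<in> sphere 0 1 \<Longrightarrow> cmod (P y) \<le> cmod (P z)" by auto
  have "cmod (P 0) \<le> cmod (P z)"
    by (rule maximum_modulus_frontier[of P "ball 0 1"]) (use Ph Pc z(2) in auto)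
  moreover have "1 \<le> cmod (P 0)"
    unfolding P_def using G0 by (simp add: norm_power one_le_power)
  ultimately have Pz: "1 \<le> cmod (P z)" by simp
  obtain \<phi> where \<phi>: "z = cis \<phi>" using z(1) by (metis complex_unimodular_polar mem_sphere_0 cis.ctr)
  \<comment> \<open>Shifts the angle by whole grid steps into the first cell after
    \<open>t0\<close>; the product over a full period does not change.\<close>
  define q where "q = \<lfloor>(\<phi> - t0) / ?h\<rfloor>"
  define \<theta> where "\<theta> = \<phi> - real_of_int q * ?h"
  have q: "real_of_int q \<le> (\<phi> - t0) / ?h" "(\<phi> - t0) / ?h < real_of_int q + 1"
    unfolding q_def by linarith+
  have q': "real_of_int q * ?h \<le> \<phi> - t0" "\<phi> - t0 < (real_of_int q + 1) * ?h"
    using q h by (simp_all only: pos_le_divide_eq pos_divide_less_eq)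
  define f where "f j = cmod (G (cis (\<theta> + real_of_int j * ?h)))" for j
  have per: "f (j + int n) = f j" for j
  proof -
    have "\<theta> + real_of_int (j + int n) * ?h = (\<theta> + real_of_int j * ?h) + 2 * pi"
      using n by (simp add: field_simps)
    then show ?thesis unfolding f_def by (simp add: cis_mult[symmetric])
  qed
  have "cmod (P z) = (\<Prod>k<n. f (int k + q))"
    unfolding P_def prod_norm[symmetric]
  proof (rule prod.cong[OF refl])
    fix k
    have "real k * ?h + \<phi> = \<theta> + real_of_int (int k + q) * ?h"
      unfolding \<theta>_def of_int_add of_int_of_nat_eq distrib_right by simp
    then show "cmod (G (cis (real k * ?h) * z)) = f (int k + q)"
      unfolding f_def \<phi> cis_mult by simp
  qed
  also have "\<dots> = (\<Prod>k<n. f (int k))" by (rule prod_int_periodic[of f n q, OF per])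
  finally have "1 \<le> (\<Prod>k<n. cmod (G (cis (\<theta> + real k * ?h))))"
    using Pz by (simp add: f_def)
  moreover have "t0 \<le> \<theta>" "\<theta> < t0 + ?h"
    using q'[unfolded distrib_right] unfolding \<theta>_def by linarith+
  ultimately show ?thesis using that by blast
qed

lemma card_grid_points:
  fixes \<theta> h u v t0 :: real
  assumes h: "h > 0" and \<theta>: "t0 \<le> \<theta>" "\<theta> < t0 + h" and uv: "t0 \<le> u" "v \<le> t0 + real n * h"
  shows "(v - u) / h - 1 \<le> real (card {k\<in>{..<n}. u < \<theta> + real k * h \<and> \<theta> + real k * h < v})"
proof -
  \<comment> \<open>The extreme indices strictly inside the interval; the window hypotheses keep
    them in \<open>{..<n}\<close>. The range may be empty, which truncation by \<open>nat\<close>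
    absorbs.\<close>
  define k0 where "k0 = \<lfloor>(u - \<theta>) / h\<rfloor> + 1"
  define k1 where "k1 = \<lceil>(v - \<theta>) / h\<rceil> - 1"
  have "(u - \<theta>) / h > -1" using \<theta> uv h by (simp add: field_simps)
  then have k0: "0 \<le> k0" unfolding k0_def by linarith
  have "(v - \<theta>) / h \<le> real n" using \<theta> uv h by (simp add: field_simps)
  then have k1: "k1 < int n" unfolding k1_def by linarith
  have "nat ` {k0..k1} \<subseteq> {k\<in>{..<n}. u < \<theta> + real k * h \<and> \<theta> + real k * h < v}"
  proof safe
    fix k assume k: "k \<in> {k0..k1}"
    then have "real_of_int k > (u - \<theta>) / h" "real_of_int k < (v - \<theta>) / h"
      unfolding k0_def k1_def by (auto; linarith)+
    then show "u < \<theta> + real (nat k) * h" "\<theta> + real (nat k) * h < v"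
      using k k0 h by (simp_all add: field_simps)
    show "nat k < n" using k k0 k1 by auto
  qed
  then have "card (nat ` {k0..k1}) \<le> card {k\<in>{..<n}. u < \<theta> + real k * h \<and> \<theta> + real k * h < v}"
    by (intro card_mono) auto
  moreover have "card (nat ` {k0..k1}) = nat (k1 - k0 + 1)"
    using k0 by (subst card_image) (auto simp: inj_on_def)
  moreover have "(v - u) / h - 1 \<le> real_of_int (k1 - k0 + 1)"
  proof -
    have "(v - u) / h = (v - \<theta>) / h - (u - \<theta>) / h" by (simp add: diff_divide_distrib)
    then show ?thesis unfolding k0_def k1_def by linarith
  qed
  ultimately show ?thesis by linarith
qed

text \<open>At a grid where the product is at least 1, every grid point in interval \<open>j\<close>
  costs the factor \<open>exp (- h j)\<close>, and the rest gain at most \<open>C\<close> each.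
  Taking logarithms and dividing by the number of grid points gives the claim in the limit.\<close>

lemma jensen_intervals:
  fixes G :: "complex \<Rightarrow> complex" and u v h :: "'i \<Rightarrow> real" and t0 C :: real
  assumes hol: "G holomorphic_on ball 0 1" and cont: "continuous_on (cball 0 1) G"
    and G0: "1 \<le> cmod (G 0)" and J: "finite J"
    and C: "\<And>\<theta>. cmod (G (cis \<theta>)) \<le> C"
    and h: "\<And>j. j \<in> J \<Longrightarrow> 0 \<le> h j"
    and sub: "\<And>j. j \<in> J \<Longrightarrow> t0 \<le> u j" "\<And>j. j \<in> J \<Longrightarrow> v j \<le> t0 + 2 * pi"
    and disj: "\<And>i j. \<lbrakk>i \<in> J; j \<in> J; i \<noteq> j\<rbrakk> \<Longrightarrow> {u i<..<v i} \<inter> {u j<..<v j} = {}"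
    and Gh: "\<And>j \<theta>. \<lbrakk>j \<in> J; u j < \<theta>; \<theta> < v j\<rbrakk> \<Longrightarrow> cmod (G (cis \<theta>)) \<le> C * exp (- h j)"
  shows "(\<Sum>j\<in>J. h j * (v j - u j)) \<le> 2 * pi * ln C"
proof -
  let ?X = "\<Sum>j\<in>J. h j * (v j - u j)" and ?Y = "\<Sum>j\<in>J. h j"
  \<comment> \<open>\<open>?Y\<close> is the counting error of at most one grid point per interval;
    it does not grow with \<open>n\<close>.\<close>
  have key: "?X / (2 * pi) * real n \<le> real n * ln C + ?Y" if n: "n \<ge> 1" for n
  proof -
    let ?d = "2 * pi / real n"
    have d: "?d > 0" using n by simp
    obtain \<theta> where \<theta>: "t0 \<le> \<theta>" "\<theta> < t0 + ?d"
      "1 \<le> (\<Prod>k<n. cmod (G (cis (\<theta> + real k * ?d))))"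
      using max_modulus_rotations[OF hol cont G0 n, of t0] by blast
    define x where "x k = \<theta> + real k * ?d" for k :: nat
    define I where "I j k \<longleftrightarrow> u j < x k \<and> x k < v j" for j k
    define H where "H k = (\<Sum>j\<in>J. if I j k then h j else 0)" for k
    have C0: "C > 0"
    proof (rule ccontr)
      assume "\<not> C > 0"
      then have "cmod (G (cis (\<theta> + real k * ?d))) = 0" for k
        using C[of "\<theta> + real k * ?d"] norm_ge_zero[of "G (cis (\<theta> + real k * ?d))"] by linarith
      then show False using \<theta>(3) n by (simp add: power_0_left)
    qed
    have bound: "cmod (G (cis (x k))) \<le> C * exp (- H k)" for k
    proof (cases "\<exists>j\<in>J. I j k")
      case True
      then obtain j where j: "j \<in> J" "I j k" by blast
      have "H k = (\<Sum>i\<in>J. if i = j then h j else 0)"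
        unfolding H_def
      proof (rule sum.cong[OF refl])
        fix i assume i: "i \<in> J"
        show "(if I i k then h i else 0) = (if i = j then h j else 0)"
          using disj[OF i j(1)] j(2) unfolding I_def by (cases "i = j") auto
      qed
      then have "H k = h j" using J j by (simp add: sum.delta)
      then show ?thesis using Gh[OF j(1)] j(2) by (simp add: I_def)
    next
      case False
      then have "H k = 0" unfolding H_def by (intro sum.neutral) auto
      then show ?thesis using C by simp
    qed
    have "1 \<le> (\<Prod>k<n. cmod (G (cis (x k))))" using \<theta>(3) by (simp add: x_def)
    also have "\<dots> \<le> (\<Prod>k<n. C * exp (- H k))"
      by (intro prod_mono) (use bound in auto)
    also have "\<dots> = exp (\<Sum>k<n. ln C - H k)"
      using C0 by (simp add: exp_sum exp_diff exp_minus divide_inverse)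
    finally have "0 \<le> (\<Sum>k<n. ln C - H k)" by simp
    then have 1: "(\<Sum>k<n. H k) \<le> real n * ln C" by (simp add: sum_subtractf)
    have "(\<Sum>k<n. H k) = (\<Sum>j\<in>J. h j * real (card {k\<in>{..<n}. u j < \<theta> + real k * ?d \<and> \<theta> + real k * ?d < v j}))"
      unfolding H_def
    proof (subst sum.swap, rule sum.cong[OF refl])
      fix j
      have "(\<Sum>k<n. if I j k then h j else 0) = (\<Sum>k\<in>{k\<in>{..<n}. I j k}. h j)"
        by (rule sum.inter_filter[symmetric]) simp
      then show "(\<Sum>k<n. if I j k then h j else 0)
         = h j * real (card {k\<in>{..<n}. u j < \<theta> + real k * ?d \<and> \<theta> + real k * ?d < v j})"
        by (simp add: I_def x_def mult.commute)
    qed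
    also have "\<dots> \<ge> (\<Sum>j\<in>J. h j * ((v j - u j) / ?d - 1))"
    proof (intro sum_mono mult_left_mono h card_grid_points)
      show "v j \<le> t0 + real n * ?d" if "j \<in> J" for j using sub(2)[OF that] n by simp
    qed (use d \<theta> sub in auto)
    finally have "(\<Sum>j\<in>J. h j * ((v j - u j) / ?d - 1)) \<le> real n * ln C" using 1 by linarith
    moreover have "(\<Sum>j\<in>J. h j * ((v j - u j) / ?d - 1)) = ?X / (2 * pi) * real n - ?Y"
    proof -
      have "h j * ((v j - u j) / ?d - 1) = h j * (v j - u j) / (2 * pi) * real n - h j" for j
        using n by (simp add: field_simps)
      then show ?thesis by (simp only: sum_subtractf sum_divide_distrib sum_distrib_right)
    qed
    ultimately show ?thesis by linarith
  qed
  have "?X / (2 * pi) \<le> ln C"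
  proof (rule ccontr)
    assume "\<not> ?X / (2 * pi) \<le> ln C"
    then have e: "?X / (2 * pi) - ln C > 0" by simp
    obtain n :: nat where n: "real n * (?X / (2 * pi) - ln C) > ?Y"
      using reals_Archimedean3[OF e] by blast
    have "?Y \<ge> 0" using h by (intro sum_nonneg) auto
    then have "n \<ge> 1" using n by (cases n) auto
    then show False using key[of n] n by (simp add: algebra_simps)
  qed
  then show ?thesis by (simp add: field_simps)
qed

section \<open>Accumulation points of the spectrum\<close>

lemma norm_cis_diff_le: "cmod (cis x - cis y) \<le> \<bar>x - y\<bar>"
proof -
  have "cis x - cis y = cis y * (cis (x - y) - 1)"
    by (simp add: right_diff_distrib cis_mult)
  then have "cmod (cis x - cis y) = cmod (cis (x - y) - 1)" by (simp add: norm_mult)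
  also have "\<dots> = 2 * \<bar>sin ((x - y) / 2)\<bar>"
    using dist_exp_i_1[of "x - y"] by (simp add: cis_conv_exp)
  also have "\<dots> \<le> \<bar>x - y\<bar>" using abs_sin_x_le_abs_x[of "(x - y) / 2"] by simp
  finally show ?thesis .
qed

lemma abs_cos_diff_le: "\<bar>cos x - cos y\<bar> \<le> \<bar>x - y\<bar>" for x y :: real
  using abs_Re_le_cmod[of "cis x - cis y"] norm_cis_diff_le[of x y] by simp

text \<open>\<open>z\<close> and \<open>1 / z\<close> are the two roots of one quadratic, so one of
  them is in the open disc unless both lie on the circle, where \<open>z + 1 / z = 2 * Re z\<close>
  is in \<open>[-2, 2]\<close>.\<close>

lemma joukowski_surj:
  assumes "l \<notin> complex_of_real ` {-2..2}"
  obtains z where "z \<noteq> 0" "cmod z < 1" "l = z + 1 / z"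
proof -
  define z where "z = (l + csqrt (l\<^sup>2 - 4)) / 2"
  have e: "z * z - l * z + 1 = 0"
  proof -
    have "csqrt (l\<^sup>2 - 4) * csqrt (l\<^sup>2 - 4) = l * l - 4"
      using power2_csqrt[of "l\<^sup>2 - 4"] by (simp add: power2_eq_square)
    moreover have "z * z - l * z + 1 = (csqrt (l\<^sup>2 - 4) * csqrt (l\<^sup>2 - 4) - (l * l - 4)) / 4"
      by (simp add: z_def field_simps)
    ultimately show ?thesis by simp
  qed
  have z0: "z \<noteq> 0" using e by auto
  have l: "l = z + 1 / z" using e z0 by (simp add: field_simps)
  have "cmod z \<noteq> 1"
  proof
    assume z1: "cmod z = 1"
    have "1 / z = cnj z" using z1 z0 by (simp add: divide_conv_cnj)
    then have "l = of_real (2 * Re z)" using l by (simp add: complex_eq_iff)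
    moreover have "2 * Re z \<in> {-2..2}" using abs_Re_le_cmod[of z] z1 by auto
    ultimately show False using assms by blast
  qed
  then consider "cmod z < 1" | "cmod z > 1" by linarith
  then show ?thesis
  proof cases
    case 1 then show ?thesis using that z0 l by blast
  next
    case 2
    then show ?thesis using that[of "1 / z"] z0 l by (simp add: norm_divide)
  qed
qed

lemma islimptI_seq:
  fixes x :: "'a::first_countable_topology"
  assumes "\<And>n. f n \<in> S - {x}" "f \<longlonglongrightarrow> x"
  shows "x islimpt S"
  using assms(2) unfolding islimpt_sequential by (intro exI[of _ f] conjI allI assms(1))

text \<open>Only the passage from points of \<open>\<Lambda>\<close> to zeros of \<open>F\<close> is
  recorded; further zeros of \<open>F\<close> do no harm.\<close>

locale jost_zeros = stretched_series +
  fixes \<Lambda> :: "complex set"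
  assumes a0: "a 0 = 1"
    and zeros: "\<And>l. l \<in> \<Lambda> \<Longrightarrow> \<exists>z. z \<noteq> 0 \<and> cmod z < 1 \<and> l = z + 1 / z \<and> F z = 0"
begin

lemma F0: "F 0 = 1"
  by (simp add: F_def a0)

definition Z0 :: "complex set" where "Z0 = {z. cmod z \<le> 1 \<and> F z = 0}"

text \<open>The preimages subconverge in the closed disc. A limit in the open disc would force
  \<open>F = 0\<close> there by the identity theorem, against \<open>F 0 = 1\<close>, so the limit
  is on the circle. Evenness of the cosine allows passing to an angle in \<open>[0, pi]\<close>, at
  the price of not knowing the sign.\<close>

lemma islimpt_Lambda:
  assumes "e islimpt \<Lambda>"
  obtains \<theta> where "0 \<le> \<theta>" "\<theta> \<le> pi" "e = complex_of_real (2 * cos \<theta>)"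
    "cis \<theta> islimpt Z0 \<or> cis (- \<theta>) islimpt Z0"
proof -
  obtain l where l: "\<And>n. l n \<in> \<Lambda> - {e}" "l \<longlonglongrightarrow> e"
    using assms unfolding islimpt_sequential by blast
  have "\<forall>n. \<exists>z. z \<noteq> 0 \<and> cmod z < 1 \<and> l n = z + 1 / z \<and> F z = 0"
    using l(1) zeros by blast
  then obtain z where z: "\<And>n. z n \<noteq> 0" "\<And>n. cmod (z n) < 1" "\<And>n. l n = z n + 1 / z n" "\<And>n. F (z n) = 0"
    by metis
  have "compact (cball (0::complex) 1)" by simp
  then obtain \<zeta> r where r: "\<zeta> \<in> cball 0 1" "strict_mono (r :: nat \<Rightarrow> nat)" "(z \<circ> r) \<longlonglongrightarrow> \<zeta>"
    unfolding compact_def using z(2) by (metis less_imp_le mem_cball_0)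
  have lr: "(\<lambda>n. l (r n)) \<longlonglongrightarrow> e" using LIMSEQ_subseq_LIMSEQ[OF l(2) r(2)] by (simp add: comp_def)
  have zr: "(\<lambda>n. z (r n)) \<longlonglongrightarrow> \<zeta>" using r(3) by (simp add: comp_def)
  \<comment> \<open>Multiplying by \<open>z\<close> avoids dividing by a limit not yet known to be
    non-zero; the resulting quadratic excludes 0.\<close>
  have "(\<lambda>n. z (r n) * l (r n)) \<longlonglongrightarrow> \<zeta> * e" by (intro tendsto_mult zr lr)
  moreover have "z n * l n = z n * z n + 1" for n using z(1)[of n] z(3)[of n] by (simp add: field_simps)
  moreover have "(\<lambda>n. z (r n) * z (r n) + 1) \<longlonglongrightarrow> \<zeta> * \<zeta> + 1" by (intro tendsto_intros zr)
  ultimately have eq: "\<zeta> * e = \<zeta> * \<zeta> + 1" using LIMSEQ_unique by simp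
  then have \<zeta>0: "\<zeta> \<noteq> 0" by auto
  have e: "e = \<zeta> + 1 / \<zeta>" using eq \<zeta>0 by (simp add: field_simps)
  have ne: "z (r n) \<noteq> \<zeta>" for n using l(1)[of "r n"] z(3)[of "r n"] e by auto
  have lim: "\<zeta> islimpt Z0"
    by (rule islimptI_seq[OF _ zr]) (use z ne in \<open>auto simp: Z0_def less_imp_le\<close>)
  have lim': "\<zeta> islimpt {w. w \<in> ball 0 1 \<and> F w = 0}"
    by (rule islimptI_seq[OF _ zr]) (use z ne in auto)
  have "cmod \<zeta> = 1"
  proof (rule ccontr)
    assume "cmod \<zeta> \<noteq> 1"
    then have "\<zeta> \<in> ball 0 1" using r(1) by simp
    then have "F 0 = 0"
      by (intro analytic_continuation[OF F_holomorphic _ _ _ _ lim', of 0]) auto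
    then show False using F0 by simp
  qed
  then have cz: "\<zeta> = cis (Arg \<zeta>)" using \<zeta>0 by (simp add: cis_Arg sgn_eq)
  define \<theta> where "\<theta> = \<bar>Arg \<zeta>\<bar>"
  have "0 \<le> \<theta>" "\<theta> \<le> pi" using Arg_bounded[of \<zeta>] by (auto simp: \<theta>_def)
  moreover have "e = complex_of_real (2 * cos \<theta>)"
  proof -
    have "1 / \<zeta> = cis (- Arg \<zeta>)" by (subst cz) (simp add: inverse_eq_divide flip: cis_inverse)
    then have "e = cis (Arg \<zeta>) + cis (- Arg \<zeta>)" using e cz by simp
    then show ?thesis by (simp add: complex_eq_iff \<theta>_def)
  qed
  moreover have "cis \<theta> islimpt Z0 \<or> cis (- \<theta>) islimpt Z0"
    using lim cz by (cases "Arg \<zeta> \<ge> 0") (auto simp: \<theta>_def)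
  ultimately show ?thesis using that by blast
qed

text \<open>Since \<open>F 0 = 1\<close>, the zeros stay away from the origin, the only pole of
  \<open>z + 1 / z\<close> in the disc.\<close>

lemma bounded_Lambda: "bounded \<Lambda>"
proof -
  have "isCont F 0"
    using F_continuous by (intro continuous_on_interior[of "cball 0 1"]) auto
  then have "\<forall>\<^sub>F z in at 0. F z \<noteq> 0"
    using F0 unfolding isCont_def by (intro tendsto_imp_eventually_ne) auto
  then obtain d where d: "d > 0" "\<And>z. z \<noteq> 0 \<Longrightarrow> cmod z < d \<Longrightarrow> F z \<noteq> 0"
    unfolding eventually_at by (auto simp: dist_norm)
  have "cmod l \<le> 1 + 1 / d" if "l \<in> \<Lambda>" for l
  proof -
    obtain z where z: "z \<noteq> 0" "cmod z < 1" "l = z + 1 / z" "F z = 0" using zeros[OF \<open>l \<in> \<Lambda>\<close>] by blast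
    have "cmod z \<ge> d" using d(2)[of z] z by force
    then have "1 / cmod z \<le> 1 / d" using d(1) by (intro divide_left_mono mult_pos_pos) auto
    then show ?thesis
      using z norm_triangle_ineq[of z "1 / z"] by (simp add: norm_divide)
  qed
  then show ?thesis by (rule boundedI)
qed

text \<open>
  A point of \<open>[-2, 2]\<close> has two preimages on the circle, and zeros may accumulate at only one of
  them; \<open>G\<close> is small near both.
\<close>

definition G :: "complex \<Rightarrow> complex" where "G z = F z * cnj (F (cnj z))"

lemma G_holomorphic: "G holomorphic_on ball 0 1"
proof -
  have "(\<lambda>n. cnj (a n) * (z - 0) ^ n) sums cnj (F (cnj z))" if "z \<in> ball 0 1" for z
  proof -
    have "(\<lambda>n. a n * cnj z ^ n) sums F (cnj z)"
      unfolding F_def using that by (intro summable_sums summable_F) auto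
    then have "(\<lambda>n. cnj (a n * cnj z ^ n)) sums cnj (F (cnj z))" by (simp only: sums_cnj)
    then show ?thesis by simp
  qed
  then have "(\<lambda>z. cnj (F (cnj z))) holomorphic_on ball 0 1" by (rule power_series_holomorphic)
  then show ?thesis unfolding G_def[abs_def] by (intro holomorphic_on_mult F_holomorphic)
qed

lemma G_continuous: "continuous_on (cball 0 1) G"
  unfolding G_def[abs_def]
  by (intro continuous_on_mult F_continuous continuous_on_cnj continuous_on_compose2[OF F_continuous] continuous_intros)
     auto

lemma norm_G_cis: "cmod (G (cis t)) = cmod (F (cis t)) * cmod (F (cis (- t)))"
  by (simp add: G_def norm_mult cis_cnj)

text \<open>With an upper bound \<open>r\<close> in place of the distance, one height serves a whole
  interval, and \<open>z = \<zeta>\<close> is included.\<close>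

lemma F_flat_le:
  assumes \<zeta>: "cmod \<zeta> \<le> 1" "\<zeta> islimpt Z0" and z: "cmod z \<le> 1" and r: "cmod (z - \<zeta>) \<le> r" "0 < r"
  shows "cmod (F z) \<le> C0 * exp (- c0 * r powr (- \<alpha>))"
proof (cases "z = \<zeta>")
  case True
  have "cmod (F z) \<le> A 1 * cmod (z - \<zeta>) ^ 1" using \<zeta> z by (intro F_flat_power) (auto simp: Z0_def)
  then have "cmod (F z) = 0" using True by simp
  then show ?thesis using C0_ge_1 by simp
next
  case False
  have "r powr (- \<alpha>) \<le> cmod (z - \<zeta>) powr (- \<alpha>)"
    using r False \<alpha>_pos by (intro powr_mono2') auto
  then have "C0 * exp (- c0 * cmod (z - \<zeta>) powr (- \<alpha>)) \<le> C0 * exp (- c0 * r powr (- \<alpha>))"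
    using C0_ge_1 c0_pos by (intro mult_left_mono) auto
  moreover have "cmod (F z) \<le> C0 * exp (- c0 * cmod (z - \<zeta>) powr (- \<alpha>))"
    using \<zeta> z False by (intro F_flat) (auto simp: Z0_def)
  ultimately show ?thesis by linarith
qed

definition flat :: "real \<Rightarrow> bool" where
  "flat \<theta> \<longleftrightarrow> cis \<theta> islimpt Z0 \<or> cis (- \<theta>) islimpt Z0"

text \<open>One factor of \<open>G\<close> is flat at the angle, the other is merely bounded by
  \<open>C0\<close>; which is which depends on the sign of the angle.\<close>

lemma G_flat:
  assumes "flat \<phi>" "\<bar>\<theta> - \<phi>\<bar> \<le> r" "0 < r"
  shows "cmod (G (cis \<theta>)) \<le> C0\<^sup>2 * exp (- (c0 * r powr (- \<alpha>)))"
proof -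
  have b: "cmod (F (cis t)) \<le> C0" for t by (rule F_bound) simp
  have pos: "0 \<le> C0" using C0_ge_1 by simp
  consider "cis \<phi> islimpt Z0" | "cis (- \<phi>) islimpt Z0" using assms(1) by (auto simp: flat_def)
  then show ?thesis
  proof cases
    case 1
    have "cmod (F (cis \<theta>)) \<le> C0 * exp (- c0 * r powr (- \<alpha>))"
      by (rule F_flat_le[OF _ 1]) (use assms norm_cis_diff_le[of \<theta> \<phi>] in auto)
    then have "cmod (F (cis \<theta>)) * cmod (F (cis (- \<theta>))) \<le> (C0 * exp (- c0 * r powr (- \<alpha>))) * C0"
      by (intro mult_mono b) (use pos in auto)
    then show ?thesis by (simp add: norm_G_cis power2_eq_square mult_ac)
  next
    case 2
    have "cmod (F (cis (- \<theta>))) \<le> C0 * exp (- c0 * r powr (- \<alpha>))"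
      by (rule F_flat_le[OF _ 2]) (use assms norm_cis_diff_le[of "- \<theta>" "- \<phi>"] in auto)
    then have "cmod (F (cis \<theta>)) * cmod (F (cis (- \<theta>))) \<le> C0 * (C0 * exp (- c0 * r powr (- \<alpha>)))"
      by (intro mult_mono b) (use pos in auto)
    then show ?thesis by (simp add: norm_G_cis power2_eq_square mult_ac)
  qed
qed

section \<open>Length sums of intervals near flat points\<close>

definition K1 :: real where "K1 = 2 * pi * ln (C0\<^sup>2) / (c0 * 2 powr (- \<alpha>))"

text \<open>On an interval of length l the height is \<open>c0 * (2 * l) powr (- \<alpha>)\<close>,
  so it contributes a fixed multiple of \<open>l powr (1 - \<alpha>)\<close> in
  \<open>jensen_intervals\<close>. The slack 2 in \<open>near\<close> admits intervals that only
  approach a flat point, as long as their distance from it is at most their length.\<close>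

lemma carleson_intervals:
  fixes u v :: "'i \<Rightarrow> real" and s :: real
  assumes J: "finite J" and sub: "\<And>j. j \<in> J \<Longrightarrow> s \<le> u j" "\<And>j. j \<in> J \<Longrightarrow> v j \<le> s + 2 * pi"
    and uv: "\<And>j. j \<in> J \<Longrightarrow> u j < v j"
    and disj: "\<And>i j. \<lbrakk>i \<in> J; j \<in> J; i \<noteq> j\<rbrakk> \<Longrightarrow> {u i<..<v i} \<inter> {u j<..<v j} = {}"
    and near: "\<And>j. j \<in> J \<Longrightarrow> \<exists>\<phi>. flat \<phi> \<and> (\<forall>\<theta>. u j < \<theta> \<and> \<theta> < v j \<longrightarrow> \<bar>\<theta> - \<phi>\<bar> \<le> 2 * (v j - u j))"
  shows "(\<Sum>j\<in>J. (v j - u j) powr (1 - \<alpha>)) \<le> K1"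
proof -
  let ?h = "\<lambda>j. c0 * (2 * (v j - u j)) powr (- \<alpha>)"
  have bd: "cmod (G (cis \<theta>)) \<le> C0\<^sup>2" for \<theta>
    unfolding norm_G_cis power2_eq_square
    by (intro mult_mono F_bound) (use C0_ge_1 in auto)
  have "(\<Sum>j\<in>J. ?h j * (v j - u j)) \<le> 2 * pi * ln (C0\<^sup>2)"
  proof (rule jensen_intervals[OF G_holomorphic G_continuous _ J bd _ sub disj])
    show "1 \<le> cmod (G 0)" by (simp add: G_def F0)
    show "cmod (G (cis \<theta>)) \<le> C0\<^sup>2 * exp (- ?h j)" if "j \<in> J" "u j < \<theta>" "\<theta> < v j" for j \<theta>
      using near[OF that(1)] that uv[OF that(1)] by (elim exE conjE) (rule G_flat, auto)
  qed (use c0_pos in auto)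
  moreover
  have "?h j * (v j - u j) = c0 * 2 powr (- \<alpha>) * (v j - u j) powr (1 - \<alpha>)" if "j \<in> J" for j
  proof -
    have "(v j - u j) powr (1 - \<alpha>) = (v j - u j) powr 1 * (v j - u j) powr (- \<alpha>)"
      unfolding powr_add[symmetric] by simp
    then show ?thesis using uv[OF that] by (simp only: powr_mult) simp
  qed
  then have "(\<Sum>j\<in>J. ?h j * (v j - u j)) = c0 * 2 powr (- \<alpha>) * (\<Sum>j\<in>J. (v j - u j) powr (1 - \<alpha>))"
    unfolding sum_distrib_left by (rule sum.cong[OF refl])
  ultimately have "c0 * 2 powr (- \<alpha>) * (\<Sum>j\<in>J. (v j - u j) powr (1 - \<alpha>)) \<le> 2 * pi * ln (C0\<^sup>2)"
    by (simp only:)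
  then show ?thesis using c0_pos by (simp add: K1_def field_simps)
qed

lemma no_flat_points:
  assumes "\<alpha> = 1"
  shows "\<not> flat \<phi>"
proof
  assume flat: "flat \<phi>"
  \<comment> \<open>Each of these intervals is as long as its distance from \<open>\<phi>\<close>,
    which just meets the slack 2. For \<open>\<alpha> = 1\<close> it contributes its length to the
    power 0, that is 1.\<close>
  define u v where "u j = \<phi> + (1 / 2) ^ Suc j" and "v j = \<phi> + (1 / 2) ^ j" for j :: nat
  have "real N \<le> K1" for N
  proof -
    have "(\<Sum>j<N. (v j - u j) powr (1 - \<alpha>)) \<le> K1"
    proof (rule carleson_intervals[where s = \<phi>])
      fix j
      show "\<phi> \<le> u j" "u j < v j" by (simp_all add: u_def v_def)
      have "(1 / 2) ^ j \<le> (1::real)" by (simp add: power_le_one)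
      then show "v j \<le> \<phi> + 2 * pi" using pi_gt3 unfolding v_def by linarith
      show "\<exists>\<phi>'. flat \<phi>' \<and> (\<forall>\<theta>. u j < \<theta> \<and> \<theta> < v j \<longrightarrow> \<bar>\<theta> - \<phi>'\<bar> \<le> 2 * (v j - u j))"
      proof (intro exI[of _ \<phi>] conjI flat allI impI)
        fix \<theta> assume h: "u j < \<theta> \<and> \<theta> < v j"
        have "(1 / 2) ^ Suc j > (0::real)" by simp
        then show "\<bar>\<theta> - \<phi>\<bar> \<le> 2 * (v j - u j)" using h unfolding u_def v_def by simp
      qed
    next
      have *: "{u i<..<v i} \<inter> {u j<..<v j} = {}" if "i < j" for i j
      proof -
        have "(1 / 2) ^ j \<le> (1 / 2 :: real) ^ Suc i" using that by (intro power_decreasing) auto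
        then have "v j \<le> u i" by (simp add: u_def v_def)
        then show ?thesis by auto
      qed
      fix i j :: nat assume "i \<noteq> j"
      then show "{u i<..<v i} \<inter> {u j<..<v j} = {}"
        using *[of i j] *[of j i] by (cases "i < j") auto
    qed auto
    \<comment> \<open>\<open>0 powr 0\<close> is 0, so the contribution is 1 only because the
      lengths are non-zero.\<close>
    moreover have "v j - u j \<noteq> 0" for j by (simp add: u_def v_def)
    ultimately show ?thesis using assms by simp
  qed
  then show False using reals_Archimedean2[of K1] by (meson not_le)
qed

lemma finite_Lambda:
  assumes "\<alpha> = 1"
  shows "{e. e islimpt \<Lambda>} = {}" "finite \<Lambda>"
proof -
  show E: "{e. e islimpt \<Lambda>} = {}"
    using islimpt_Lambda no_flat_points[OF assms] unfolding flat_def by blast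
  show "finite \<Lambda>"
    using bounded_infinite_imp_islimpt[OF order_refl bounded_Lambda] E by blast
qed

section \<open>The accumulation set as a compact real set\<close>

definition X :: "real set" where "X = Re ` {e. e islimpt \<Lambda>}"

lemma X_E: "{e. e islimpt \<Lambda>} = complex_of_real ` X"
proof -
  have "complex_of_real (Re e) = e" if "e islimpt \<Lambda>" for e
    using islimpt_Lambda[OF that] by (metis Re_complex_of_real)
  then show ?thesis unfolding X_def by force
qed

lemma X_sub: "X \<subseteq> {-2..2}"
proof
  fix x assume "x \<in> X"
  then obtain e where e: "e islimpt \<Lambda>" "x = Re e" unfolding X_def by blast
  obtain \<theta> where "e = complex_of_real (2 * cos \<theta>)" using islimpt_Lambda[OF e(1)] by metis
  then have "x = 2 * cos \<theta>" using e(2) by simp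
  then show "x \<in> {-2..2}" using cos_le_one[of \<theta>] cos_ge_minus_one[of \<theta>] by simp
qed

lemma X_compact: "compact X"
proof -
  have "bounded {e. e islimpt \<Lambda>}"
    unfolding X_E using X_sub by (intro boundedI[of _ 2]) (auto simp: abs_le_iff)
  then have "compact {e. e islimpt \<Lambda>}" using closed_limpts by (auto simp: compact_eq_bounded_closed)
  then show ?thesis unfolding X_def by (intro compact_continuous_image continuous_intros)
qed

text \<open>\<open>2 * cos\<close> is Lipschitz with constant 2, so lengths on the line are at most
  twice the lengths of the angles, and \<open>\<alpha> < 1\<close> makes the power monotone. Only
  this direction is used, so the square root behaviour of \<open>arccos\<close> at the ends causes
  no loss.\<close>

lemma carleson_X:
  fixes p q :: "'i \<Rightarrow> real"
  assumes \<alpha>: "\<alpha> < 1" and J: "finite J" and sub: "\<And>j. j \<in> J \<Longrightarrow> -2 \<le> p j" "\<And>j. j \<in> J \<Longrightarrow> q j \<le> 2"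
    and pq: "\<And>j. j \<in> J \<Longrightarrow> p j < q j"
    and disj: "\<And>i j. \<lbrakk>i \<in> J; j \<in> J; i \<noteq> j\<rbrakk> \<Longrightarrow> {p i<..<q i} \<inter> {p j<..<q j} = {}"
    and near: "\<And>j. j \<in> J \<Longrightarrow> X \<inter> {p j..q j} \<noteq> {}"
  shows "(\<Sum>j\<in>J. (q j - p j) powr (1 - \<alpha>)) \<le> 2 powr (1 - \<alpha>) * K1"
proof -
  \<comment> \<open>\<open>arccos\<close> is decreasing, hence the end points trade places.\<close>
  define u v where "u j = arccos (q j / 2)" and "v j = arccos (p j / 2)" for j
  have uv: "0 \<le> u j" "v j \<le> pi" "u j < v j" "cos (u j) = q j / 2" "cos (v j) = p j / 2"
    if "j \<in> J" for j
    using sub[OF that] pq[OF that] unfolding u_def v_def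
    by (auto intro!: arccos_lbound arccos_ubound arccos_less_arccos)
  have img: "2 * cos \<theta> \<in> {p j<..<q j}" if j: "j \<in> J" and "u j < \<theta>" "\<theta> < v j" for j \<theta>
    using cos_monotone_0_pi[of "u j" \<theta>] cos_monotone_0_pi[of \<theta> "v j"] uv[OF j] that by auto
  have len: "q j - p j \<le> 2 * (v j - u j)" if "j \<in> J" for j
    using abs_cos_diff_le[of "u j" "v j"] uv[OF that] by simp
  have "(\<Sum>j\<in>J. (v j - u j) powr (1 - \<alpha>)) \<le> K1"
  proof (rule carleson_intervals[where s = 0])
    fix i j assume ij: "i \<in> J" "j \<in> J" "i \<noteq> j"
    show "{u i<..<v i} \<inter> {u j<..<v j} = {}"
    proof (rule equals0I)
      fix \<theta> assume "\<theta> \<in> {u i<..<v i} \<inter> {u j<..<v j}"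
      then have "2 * cos \<theta> \<in> {p i<..<q i} \<inter> {p j<..<q j}" using img[OF ij(1)] img[OF ij(2)] by simp
      then show False unfolding disj[OF ij] by simp
    qed
  next
    fix j assume j: "j \<in> J"
    show "v j \<le> 0 + 2 * pi" using uv[OF j] pi_gt_zero by linarith
    obtain x where x: "x \<in> X" "p j \<le> x" "x \<le> q j" using near[OF j] by auto
    then obtain e where e: "e islimpt \<Lambda>" "x = Re e" unfolding X_def by blast
    obtain \<phi> where \<phi>: "0 \<le> \<phi>" "\<phi> \<le> pi" "e = complex_of_real (2 * cos \<phi>)" "flat \<phi>"
      using islimpt_Lambda[OF e(1)] unfolding flat_def by metis
    have "cos \<phi> \<le> cos (u j)" "cos (v j) \<le> cos \<phi>" using x e \<phi> uv[OF j] by auto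
    moreover have "cos \<phi> \<le> cos (u j) \<longleftrightarrow> u j \<le> \<phi>" "cos (v j) \<le> cos \<phi> \<longleftrightarrow> \<phi> \<le> v j"
      by (rule cos_mono_le_eq; use uv[OF j] \<phi> in linarith)+
    ultimately have "u j \<le> \<phi>" "\<phi> \<le> v j" by simp_all
    then show "\<exists>\<phi>. flat \<phi> \<and> (\<forall>\<theta>. u j < \<theta> \<and> \<theta> < v j \<longrightarrow> \<bar>\<theta> - \<phi>\<bar> \<le> 2 * (v j - u j))"
      using \<phi>(4) by (intro exI[of _ \<phi>]) auto
  qed (use J uv in auto)
  moreover have "(\<Sum>j\<in>J. (q j - p j) powr (1 - \<alpha>)) \<le> (\<Sum>j\<in>J. 2 powr (1 - \<alpha>) * (v j - u j) powr (1 - \<alpha>))"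
  proof (rule sum_mono)
    fix j assume j: "j \<in> J"
    have "(q j - p j) powr (1 - \<alpha>) \<le> (2 * (v j - u j)) powr (1 - \<alpha>)"
      using \<alpha> pq[OF j] len[OF j] by (intro powr_mono2) auto
    then show "(q j - p j) powr (1 - \<alpha>) \<le> 2 powr (1 - \<alpha>) * (v j - u j) powr (1 - \<alpha>)"
      by (simp only: powr_mult)
  qed
  ultimately show ?thesis
    by (simp add: sum_distrib_left[symmetric]) (smt (verit) mult_left_mono powr_ge_zero)
qed

end

section \<open>Gaps, null sets and Hausdorff dimension\<close>

text \<open>A component of \<open>[-2, 2] - X\<close> may contain -2 or 2 and so be open, half-open
  or closed; enclosing it between the intervals from \<open>Inf\<close> to \<open>Sup\<close> treats
  all shapes at once.\<close>

lemma real_connected_hull: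
  fixes l :: "real set"
  assumes "connected l" "bounded l" "l \<noteq> {}"
  shows "{Inf l<..<Sup l} \<subseteq> l" "l \<subseteq> {Inf l..Sup l}"
proof -
  have b: "bdd_above l" "bdd_below l" using assms bounded_imp_bdd_above bounded_imp_bdd_below by auto
  show "l \<subseteq> {Inf l..Sup l}" using b cInf_lower cSup_upper by auto
  show "{Inf l<..<Sup l} \<subseteq> l"
  proof
    fix x assume x: "x \<in> {Inf l<..<Sup l}"
    obtain y where y: "y \<in> l" "y < x" using x assms(3) b by (metis cInf_less_iff greaterThanLessThan_iff)
    obtain z where z: "z \<in> l" "x < z" using x assms(3) b by (metis less_cSup_iff greaterThanLessThan_iff)
    show "x \<in> l" using connected_contains_Icc[OF assms(1) y(1) z(1)] y z by auto
  qed
qed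

lemma real_connected_measure:
  fixes l :: "real set"
  assumes "connected l" "bounded l" "l \<noteq> {}"
  shows "l \<in> sets borel" "emeasure lborel l = ennreal (Sup l - Inf l)" "measure lborel l = Sup l - Inf l"
proof -
  note h = real_connected_hull[OF assms]
  have "l = {Inf l<..<Sup l} \<union> (l \<inter> {Inf l, Sup l})" using h by force
  moreover have "{Inf l<..<Sup l} \<union> (l \<inter> {Inf l, Sup l}) \<in> sets borel"
    by (intro sets.Un borel_open borel_closed finite_imp_closed) auto
  ultimately show borel: "l \<in> sets borel" by simp
  have le: "Inf l \<le> Sup l" using h(2) assms(3) by force
  have "emeasure lborel {Inf l<..<Sup l} \<le> emeasure lborel l"
    by (rule emeasure_mono[OF h(1)]) (use borel in simp)
  moreover have "emeasure lborel l \<le> emeasure lborel {Inf l..Sup l}"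
    by (rule emeasure_mono[OF h(2)]) simp
  ultimately show e: "emeasure lborel l = ennreal (Sup l - Inf l)" using le by simp
  show "measure lborel l = Sup l - Inf l" using e le by (simp add: measure_def)
qed

locale compact_in_interval =
  fixes X :: "real set"
  assumes X: "compact X" "X \<subseteq> {-2..2}"
begin

abbreviation gaps :: "real set set" where "gaps \<equiv> components ({-2..2} - X)"

lemma gap_props:
  assumes "l \<in> gaps"
  shows "connected l" "bounded l" "l \<noteq> {}" "l \<subseteq> {-2..2} - X"
proof -
  show *: "l \<subseteq> {-2..2} - X" using in_components_subset[OF assms] .
  have "bounded {-2..2::real}" by simp
  then show "bounded l" by (rule bounded_subset) (use * in auto)
qed (use in_components_connected in_components_nonempty assms in auto)

lemma gap_hull:
  assumes "l \<in> gaps"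
  shows "{Inf l<..<Sup l} \<subseteq> l" "l \<subseteq> {Inf l..Sup l}"
  using real_connected_hull[OF gap_props(1-3)[OF assms]] .

lemma gap_measure:
  assumes "l \<in> gaps"
  shows "l \<in> sets borel" "emeasure lborel l = ennreal (Sup l - Inf l)" "measure lborel l = Sup l - Inf l"
  using real_connected_measure[OF gap_props(1-3)[OF assms]] .

lemma gap_bounds:
  assumes "l \<in> gaps"
  shows "-2 \<le> Inf l" "Sup l \<le> 2"
proof -
  show "-2 \<le> Inf l" by (rule cInf_greatest) (use gap_props[OF assms] in auto)
  show "Sup l \<le> 2" by (rule cSup_least) (use gap_props[OF assms] in auto)
qed

text \<open>\<open>X\<close> is closed, so a point of a gap has a neighbourhood in
  \<open>[-2, 2]\<close>, one-sided at the ends, that misses \<open>X\<close> and hence lies in the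
  gap.\<close>

lemma gap_length_pos:
  assumes "l \<in> gaps"
  shows "Inf l < Sup l"
proof -
  note g = gap_props[OF assms]
  obtain t where t: "t \<in> l" using g(3) by blast
  then have tX: "t \<in> - X" "-2 \<le> t" "t \<le> 2" using g(4) by auto
  have "open (- X)" using X(1) compact_imp_closed by blast
  then obtain r where r: "r > 0" "ball t r \<subseteq> - X" using tX by (meson open_contains_ball_eq)
  have sub: "{max (-2) (t - r / 2)..min 2 (t + r / 2)} \<subseteq> l"
  proof (rule components_maximal[OF assms])
    have "{t - r / 2..t + r / 2} \<subseteq> ball t r" using r(1) by (auto simp: dist_real_def)
    then show "{max (-2) (t - r / 2)..min 2 (t + r / 2)} \<subseteq> {-2..2} - X" using r(2) by force
    show "l \<inter> {max (-2) (t - r / 2)..min 2 (t + r / 2)} \<noteq> {}" using t tX r(1) by auto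
  qed simp
  have m: "max (-2) (t - r / 2) < min 2 (t + r / 2)" using tX r(1) by auto
  then have "max (-2) (t - r / 2) \<in> l" "min 2 (t + r / 2) \<in> l" using sub by auto
  then have "Inf l \<le> max (-2) (t - r / 2)" "min 2 (t + r / 2) \<le> Sup l"
    using subsetD[OF gap_hull(2)[OF assms]] by (meson atLeastAtMost_iff)+
  then show ?thesis using m by linarith
qed

text \<open>Compactness gives a nearest point of \<open>X\<close> on one side of a point of the gap;
  nothing in between belongs to \<open>X\<close>, so by maximality the gap extends up to it.\<close>

lemma gap_touches:
  assumes "l \<in> gaps" "X \<noteq> {}"
  shows "X \<inter> {Inf l..Sup l} \<noteq> {}"
proof -
  note g = gap_props[OF assms(1)]
  obtain t where t: "t \<in> l" using g(3) by blast
  have tX: "t \<notin> X" "-2 \<le> t" "t \<le> 2" using g(4) t by auto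
  have tl: "Inf l \<le> t" "t \<le> Sup l" using gap_hull(2)[OF assms(1)] t by auto
  obtain x where x: "x \<in> X" using assms(2) by blast
  then have x2: "-2 \<le> x" "x \<le> 2" using X(2) by auto
  show ?thesis
  proof (cases "t < x")
    case True
    have "compact (X \<inter> {t..x})" using X(1) by (intro compact_Int) auto
    moreover have "X \<inter> {t..x} \<noteq> {}" using x True by auto
    ultimately obtain f where f: "f \<in> X \<inter> {t..x}" "\<And>y. y \<in> X \<inter> {t..x} \<Longrightarrow> f \<le> y"
      using compact_attains_inf by metis
    then have tf: "t < f" using tX by (metis IntE atLeastAtMost_iff order_less_le)
    have "{t..<f} \<subseteq> l"
      by (rule components_maximal[OF assms(1)]) (use f tf t tX x2 in force)+
    then have "y \<in> l" if "t < y" "y < f" for y using that by auto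
    then have "y \<le> Sup l" if "t < y" "y < f" for y using subsetD[OF gap_hull(2)[OF assms(1)]] that by (meson atLeastAtMost_iff)
    then have "f \<le> Sup l" using dense_le_bounded[OF tf] by blast
    then show ?thesis using f(1) tl tf by auto
  next
    case False
    then have xt: "x < t" using x tX by (metis linorder_neqE_linordered_idom)
    have "compact (X \<inter> {x..t})" using X(1) by (intro compact_Int) auto
    moreover have "X \<inter> {x..t} \<noteq> {}" using x xt by auto
    ultimately obtain f where f: "f \<in> X \<inter> {x..t}" "\<And>y. y \<in> X \<inter> {x..t} \<Longrightarrow> y \<le> f"
      using compact_attains_sup by metis
    then have tf: "f < t" using tX by (metis IntE atLeastAtMost_iff order_less_le)
    have "{f<..t} \<subseteq> l"
      by (rule components_maximal[OF assms(1)]) (use f tf t tX x2 in force)+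
    then have "y \<in> l" if "f < y" "y < t" for y using that by auto
    then have "Inf l \<le> y" if "f < y" "y < t" for y using subsetD[OF gap_hull(2)[OF assms(1)]] that by (meson atLeastAtMost_iff)
    then have "Inf l \<le> f" using dense_ge_bounded[OF tf] by blast
    then show ?thesis using f(1) tl tf by auto
  qed
qed

lemma gap_disjoint:
  assumes "l \<in> gaps" "l' \<in> gaps" "l \<noteq> l'"
  shows "{Inf l<..<Sup l} \<inter> {Inf l'<..<Sup l'} = {}"
  using components_nonoverlap[OF assms(1,2)] assms(3) gap_hull(1)[OF assms(1)] gap_hull(1)[OF assms(2)]
  by blast

lemma summable_gaps:
  assumes \<sigma>: "0 < \<sigma>"
    and carl: "\<And>L. \<lbrakk>finite L; L \<subseteq> gaps; X \<noteq> {}\<rbrakk> \<Longrightarrow> (\<Sum>l\<in>L. (Sup l - Inf l) powr \<sigma>) \<le> K"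
  shows "(\<lambda>l. measure lborel l powr \<sigma>) summable_on gaps"
proof (cases "X = {}")
  case True
  have "gaps = {{-2..2}}" unfolding True by (simp add: components_eq_sing_iff)
  then show ?thesis by simp
next
  case False
  show ?thesis
  proof (rule nonneg_bdd_above_summable_on)
    show "bdd_above (sum (\<lambda>l. measure lborel l powr \<sigma>) ` {L. L \<subseteq> gaps \<and> finite L})"
    proof (rule bdd_aboveI2)
      fix L assume L: "L \<in> {L. L \<subseteq> gaps \<and> finite L}"
      have "(\<Sum>l\<in>L. measure lborel l powr \<sigma>) = (\<Sum>l\<in>L. (Sup l - Inf l) powr \<sigma>)"
        by (rule sum.cong) (use L gap_measure(3) in auto)
      also have "\<dots> \<le> K" using carl L False by auto
      finally show "(\<Sum>l\<in>L. measure lborel l powr \<sigma>) \<le> K" .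
    qed
  qed simp
qed

section \<open>Counting the grid cells that meet the set\<close>

definition grid :: "nat \<Rightarrow> nat \<Rightarrow> real" where "grid m i = -2 + 4 * real i / real m"

definition hits :: "nat \<Rightarrow> nat set" where
  "hits m = {i\<in>{..<m}. X \<inter> {grid m i..grid m (Suc i)} \<noteq> {}}"

lemma finite_hits [simp]: "finite (hits m)" by (simp add: hits_def)

lemma grid_step: "grid m (Suc i) - grid m i = 4 / real m"
  by (simp add: grid_def add_divide_distrib)

lemma grid_bounds: "i < m \<Longrightarrow> -2 \<le> grid m i \<and> grid m (Suc i) \<le> 2"
  by (simp add: grid_def field_simps)

lemma grid_less: "i < m \<Longrightarrow> grid m i < grid m (Suc i)"
  using grid_step[of m i] by (smt (verit) divide_pos_pos of_nat_0_less_iff gr_implies_not0 neq0_conv)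

lemma grid_disjoint:
  assumes "i \<noteq> j"
  shows "{grid m i<..<grid m (Suc i)} \<inter> {grid m j<..<grid m (Suc j)} = {}"
proof -
  have *: "{grid m i<..<grid m (Suc i)} \<inter> {grid m j<..<grid m (Suc j)} = {}" if "i < j" for i j
  proof -
    have "grid m (Suc i) \<le> grid m j"
      unfolding grid_def using that by (intro add_left_mono divide_right_mono mult_left_mono) auto
    then show ?thesis by auto
  qed
  show ?thesis using *[of i j] *[of j i] assms by (cases "i < j") auto
qed

lemma grid_covers:
  assumes m: "m \<ge> 1"
  shows "X \<subseteq> (\<Union>i\<in>hits m. {grid m i..grid m (Suc i)})"
proof
  fix x assume x: "x \<in> X"
  then have x2: "-2 \<le> x" "x \<le> 2" using X(2) by auto
  \<comment> \<open>The minimum puts \<open>x = 2\<close> into the last cell.\<close>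
  define i where "i = min (m - 1) (nat \<lfloor>(x + 2) * real m / 4\<rfloor>)"
  have i: "i < m" using m by (simp add: i_def)
  have "real i \<le> (x + 2) * real m / 4"
  proof -
    have "real (nat \<lfloor>(x + 2) * real m / 4\<rfloor>) \<le> (x + 2) * real m / 4"
      using x2 by (intro of_nat_floor) simp
    then show ?thesis unfolding i_def by linarith
  qed
  moreover have "(x + 2) * real m / 4 \<le> real (Suc i)"
  proof (cases "i = m - 1")
    case True
    then have "real (Suc i) = real m" using m by simp
    moreover have "(x + 2) * real m \<le> 4 * real m" by (intro mult_right_mono) (use x2 in auto)
    ultimately show ?thesis by simp
  next
    case False
    then have "i = nat \<lfloor>(x + 2) * real m / 4\<rfloor>" by (auto simp: i_def min_def split: if_splits)
    then show ?thesis by linarith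
  qed
  ultimately have "x \<in> {grid m i..grid m (Suc i)}"
    using m by (simp add: grid_def field_simps)
  then show "x \<in> (\<Union>i\<in>hits m. {grid m i..grid m (Suc i)})" using x i unfolding hits_def by blast
qed

text \<open>The hit cells cover \<open>X\<close> and have total length at most
  \<open>K * (4 / m) powr (1 - \<sigma>)\<close>, which tends to 0.\<close>

lemma null_of_hits:
  assumes \<sigma>: "\<sigma> < 1" and K: "\<And>m. m \<ge> 1 \<Longrightarrow> real (card (hits m)) * (4 / real m) powr \<sigma> \<le> K"
  shows "emeasure lborel X = 0"
proof -
  have Xb: "X \<in> sets lborel" using X(1) by (simp add: borel_compact)
  have "emeasure lborel X \<le> ennreal (K * (4 / real m) powr (1 - \<sigma>))" if m: "m \<ge> 1" for m
  proof -
    have "emeasure lborel X \<le> emeasure lborel (\<Union>i\<in>hits m. {grid m i..grid m (Suc i)})"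
      by (intro emeasure_mono grid_covers m) auto
    also have "\<dots> \<le> (\<Sum>i\<in>hits m. emeasure lborel {grid m i..grid m (Suc i)})"
      by (rule emeasure_subadditive_finite) auto
    also have "\<dots> = (\<Sum>i\<in>hits m. ennreal (4 / real m))"
      by (rule sum.cong) (use grid_less in \<open>auto simp: hits_def grid_step less_imp_le\<close>)
    also have "\<dots> = ennreal (real (card (hits m)) * (4 / real m))"
      by (simp add: ennreal_of_nat_eq_real_of_nat flip: ennreal_mult)
    also have "\<dots> \<le> ennreal (K * (4 / real m) powr (1 - \<sigma>))"
    proof (rule ennreal_leI)
      have "4 / real m = (4 / real m) powr \<sigma> * (4 / real m) powr (1 - \<sigma>)"
        using m by (simp add: powr_add[symmetric])
      then have "real (card (hits m)) * (4 / real m) = (real (card (hits m)) * (4 / real m) powr \<sigma>) * (4 / real m) powr (1 - \<sigma>)"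
        by (simp only: mult.assoc)
      also have "\<dots> \<le> K * (4 / real m) powr (1 - \<sigma>)"
        by (intro mult_right_mono K m) simp
      finally show "real (card (hits m)) * (4 / real m) \<le> K * (4 / real m) powr (1 - \<sigma>)" .
    qed
    finally show ?thesis .
  qed
  moreover have "(\<lambda>m. ennreal (K * (4 / real m) powr (1 - \<sigma>))) \<longlonglongrightarrow> ennreal 0"
  proof (rule tendsto_ennrealI)
    have "(\<lambda>m. 4 / real m) \<longlonglongrightarrow> 0" by (rule lim_const_over_n)
    then have "(\<lambda>m. (4 / real m) powr (1 - \<sigma>)) \<longlonglongrightarrow> 0"
      by (rule tendsto_zero_powrI[where b = "1 - \<sigma>"]) (use \<sigma> in auto)
    then show "(\<lambda>m. K * (4 / real m) powr (1 - \<sigma>)) \<longlonglongrightarrow> 0" by (rule tendsto_mult_right_zero)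
  qed
  ultimately have "emeasure lborel X \<le> ennreal 0"
    by (intro LIMSEQ_le_const[of _ "ennreal 0"]) auto
  then show ?thesis by simp
qed

text \<open>Up to the null set \<open>X\<close>, the hit cells are distributed over the gaps. A gap
  of length l receives at most \<open>min (2 * d) l \<le> (2 * d) powr (1 - \<epsilon>) * l powr
  \<epsilon>\<close>, and the last factor is summable.\<close>

lemma hits_bound:
  assumes null: "emeasure lborel X = 0" and \<epsilon>: "0 < \<epsilon>" "\<epsilon> < 1"
    and sum: "(\<lambda>l. measure lborel l powr \<epsilon>) summable_on gaps" and m: "m \<ge> 1"
  shows "real (card (hits m)) * (4 / real m) \<le> (2 * (4 / real m)) powr (1 - \<epsilon>) * (\<Sum>\<^sub>\<infinity>l\<in>gaps. measure lborel l powr \<epsilon>)"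
proof -
  let ?T = "\<Sum>\<^sub>\<infinity>l\<in>gaps. measure lborel l powr \<epsilon>"
  define d where "d = 4 / real m"
  have d: "d > 0" using m by (simp add: d_def)
  define W where "W = (\<Union>i\<in>hits m. {grid m i<..<grid m (Suc i)})"
  have Wb: "W \<in> sets lborel" unfolding W_def by auto
  have Xb: "X \<in> sets lborel" using X(1) by (simp add: borel_compact)
  have T0: "0 \<le> ?T" by (rule infsum_nonneg) simp
  have eW: "emeasure lborel W = ennreal (real (card (hits m)) * d)"
  proof -
    have "emeasure lborel W = (\<Sum>i\<in>hits m. emeasure lborel {grid m i<..<grid m (Suc i)})"
      unfolding W_def
    proof (rule sum_emeasure[symmetric])
      show "disjoint_family_on (\<lambda>i. {grid m i<..<grid m (Suc i)}) (hits m)"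
        unfolding disjoint_family_on_def using grid_disjoint by blast
    qed auto
    also have "\<dots> = (\<Sum>i\<in>hits m. ennreal d)"
      by (rule sum.cong) (use grid_less in \<open>auto simp: hits_def grid_step less_imp_le d_def\<close>)
    also have "\<dots> = ennreal (real (card (hits m)) * d)"
      using d by (simp add: ennreal_of_nat_eq_real_of_nat flip: ennreal_mult)
    finally show ?thesis .
  qed
  \<comment> \<open>A hit cell contains a point outside the gap \<open>l\<close>, so within \<open>l\<close> it stays \<open>d\<close>-close to an end point.\<close>
  have gapW: "emeasure lborel (W \<inter> l) \<le> ennreal ((2 * d) powr (1 - \<epsilon>) * measure lborel l powr \<epsilon>)" if l: "l \<in> gaps" for l
  proof -
    let ?a = "Inf l" and ?b = "Sup l"
    have lb: "l \<in> sets lborel" using gap_measure(1)[OF l] by simp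
    have pos: "?a < ?b" by (rule gap_length_pos[OF l])
    have "W \<inter> l \<subseteq> {?a..?a + d} \<union> {?b - d..?b}"
    proof
      fix x assume x: "x \<in> W \<inter> l"
      then obtain i where i: "i \<in> hits m" "grid m i < x" "x < grid m (Suc i)" unfolding W_def by auto
      then obtain f where f: "f \<in> X" "grid m i \<le> f" "f \<le> grid m (Suc i)" unfolding hits_def by auto
      have xf: "\<bar>x - f\<bar> \<le> d" using i f grid_step[of m i] unfolding d_def by linarith
      have "f \<notin> l" using gap_props(4)[OF l] f(1) by auto
      then have "f \<le> ?a \<or> ?b \<le> f" using gap_hull(1)[OF l] by force
      moreover have "?a \<le> x" "x \<le> ?b" using gap_hull(2)[OF l] x by auto
      ultimately show "x \<in> {?a..?a + d} \<union> {?b - d..?b}" using xf by auto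
    qed
    then have "emeasure lborel (W \<inter> l) \<le> emeasure lborel ({?a..?a + d} \<union> {?b - d..?b})"
      by (rule emeasure_mono) auto
    also have "\<dots> \<le> emeasure lborel {?a..?a + d} + emeasure lborel {?b - d..?b}"
      by (rule emeasure_subadditive) auto
    also have "\<dots> = ennreal (2 * d)" using d by (simp add: ennreal_plus[symmetric] del: ennreal_plus)
    finally have 1: "emeasure lborel (W \<inter> l) \<le> ennreal (2 * d)" .
    have 2: "emeasure lborel (W \<inter> l) \<le> ennreal (?b - ?a)"
      using emeasure_mono[of "W \<inter> l" l lborel] lb gap_measure(2)[OF l] by simp
    let ?M = "min (2 * d) (?b - ?a)"
    have "emeasure lborel (W \<inter> l) \<le> ennreal ?M"
      using 1 2 by (cases "2 * d \<le> ?b - ?a") (auto simp: min_def)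
    also have "\<dots> \<le> ennreal ((2 * d) powr (1 - \<epsilon>) * (?b - ?a) powr \<epsilon>)"
    proof (rule ennreal_leI)
      have M: "?M > 0" using d pos by simp
      have "?M = ?M powr (1 - \<epsilon>) * ?M powr \<epsilon>" using M by (simp add: powr_add[symmetric])
      also have "\<dots> \<le> (2 * d) powr (1 - \<epsilon>) * (?b - ?a) powr \<epsilon>"
        by (intro mult_mono powr_mono2) (use M d pos \<epsilon> in auto)
      finally show "?M \<le> (2 * d) powr (1 - \<epsilon>) * (?b - ?a) powr \<epsilon>" .
    qed
    finally show ?thesis unfolding gap_measure(3)[OF l] .
  qed
  let ?B = "(2 * d) powr (1 - \<epsilon>) * ?T"
  have fin: "emeasure lborel (\<Union>l\<in>L. W \<inter> l) \<le> ennreal ?B" if L: "finite L" "L \<subseteq> gaps" for L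
  proof -
    have "emeasure lborel (\<Union>l\<in>L. W \<inter> l) \<le> (\<Sum>l\<in>L. emeasure lborel (W \<inter> l))"
      using L gap_measure(1) Wb by (intro emeasure_subadditive_finite) auto
    also have "\<dots> \<le> (\<Sum>l\<in>L. ennreal ((2 * d) powr (1 - \<epsilon>) * measure lborel l powr \<epsilon>))"
      by (intro sum_mono gapW) (use L in auto)
    also have "\<dots> = ennreal ((2 * d) powr (1 - \<epsilon>) * (\<Sum>l\<in>L. measure lborel l powr \<epsilon>))"
      by (simp add: sum_distrib_left sum_ennreal)
    also have "\<dots> \<le> ennreal ?B"
      by (intro ennreal_leI mult_left_mono finite_sum_le_infsum sum L) auto
    finally show ?thesis .
  qed
  \<comment> \<open>Every gap contributes a non-zero term to a summable family.\<close>
  have cnt: "countable gaps"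
  proof -
    have "{l\<in>gaps. measure lborel l powr \<epsilon> \<noteq> 0} = gaps"
      using gap_length_pos gap_measure(3) by force
    then show ?thesis using summable_countable_real[OF sum] by simp
  qed
  have all: "emeasure lborel (\<Union>l\<in>gaps. W \<inter> l) \<le> ennreal ?B"
  proof (cases "gaps = {}")
    case False
    \<comment> \<open>The bound is known for finitely many gaps; an increasing exhaustion carries it
      over to all of them.\<close>
    define A where "A n = (\<Union>l\<in>from_nat_into gaps ` {..<n}. W \<inter> l)" for n :: nat
    have sub: "from_nat_into gaps ` {..<n} \<subseteq> gaps" for n
      using from_nat_into[OF False] by auto
    have "(\<Union>l\<in>gaps. W \<inter> l) = (\<Union>n. A n)"
    proof -
      have in_A: "\<exists>n. x \<in> A n" if l: "l \<in> gaps" and x: "x \<in> W \<inter> l" for x l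
      proof -
        obtain n where "from_nat_into gaps n = l" using from_nat_into_surj[OF cnt l] by blast
        then have "x \<in> A (Suc n)" using x unfolding A_def by auto
        then show ?thesis by blast
      qed
      have "(\<Union>l\<in>gaps. W \<inter> l) \<subseteq> (\<Union>n. A n)"
      proof (rule UN_least)
        fix l assume "l \<in> gaps"
        then show "W \<inter> l \<subseteq> (\<Union>n. A n)" using in_A[of l] by auto
      qed
      moreover have "A n \<subseteq> (\<Union>l\<in>gaps. W \<inter> l)" for n
        unfolding A_def by (rule UN_mono[OF sub]) simp
      ultimately show ?thesis by (simp add: UN_least subset_antisym)
    qed
    moreover have "(SUP n. emeasure lborel (A n)) = emeasure lborel (\<Union>n. A n)"
    proof (rule SUP_emeasure_incseq)
      have "A n \<in> sets lborel" for n
        unfolding A_def using sub[of n] gap_measure(1) Wb by (intro sets.finite_UN) auto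
      then show "range A \<subseteq> sets lborel" by auto
      show "incseq A" unfolding A_def by (intro incseq_SucI UN_mono) auto
    qed
    moreover have "(SUP n. emeasure lborel (A n)) \<le> ennreal ?B"
      unfolding A_def by (intro SUP_least fin sub) auto
    ultimately show ?thesis by simp
  next
    case True
    show ?thesis unfolding True by simp
  qed
  have "W \<subseteq> X \<union> (\<Union>l\<in>gaps. W \<inter> l)"
  proof
    fix x assume x: "x \<in> W"
    then obtain i where "i \<in> hits m" "grid m i < x" "x < grid m (Suc i)" unfolding W_def by auto
    then have "x \<in> {-2..2}" using grid_bounds[of i m] unfolding hits_def by auto
    then show "x \<in> X \<union> (\<Union>l\<in>gaps. W \<inter> l)" using x Union_components[of "{-2..2} - X"] by blast
  qed
  moreover have Ub: "(\<Union>l\<in>gaps. W \<inter> l) \<in> sets lborel"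
    using cnt gap_measure(1) Wb by (intro sets.countable_UN') auto
  ultimately have "emeasure lborel W \<le> emeasure lborel (X \<union> (\<Union>l\<in>gaps. W \<inter> l))"
    using Xb by (intro emeasure_mono) auto
  also have "\<dots> \<le> emeasure lborel X + emeasure lborel (\<Union>l\<in>gaps. W \<inter> l)"
    by (rule emeasure_subadditive[OF Xb Ub])
  also have "\<dots> \<le> ennreal ?B" using all null by simp
  finally show ?thesis
    unfolding eW d_def[symmetric] using T0 by (subst (asm) ennreal_le_iff) auto
qed

lemma hausdorff_premeasure_hits:
  assumes "0 < s" "m \<ge> 1" "4 / real m \<le> \<delta>"
  shows "hausdorff_premeasure s \<delta> (complex_of_real ` X) \<le> ennreal (real (card (hits m)) * (4 / real m) powr s)"
proof -
  define U where "U i = (if i \<in> hits m then complex_of_real ` {grid m i..grid m (Suc i)} else {})" for i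
  have diam: "diameter (U i) \<le> 4 / real m" for i
  proof (rule diameter_le)
    fix x y assume "x \<in> U i" "y \<in> U i"
    then obtain a b where ab: "x = complex_of_real a" "y = complex_of_real b"
      "a \<in> {grid m i..grid m (Suc i)}" "b \<in> {grid m i..grid m (Suc i)}"
      by (auto simp: U_def split: if_splits)
    have "cmod (x - y) = \<bar>a - b\<bar>" unfolding ab of_real_diff[symmetric] norm_of_real ..
    also have "\<dots> \<le> grid m (Suc i) - grid m i" using ab by auto
    finally show "cmod (x - y) \<le> 4 / real m" unfolding grid_step .
  qed simp
  have bdd: "bounded (U i)" for i
    by (auto simp: U_def intro!: compact_imp_bounded compact_continuous_image continuous_intros)
  have cov: "complex_of_real ` X \<subseteq> (\<Union>i. U i)"
    using grid_covers[OF assms(2)] by (fastforce simp: U_def)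
  have "hausdorff_premeasure s \<delta> (complex_of_real ` X) \<le> (\<Sum>i. ennreal (diameter (U i) powr s))"
    unfolding hausdorff_premeasure_def
    by (rule INF_lower) (use cov bdd diam assms(3) order_trans in blast)
  also have "\<dots> = (\<Sum>i\<in>hits m. ennreal (diameter (U i) powr s))"
    by (rule suminf_finite) (use assms(1) in \<open>auto simp: U_def\<close>)
  also have "\<dots> \<le> (\<Sum>i\<in>hits m. ennreal ((4 / real m) powr s))"
    by (intro sum_mono ennreal_leI powr_mono2 diam diameter_ge_0 bdd) (use assms(1) in auto)
  also have "\<dots> = ennreal (real (card (hits m)) * (4 / real m) powr s)"
    by (simp add: ennreal_of_nat_eq_real_of_nat flip: ennreal_mult)
  finally show ?thesis .
qed

text \<open>By \<open>hits_bound\<close> the number of hit cells grows at most like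
  \<open>m powr \<epsilon>\<close>, so for \<open>s > \<epsilon>\<close> the cost of this cover
  tends to 0 under refinement.\<close>

lemma hausdorff_measure_zero:
  assumes null: "emeasure lborel X = 0" and \<epsilon>: "0 < \<epsilon>" "\<epsilon> < 1"
    and sum: "(\<lambda>l. measure lborel l powr \<epsilon>) summable_on gaps" and s: "\<epsilon> < s"
  shows "hausdorff_measure s (complex_of_real ` X) = 0"
proof -
  let ?T = "\<Sum>\<^sub>\<infinity>l\<in>gaps. measure lborel l powr \<epsilon>"
  have "hausdorff_premeasure s \<delta> (complex_of_real ` X) \<le> ennreal 0" if \<delta>: "\<delta> > 0" for \<delta>
  proof (rule LIMSEQ_le_const)
    show "(\<lambda>m. ennreal (2 powr (1 - \<epsilon>) * ?T * (4 / real m) powr (s - \<epsilon>))) \<longlonglongrightarrow> ennreal 0"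
    proof (rule tendsto_ennrealI)
      have "(\<lambda>m. 4 / real m) \<longlonglongrightarrow> 0" by (rule lim_const_over_n)
      then have "(\<lambda>m. (4 / real m) powr (s - \<epsilon>)) \<longlonglongrightarrow> 0"
        by (rule tendsto_zero_powrI[where b = "s - \<epsilon>"]) (use s in auto)
      then show "(\<lambda>m. 2 powr (1 - \<epsilon>) * ?T * (4 / real m) powr (s - \<epsilon>)) \<longlonglongrightarrow> 0"
        by (rule tendsto_mult_right_zero)
    qed
    obtain N :: nat where N: "real N > 4 / \<delta>" using reals_Archimedean2 by blast
    show "\<exists>N. \<forall>m\<ge>N. hausdorff_premeasure s \<delta> (complex_of_real ` X)
        \<le> ennreal (2 powr (1 - \<epsilon>) * ?T * (4 / real m) powr (s - \<epsilon>))"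
    proof (intro exI[of _ "Suc N"] allI impI)
      fix m assume m: "Suc N \<le> m"
      then have m1: "m \<ge> 1" by simp
      have "4 / \<delta> \<le> real m" using N m by linarith
      then have m2: "4 / real m \<le> \<delta>" using \<delta> m1 by (simp add: field_simps)
      have "hausdorff_premeasure s \<delta> (complex_of_real ` X) \<le> ennreal (real (card (hits m)) * (4 / real m) powr s)"
        by (rule hausdorff_premeasure_hits) (use m1 m2 \<epsilon> s in auto)
      also have "\<dots> \<le> ennreal (2 powr (1 - \<epsilon>) * ?T * (4 / real m) powr (s - \<epsilon>))"
      proof (rule ennreal_leI)
        have q: "4 / real m > 0" using m1 by simp
        have "(4 / real m) powr s = (4 / real m) powr 1 * (4 / real m) powr (s - 1)"
          by (simp only: powr_add[symmetric]) simp
        then have "real (card (hits m)) * (4 / real m) powr s = (real (card (hits m)) * (4 / real m)) * (4 / real m) powr (s - 1)"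
          using q by simp
        also have "\<dots> \<le> ((2 * (4 / real m)) powr (1 - \<epsilon>) * ?T) * (4 / real m) powr (s - 1)"
          by (intro mult_right_mono hits_bound[OF null \<epsilon> sum m1]) simp
        also have "\<dots> = 2 powr (1 - \<epsilon>) * ?T * ((4 / real m) powr (1 - \<epsilon>) * (4 / real m) powr (s - 1))"
          by (simp only: powr_mult mult_ac)
        also have "(4 / real m) powr (1 - \<epsilon>) * (4 / real m) powr (s - 1) = (4 / real m) powr (s - \<epsilon>)"
          by (simp only: powr_add[symmetric]) simp
        finally show "real (card (hits m)) * (4 / real m) powr s \<le> 2 powr (1 - \<epsilon>) * ?T * (4 / real m) powr (s - \<epsilon>)" .
      qed
      finally show "hausdorff_premeasure s \<delta> (complex_of_real ` X)
        \<le> ennreal (2 powr (1 - \<epsilon>) * ?T * (4 / real m) powr (s - \<epsilon>))" .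
    qed
  qed
  then have "hausdorff_measure s (complex_of_real ` X) \<le> 0"
    unfolding hausdorff_measure_def by (intro SUP_least) auto
  then show ?thesis by simp
qed

lemma hausdorff_dim_le_exponent:
  assumes null: "emeasure lborel X = 0" and \<epsilon>: "0 < \<epsilon>" "\<epsilon> < 1"
    and sum: "(\<lambda>l. measure lborel l powr \<epsilon>) summable_on gaps"
  shows "hausdorff_dim (complex_of_real ` X) \<le> ereal \<epsilon>"
proof (rule ereal_le_epsilon2)
  fix e :: real assume e: "0 < e"
  have "hausdorff_dim (complex_of_real ` X) \<le> ereal (\<epsilon> + e)"
    unfolding hausdorff_dim_def
    by (rule INF_lower) (use hausdorff_measure_zero[OF null \<epsilon> sum, of "\<epsilon> + e"] e \<epsilon> in auto)
  then show "hausdorff_dim (complex_of_real ` X) \<le> ereal \<epsilon> + ereal e" by simp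
qed

lemma hausdorff_dim_le_convergence_exponent:
  assumes null: "emeasure lborel X = 0" and \<sigma>: "0 < \<sigma>" "\<sigma> < 1"
    and sum: "(\<lambda>l. measure lborel l powr \<sigma>) summable_on gaps"
  shows "hausdorff_dim (complex_of_real ` X) \<le> convergence_exponent X"
  unfolding convergence_exponent_def
proof (rule INF_greatest)
  fix \<epsilon> assume \<epsilon>: "\<epsilon> \<in> {\<epsilon>. 0 < \<epsilon> \<and> (\<lambda>l. measure lborel l powr \<epsilon>) summable_on gaps}"
  show "hausdorff_dim (complex_of_real ` X) \<le> ereal \<epsilon>"
  proof (cases "\<epsilon> < 1")
    case True
    then show ?thesis using hausdorff_dim_le_exponent[OF null] \<epsilon> by simp
  next
    case False
    \<comment> \<open>The infimum also ranges over exponents of at least 1, where the counting bound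
      does not apply; the admissible \<open>\<sigma> < 1\<close> lies below them.\<close>
    have "hausdorff_dim (complex_of_real ` X) \<le> ereal \<sigma>" by (rule hausdorff_dim_le_exponent[OF null \<sigma> sum])
    also have "\<dots> \<le> ereal \<epsilon>" using False \<sigma> by simp
    finally show ?thesis .
  qed
qed

end

section \<open>Banded matrices\<close>

text \<open>Each entry of row \<open>i\<close> within the band accounts for one summand of
  \<open>band_dev p D i\<close>, the two outermost ones compared with 1. Both indices being at least
  1, the convention for missing entries does not interfere.\<close>

lemma band_dev_bound:
  assumes p: "p \<ge> 1" and ij: "i \<ge> 1" "j \<ge> 1" "\<bar>int i - int j\<bar> \<le> int p"
  shows "cmod (D i j - (if \<bar>int i - int j\<bar> = int p then 1 else 0)) \<le> band_dev p D i"
proof -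
  define f where "f r = cmod (ext_entry p D (int i) (int i + r))" for r
  have e: "ext_entry p D (int i) (int j) = D i j" using ij unfolding ext_entry_def by (simp add: min_def)
  have S0: "0 \<le> (\<Sum>r\<in>{- int p + 1..int p - 1}. f r)" by (rule sum_nonneg) (simp add: f_def)
  have B: "band_dev p D i = cmod (ext_entry p D (int i) (int i - int p) - 1)
      + (\<Sum>r\<in>{- int p + 1..int p - 1}. f r) + cmod (ext_entry p D (int i) (int i + int p) - 1)"
    by (simp add: band_dev_def f_def)
  consider "int j = int i - int p" | "int j = int i + int p" | "\<bar>int i - int j\<bar> < int p" using ij(3) by linarith
  then show ?thesis
  proof cases
    case 1
    then show ?thesis using S0 p e unfolding B by simp
  next
    case 2
    then show ?thesis using S0 p e unfolding B by simp
  next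
    case 3
    have "cmod (D i j) = f (int j - int i)" unfolding f_def using e by simp
    also have "\<dots> = (\<Sum>r\<in>{int j - int i}. f r)" by simp
    also have "\<dots> \<le> (\<Sum>r\<in>{- int p + 1..int p - 1}. f r)"
      by (rule sum_mono2) (use 3 in \<open>auto simp: f_def\<close>)
    finally show ?thesis unfolding B using 3 norm_ge_zero by (smt (verit) diff_zero)
  qed
qed

lemma mat_op_banded:
  assumes "banded p D" "i \<ge> 1"
  shows "mat_op D x i = (\<Sum>j\<in>{1..i + p}. D i j * x j)"
proof -
  have "mat_op D x i = (\<Sum>\<^sub>\<infinity>j\<in>{1..}. D i j * x j)" using assms(2) by (simp add: mat_op_def)
  also have "\<dots> = (\<Sum>\<^sub>\<infinity>j\<in>{1..i + p}. D i j * x j)"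
    by (rule infsum_cong_neutral) (use assms in \<open>auto simp: banded_def\<close>)
  finally show ?thesis by simp
qed

lemma l2_bounded:
  assumes "x \<in> l2"
  obtains S where "\<And>n. cmod (x n) \<le> S"
proof -
  have "summable (\<lambda>n. (cmod (x n))\<^sup>2)" using assms by (simp add: l2_def)
  then have "(\<lambda>n. (cmod (x n))\<^sup>2) \<longlonglongrightarrow> 0" by (rule summable_LIMSEQ_zero)
  then have "Bseq (\<lambda>n. (cmod (x n))\<^sup>2)" by (rule convergent_imp_Bseq[OF convergentI])
  then obtain K where K: "\<And>n. norm ((cmod (x n))\<^sup>2) \<le> K" by (auto simp: Bseq_def)
  have "cmod (x n) \<le> sqrt K" for n using K[of n] by (simp add: real_le_rsqrt)
  then show ?thesis using that by blast
qed

text \<open>\<open>V\<close> is \<open>D\<close> minus the free matrix, re-indexed from 0. The row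
  deviation bounds all its entries in a row alike, and shifting from \<open>Suc n\<close> to
  \<open>n\<close> only weakens the exponential bound.\<close>

lemma eigenvalue_series:
  assumes p: "p \<ge> 1" and b: "0 < \<beta>" "\<beta> < 1" and D: "D \<in> P_class p \<beta>"
  obtains a :: "nat \<Rightarrow> complex" and M \<kappa> :: real where
    "\<kappa> > 0" "\<And>k. cmod (a k) \<le> M * exp (- \<kappa> * real k powr \<beta>)" "a 0 = 1"
    "\<And>l. l \<in> discrete_spectrum D \<Longrightarrow> \<exists>z. z \<noteq> 0 \<and> cmod z < 1 \<and> l = z + 1 / z \<and> (\<Sum>k. a k * z ^ k) = 0"
proof -
  have band: "banded p D" using D by (simp add: P_class_def)
  obtain C1 C2 where C: "C1 > 0" "C2 > 0"
    "\<And>n. n \<ge> 1 \<Longrightarrow> band_dev p D n \<le> C1 * exp (- C2 * real n powr \<beta>)"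
    using D unfolding P_class_def by blast
  define N where "N n m \<longleftrightarrow> \<bar>int n - int m\<bar> = int p" for n m :: nat
  define V where "V n m = (if \<bar>int n - int m\<bar> \<le> int p then D (Suc n) (Suc m) - (if N n m then 1 else 0) else 0)"
    for n m :: nat
  have V: "cmod (V n m) \<le> C1 * exp (- C2 * real n powr \<beta>)" for n m
  proof (cases "\<bar>int n - int m\<bar> \<le> int p")
    case True
    have "cmod (V n m) \<le> band_dev p D (Suc n)"
      using band_dev_bound[OF p, of "Suc n" "Suc m" D] True by (simp add: V_def N_def)
    also have "\<dots> \<le> C1 * exp (- C2 * real (Suc n) powr \<beta>)" by (rule C(3)) simp
    also have "\<dots> \<le> C1 * exp (- C2 * real n powr \<beta>)"
    proof -
      have "real n powr \<beta> \<le> real (Suc n) powr \<beta>" by (rule powr_mono2) (use b in auto)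
      then show ?thesis using C by simp
    qed
    finally show ?thesis .
  next
    case False
    then show ?thesis using C by (simp add: V_def)
  qed
  show ?thesis
  proof (rule jost_series[OF p b(1) less_imp_le[OF b(2)] C(2) less_imp_le[OF C(1)] V])
    fix a :: "nat \<Rightarrow> complex" and M \<kappa> :: real
    assume a: "\<kappa> > 0" "\<And>k. cmod (a k) \<le> M * exp (- \<kappa> * real k powr \<beta>)" "a 0 = 1"
      and ker: "\<And>z s S. \<lbrakk>cmod z < 1; z \<noteq> 0; \<And>n. cmod (s n) \<le> S; s \<noteq> (\<lambda>_. 0);
       \<And>n. s (n + p) + (if n \<ge> p then s (n - p) else 0) + (\<Sum>m\<le>n + p. V n m * s m) = (z + 1 / z) * s n\<rbrakk>
       \<Longrightarrow> (\<Sum>k. a k * z ^ k) = 0"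
    have "\<exists>z. z \<noteq> 0 \<and> cmod z < 1 \<and> l = z + 1 / z \<and> (\<Sum>k. a k * z ^ k) = 0"
      if l: "l \<in> discrete_spectrum D" for l
    proof -
      have "l \<notin> complex_of_real ` {-2..2}" "is_eigenvalue D l"
        using l by (auto simp: discrete_spectrum_def)
      then obtain z x where z: "z \<noteq> 0" "cmod z < 1" "l = z + 1 / z"
        and x: "x \<in> l2" "x \<noteq> (\<lambda>_. 0)" "mat_op D x = (\<lambda>i. l * x i)"
        unfolding is_eigenvalue_def by (metis joukowski_surj)
      obtain S where S: "\<And>n. cmod (x n) \<le> S" using l2_bounded[OF x(1)] by blast
      define s where "s n = x (Suc n)" for n
      have snz: "s \<noteq> (\<lambda>_. 0)"
      proof
        assume "s = (\<lambda>_. 0)"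
        then have "x (Suc n) = 0" for n unfolding s_def by meson
        moreover have "x 0 = 0" using x(1) by (simp add: l2_def)
        ultimately have "x n = 0" for n by (cases n) auto
        then show False using x(2) by auto
      qed
      have eq: "s (n + p) + (if n \<ge> p then s (n - p) else 0) + (\<Sum>m\<le>n + p. V n m * s m) = (z + 1 / z) * s n" for n
      proof -
        have "(z + 1 / z) * s n = mat_op D x (Suc n)" using x(3) z(3) by (simp add: s_def)
        also have "\<dots> = (\<Sum>j\<in>{Suc 0..Suc (n + p)}. D (Suc n) j * x j)"
          by (subst mat_op_banded[OF band]) auto
        also have "\<dots> = (\<Sum>m\<in>{0..n + p}. D (Suc n) (Suc m) * s m)"
          unfolding s_def by (rule sum.shift_bounds_cl_Suc_ivl)
        also have "\<dots> = (\<Sum>m\<le>n + p. V n m * s m + (if N n m then s m else 0))"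
        proof (rule sum.cong)
          fix m assume "m \<in> {..n + p}"
          show "D (Suc n) (Suc m) * s m = V n m * s m + (if N n m then s m else 0)"
          proof (cases "\<bar>int n - int m\<bar> \<le> int p")
            case False
            then have "D (Suc n) (Suc m) = 0" using band unfolding banded_def by simp
            then show ?thesis using False by (simp add: V_def N_def)
          qed (simp add: V_def algebra_simps)
        qed auto
        also have "\<dots> = (\<Sum>m\<le>n + p. V n m * s m) + (\<Sum>m\<le>n + p. if N n m then s m else 0)"
          by (rule sum.distrib)
        \<comment> \<open>As \<open>p \<ge> 1\<close>, the positions \<open>n + p\<close> and
          \<open>n - p\<close> differ, so the indicator splits into two; the guard
          \<open>n \<ge> p\<close> stops truncated subtraction from inventing a neighbour.\<close>
        also have "(\<Sum>m\<le>n + p. if N n m then s m else 0)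
          = (\<Sum>m\<le>n + p. (if m = n + p then s (n + p) else 0) + (if n \<ge> p \<and> m = n - p then s (n - p) else 0))"
          by (rule sum.cong) (use p in \<open>auto simp: N_def\<close>)
        also have "\<dots> = s (n + p) + (if n \<ge> p then s (n - p) else 0)"
          unfolding sum.distrib by (cases "n \<ge> p") (auto simp: sum.delta)
        finally show ?thesis by (simp add: add_ac)
      qed
      have "(\<Sum>k. a k * z ^ k) = 0"
        by (rule ker[OF z(2,1) _ snz eq]) (use S in \<open>auto simp: s_def\<close>)
      then show ?thesis using z by blast
    qed
    then show thesis using that[OF a] by blast
  qed
qed

theorem theorem1p2:
  fixes p :: nat and D :: "nat \<Rightarrow> nat \<Rightarrow> complex"
  assumes "p \<ge> 1"
  shows "(\<forall>\<beta>::real. 0 < \<beta> \<and> \<beta> < 1/2 \<and> D \<in> P_class p \<beta> \<longrightarrow>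
            E_set D \<subseteq> complex_of_real ` {-2..2} \<and>
            closed (E_set D) \<and>
            Re ` E_set D \<in> null_sets lebesgue \<and>
            hausdorff_dim (E_set D) \<le> convergence_exponent (Re ` E_set D) \<and>
            convergence_exponent (Re ` E_set D) \<le> ereal ((1 - 2 * \<beta>) / (1 - \<beta>))) \<and>
         (D \<in> P_class p (1/2) \<longrightarrow>
            E_set D = {} \<and> finite (discrete_spectrum D))"
proof (intro conjI allI impI)
  assume D: "D \<in> P_class p (1/2)"
  obtain a M \<kappa> where a: "\<kappa> > 0" "\<And>k. cmod (a k) \<le> M * exp (- \<kappa> * real k powr (1/2))" "a 0 = 1"
    "\<And>l. l \<in> discrete_spectrum D \<Longrightarrow> \<exists>z. z \<noteq> 0 \<and> cmod z < 1 \<and> l = z + 1 / z \<and> (\<Sum>k. a k * z ^ k) = 0"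
    by (rule eigenvalue_series[OF assms _ _ D]) auto
  have s: "stretched_series a M \<kappa> (1/2)" by unfold_locales (use a in auto)
  interpret jost_zeros a M \<kappa> "1/2" "discrete_spectrum D"
    by (intro jost_zeros.intro s, unfold_locales) (use a in \<open>auto simp: stretched_series.F_def[OF s]\<close>)
  have "\<alpha> = 1" by (simp add: \<alpha>_def)
  then show "E_set D = {}" "finite (discrete_spectrum D)"
    using finite_Lambda unfolding E_set_def by auto
next
  fix \<beta> :: real
  assume h: "0 < \<beta> \<and> \<beta> < 1/2 \<and> D \<in> P_class p \<beta>"
  then have b: "0 < \<beta>" "\<beta> < 1" "D \<in> P_class p \<beta>" by auto
  obtain a M \<kappa> where a: "\<kappa> > 0" "\<And>k. cmod (a k) \<le> M * exp (- \<kappa> * real k powr \<beta>)" "a 0 = 1"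
    "\<And>l. l \<in> discrete_spectrum D \<Longrightarrow> \<exists>z. z \<noteq> 0 \<and> cmod z < 1 \<and> l = z + 1 / z \<and> (\<Sum>k. a k * z ^ k) = 0"
    by (rule eigenvalue_series[OF assms b]) auto
  have s: "stretched_series a M \<kappa> \<beta>" by unfold_locales (use a b in auto)
  interpret jost_zeros a M \<kappa> \<beta> "discrete_spectrum D"
    by (intro jost_zeros.intro s, unfold_locales) (use a in \<open>auto simp: stretched_series.F_def[OF s]\<close>)
  have XE: "Re ` E_set D = X" "E_set D = complex_of_real ` X"
    using X_E by (auto simp: E_set_def X_def)
  interpret c: compact_in_interval X by unfold_locales (rule X_compact, rule X_sub)
  have \<alpha>: "0 < 1 - \<alpha>" "1 - \<alpha> < 1" "1 - \<alpha> = (1 - 2 * \<beta>) / (1 - \<beta>)"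
    using h \<alpha>_pos by (auto simp: \<alpha>_def field_simps)
  have hits: "real (card (c.hits m)) * (4 / real m) powr (1 - \<alpha>) \<le> 2 powr (1 - \<alpha>) * K1" if m: "m \<ge> 1" for m
  proof -
    have "(\<Sum>i\<in>c.hits m. (c.grid m (Suc i) - c.grid m i) powr (1 - \<alpha>)) \<le> 2 powr (1 - \<alpha>) * K1"
      by (rule carleson_X) (use \<alpha> c.grid_bounds c.grid_less c.grid_disjoint in \<open>auto simp: c.hits_def\<close>)
    then show ?thesis by (simp add: c.grid_step)
  qed
  have null: "emeasure lborel X = 0" by (rule c.null_of_hits[OF \<alpha>(2) hits])
  have sum: "(\<lambda>l. measure lborel l powr (1 - \<alpha>)) summable_on c.gaps"
  proof (rule c.summable_gaps[OF \<alpha>(1)])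
    fix L assume L: "finite L" "L \<subseteq> c.gaps" "X \<noteq> {}"
    show "(\<Sum>l\<in>L. (Sup l - Inf l) powr (1 - \<alpha>)) \<le> 2 powr (1 - \<alpha>) * K1"
    proof (rule carleson_X)
      show "{Inf i<..<Sup i} \<inter> {Inf j<..<Sup j} = {}" if "i \<in> L" "j \<in> L" "i \<noteq> j" for i j
        using c.gap_disjoint[of i j] that L(2) by blast
      show "X \<inter> {Inf j..Sup j} \<noteq> {}" if "j \<in> L" for j
        using c.gap_touches[of j] that L by blast
    qed (use \<alpha> L c.gap_bounds c.gap_length_pos in auto)
  qed
  show "E_set D \<subseteq> complex_of_real ` {-2..2}" unfolding XE(2) using X_sub by blast
  show "closed (E_set D)" unfolding E_set_def by (rule closed_limpts)
  have "X \<in> null_sets lborel" using null X_compact by (auto simp: null_sets_def borel_compact)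
  then show "Re ` E_set D \<in> null_sets lebesgue" unfolding XE(1) by (rule null_sets_completionI)
  show "hausdorff_dim (E_set D) \<le> convergence_exponent (Re ` E_set D)"
    \<comment> \<open>The order matters: rewriting with \<open>XE(2)\<close> first would destroy the
      term that \<open>XE(1)\<close> matches.\<close>
    unfolding XE(1) unfolding XE(2) by (rule c.hausdorff_dim_le_convergence_exponent[OF null \<alpha>(1,2) sum])
  show "convergence_exponent (Re ` E_set D) \<le> ereal ((1 - 2 * \<beta>) / (1 - \<beta>))"
    unfolding XE(1) convergence_exponent_def \<alpha>(3)[symmetric] by (rule INF_lower) (use \<alpha> sum in auto)
qed

end
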